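(* Let $n\ge 3$ and let $Z\subset\mathbb{P}^{n-1}$ be a zero-dimensional scheme with $$s=\Delta H(R/I_Z,d)=\Delta H(R/I_Z,d+1)>\Delta H(R/I_Z,d+2)$$ for some $d>r_2(R/I_Z)$. Let $C$ be the unmixed curve of degree $s$ given by the unmixed one-dimensional part of the curve defined by the ideal $\langle (I_Z)_{\le d}\rangle$, and assume that $C$ is reduced and irreducible and contains all of $Z$. Then $$\Delta H(R/I_Z,t)>\Delta H(R/I_Z,t+1)\quad\text{for all } t\ge d+1 \text{ as long as } \Delta H(R/I_Z,t)>0.\qquad( * )$$ In particular, suppose that $Z$ is a reduced set of points with the Uniform Position Property satisfying the same numerical hypotheses. Then if $C$ is reduced and irreducible, $( * )$ holds.
   Context: $K$ is a field of characteristic $0$, $R=K[x_1,\dots,x_n]$ with the standard grading, $\mathbb{P}^{n-1}=\operatorname{Proj} R$. $I_Z\subset R$ is the saturated homogeneous ideal of $Z$, $H(R/I,t)=\dim_K(R/I)_t$, $\Delta H(R/I,t)=H(R/I,t)-H(R/I,t-1)$. For a homogeneous ideal $I$ and $s\ge\dim(R/I)$, $r_s(R/I)=\max\{k : H(R/(I+J),k)\ne 0\}$, where $J$ is generated by $s$ general linear forms. $\langle (I_Z)_{\le d}\rangle$ is the ideal generated by the elements of $I_Z$ of degree $\le d$; under the numerical hypotheses of the statement it is a saturated ideal defining a one-dimensional scheme (curve) of degree $s$, possibly with zero-dimensional components, and its unmixed one-dimensional part is obtained by discarding the zero-dimensional primary components. A finite set of points has the Uniform Position Property (UPP) if any two of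 its subsets of the same cardinality have the same Hilbert function. *)

theory Defs
  imports Complex_Main "HOL-Library.Poly_Mapping" "HOL-Library.Cardinality"
begin

section \<open>The polynomial ring\<close>

text \<open>
  The polynomial ring \<open>R = K[x_i | i :: 'n]\<close> is the whole type \<open>('n, 'k) mpoly\<close>; the
  finite index type \<open>'n\<close> provides the \<open>n = CARD('n)\<close> variables.
\<close>

type_synonym ('n, 'k) mpoly = "('n \<Rightarrow>\<^sub>0 nat) \<Rightarrow>\<^sub>0 'k"

definition var :: "'n \<Rightarrow> ('n, 'k::comm_ring_1) mpoly" where
  "var i = Poly_Mapping.single (Poly_Mapping.single i 1) 1"

definition smult :: "'k::comm_ring_1 \<Rightarrow> ('n, 'k) mpoly \<Rightarrow> ('n, 'k) mpoly" where
  "smult c p = Poly_Mapping.single 0 c * p"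

definition mdeg :: "('n::finite \<Rightarrow>\<^sub>0 nat) \<Rightarrow> nat" where
  "mdeg m = (\<Sum>i\<in>UNIV. Poly_Mapping.lookup m i)"

definition forms :: "nat \<Rightarrow> ('n::finite, 'k::comm_ring_1) mpoly set" where
  "forms t = {p. \<forall>m\<in>Poly_Mapping.keys p. mdeg m = t}"

global_interpretation mpoly: vector_space "smult :: 'k::field \<Rightarrow> ('n, 'k) mpoly \<Rightarrow> _"
  by standard
    (simp_all add: smult_def distrib_left distrib_right single_add mult_single
      mult.assoc[symmetric])

global_interpretation ring_module: module "(*) :: 'a::comm_ring_1 \<Rightarrow> 'a \<Rightarrow> 'a"
  by standard (simp_all add: algebra_simps)

section \<open>Ideals\<close>

abbreviation is_ideal :: "'a::comm_ring_1 set \<Rightarrow> bool" where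
  "is_ideal \<equiv> ring_module.subspace"

abbreviation ideal_gen :: "'a::comm_ring_1 set \<Rightarrow> 'a set" where
  "ideal_gen \<equiv> ring_module.span"

definition prime_ideal :: "'a::comm_ring_1 set \<Rightarrow> bool" where
  "prime_ideal P \<longleftrightarrow> is_ideal P \<and> P \<noteq> UNIV \<and> (\<forall>a b. a * b \<in> P \<longrightarrow> a \<in> P \<or> b \<in> P)"

definition primary_ideal :: "'a::comm_ring_1 set \<Rightarrow> bool" where
  "primary_ideal Q \<longleftrightarrow> is_ideal Q \<and> Q \<noteq> UNIV \<and>
     (\<forall>a b. a * b \<in> Q \<longrightarrow> a \<in> Q \<or> (\<exists>k. b ^ k \<in> Q))"

definition radical :: "'a::comm_ring_1 set \<Rightarrow> 'a set" where
  "radical I = {f. \<exists>k. f ^ k \<in> I}"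

definition homogeneous_ideal :: "('n::finite, 'k::field) mpoly set \<Rightarrow> bool" where
  "homogeneous_ideal I \<longleftrightarrow> is_ideal I \<and> I = ideal_gen (\<Union>t. I \<inter> forms t)"

definition irrelevant :: "('n::finite, 'k::field) mpoly set" where
  "irrelevant = ideal_gen (range var)"

definition saturation :: "('n::finite, 'k::field) mpoly set \<Rightarrow> ('n, 'k) mpoly set" where
  "saturation I = {f. \<exists>k. \<forall>g\<in>forms k. g * f \<in> I}"

definition ideal_le :: "nat \<Rightarrow> ('n::finite, 'k::field) mpoly set \<Rightarrow> ('n, 'k) mpoly set" where
  "ideal_le d I = ideal_gen (\<Union>e\<in>{..d}. I \<inter> forms e)"

section \<open>Hilbert functions\<close>

text \<open>
  For a homogeneous ideal \<open>I\<close> the component \<open>(R/I)_t\<close> is \<open>R_t / (I \<inter> R_t)\<close>, a quotient of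
  finite-dimensional spaces. Lemma \<open>hilbert_eq_card_basis\<close> confirms that the value below is
  the cardinality of any basis of that quotient.
\<close>

definition hilbert :: "('n::finite, 'k::field) mpoly set \<Rightarrow> nat \<Rightarrow> nat" where
  "hilbert I t = mpoly.dim (forms t :: ('n, 'k) mpoly set) - mpoly.dim (I \<inter> forms t)"

text \<open>\<open>H(R/I, -1) = 0\<close>, hence the case distinction.\<close>

definition delta_hilbert :: "('n::finite, 'k::field) mpoly set \<Rightarrow> nat \<Rightarrow> int" where
  "delta_hilbert I t = int (hilbert I t) - (if t = 0 then 0 else int (hilbert I (t - 1)))"

lemma finite_mdeg: "finite {m :: 'n::finite \<Rightarrow>\<^sub>0 nat. mdeg m = t}"
proof (rule finite_imageD)
  have "Poly_Mapping.lookup ` {m :: 'n \<Rightarrow>\<^sub>0 nat. mdeg m = t} \<subseteq> {f. \<forall>i. f i \<in> {..t}}"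
    unfolding mdeg_def by (auto intro!: member_le_sum)
  moreover have "finite {f :: 'n \<Rightarrow> nat. \<forall>i. f i \<in> {..t}}"
    using finite_set_of_finite_funs[of "UNIV :: 'n set" "{..t}"] by simp
  ultimately show "finite (Poly_Mapping.lookup ` {m :: 'n \<Rightarrow>\<^sub>0 nat. mdeg m = t})"
    by (rule finite_subset)
  show "inj_on Poly_Mapping.lookup {m :: 'n \<Rightarrow>\<^sub>0 nat. mdeg m = t}"
    by (simp add: inj_on_def poly_mapping_eqI)
qed

lemma subspace_forms: "mpoly.subspace (forms t :: ('n::finite, 'k::field) mpoly set)"
proof (rule mpoly.subspaceI)
  fix x y :: "('n, 'k) mpoly" assume "x \<in> forms t" "y \<in> forms t"
  then show "x + y \<in> forms t"
    using Poly_Mapping.keys_add[of x y] by (auto simp: forms_def)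
next
  fix c and x :: "('n, 'k) mpoly" assume "x \<in> forms t"
  then show "smult c x \<in> forms t"
    using keys_mult[of "Poly_Mapping.single 0 c" x]
    by (auto simp: forms_def smult_def split: if_splits)
qed (simp add: forms_def)

lemma forms_subset_span:
  "(forms t :: ('n::finite, 'k::field) mpoly set)
     \<subseteq> mpoly.span ((\<lambda>m. Poly_Mapping.single m 1) ` {m. mdeg m = t})"
proof
  fix p :: "('n, 'k) mpoly" assume p: "p \<in> forms t"
  have "p = (\<Sum>m\<in>Poly_Mapping.keys p. smult (Poly_Mapping.lookup p m) (Poly_Mapping.single m 1))"
    by (rule poly_mapping_eqI)
      (auto simp: smult_def mult_single lookup_sum lookup_single when_def in_keys_iff)
  moreover have "\<dots> \<in> mpoly.span ((\<lambda>m. Poly_Mapping.single m 1) ` {m. mdeg m = t})"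
    using p by (intro mpoly.span_sum mpoly.span_scale mpoly.span_base) (auto simp: forms_def)
  ultimately show "p \<in> mpoly.span ((\<lambda>m. Poly_Mapping.single m 1) ` {m. mdeg m = t})"
    by simp
qed

lemma hilbert_eq_card_basis:
  fixes I :: "('n::finite, 'k::field) mpoly set"
  assumes I: "is_ideal I"
    and B: "B \<subseteq> forms t" "mpoly.independent B"
    and indep: "mpoly.span B \<inter> I = {0}"
    and spans: "\<And>f. f \<in> forms t \<Longrightarrow> \<exists>g\<in>mpoly.span B. f - g \<in> I"
  shows "finite B" "card B = hilbert I t"
proof -
  let ?F = "forms t :: ('n, 'k) mpoly set"
  have fin: "finite S" if "S \<subseteq> ?F" "mpoly.independent S" for S
    using mpoly.independent_span_bound[OF _ that(2)] that(1) forms_subset_span[of t]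
      finite_mdeg[of t, where 'n = 'n] by blast
  show fB: "finite B" using fin B by blast
  have sI: "mpoly.subspace I"
    using I unfolding mpoly.subspace_def ring_module.subspace_def smult_def by auto
  have sIF: "mpoly.subspace (I \<inter> ?F)"
    using sI subspace_forms by (rule mpoly.subspace_inter)
  obtain A where A: "A \<subseteq> I \<inter> ?F" "mpoly.independent A" "I \<inter> ?F \<subseteq> mpoly.span A"
    "card A = mpoly.dim (I \<inter> ?F)"
    using mpoly.basis_exists by blast
  have fA: "finite A" using fin A by blast
  have spanA: "mpoly.span A = I \<inter> ?F"
    using mpoly.span_minimal[OF A(1) sIF] A(3) by (rule subset_antisym)
  have spanB: "mpoly.span B \<subseteq> ?F"
    using mpoly.span_minimal[OF B(1) subspace_forms] .
  have meet: "mpoly.span A \<inter> mpoly.span B = {0}"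
    using spanA indep mpoly.span_zero by blast
  have disj: "A \<inter> B = {}"
  proof (rule ccontr)
    assume "A \<inter> B \<noteq> {}"
    then obtain x where x: "x \<in> A" "x \<in> B" by blast
    then have "x \<in> mpoly.span A \<inter> mpoly.span B" by (simp add: mpoly.span_base)
    then have "x = 0" using meet by simp
    then show False using x(1) A(2) mpoly.dependent_zero[of A] by simp
  qed
  have ind: "mpoly.independent (A \<union> B)"
  proof (rule mpoly.independent_if_scalars_zero)
    show "finite (A \<union> B)" using fA fB by simp
    fix u x assume s: "(\<Sum>x\<in>A \<union> B. smult (u x) x) = 0" and x: "x \<in> A \<union> B"
    let ?a = "\<Sum>x\<in>A. smult (u x) x" and ?b = "\<Sum>x\<in>B. smult (u x) x"
    have "?a + ?b = 0"
      using s sum.union_disjoint[OF fA fB disj, of "\<lambda>x. smult (u x) x"] by simp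
    then have ab: "?a = - ?b" by (simp add: eq_neg_iff_add_eq_0)
    have "?a \<in> mpoly.span A" "?b \<in> mpoly.span B"
      by (intro mpoly.span_sum mpoly.span_scale mpoly.span_base, assumption)+
    then have "?a \<in> mpoly.span A \<inter> mpoly.span B"
      using ab mpoly.span_neg by auto
    then have "?a = 0" "?b = 0" using meet ab by auto
    then show "u x = 0"
      using x mpoly.independentD[OF A(2) fA subset_refl, of u x]
        mpoly.independentD[OF B(2) fB subset_refl, of u x] by (elim UnE) simp_all
  qed
  have "?F \<subseteq> mpoly.span (A \<union> B)"
  proof
    fix f assume f: "f \<in> ?F"
    then obtain g where g: "g \<in> mpoly.span B" "f - g \<in> I" using spans by blast
    have "f - g \<in> mpoly.span A"
      using g spanA spanB f mpoly.subspace_diff[OF subspace_forms] by blast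
    then have "(f - g) + g \<in> mpoly.span (A \<union> B)"
      using g by (meson mpoly.span_add mpoly.span_mono Un_upper1 Un_upper2 subsetD)
    then show "f \<in> mpoly.span (A \<union> B)" by simp
  qed
  then have "mpoly.dim ?F = card (A \<union> B)"
    using mpoly.basis_card_eq_dim[OF _ _ ind, of ?F] A(1) B(1) by simp
  then show "card B = hilbert I t"
    using A(4) fA fB disj by (simp add: hilbert_def card_Un_disjoint)
qed

section \<open>General linear forms\<close>

definition poly_eval :: "('v \<Rightarrow> 'k::comm_ring_1) \<Rightarrow> ('v, 'k) mpoly \<Rightarrow> 'k" where
  "poly_eval a F = (\<Sum>m\<in>Poly_Mapping.keys F. Poly_Mapping.lookup F m *
     (\<Prod>v\<in>Poly_Mapping.keys m. a v ^ Poly_Mapping.lookup m v))"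

definition linear_form :: "('n::finite \<Rightarrow> 'k::field) \<Rightarrow> ('n, 'k) mpoly" where
  "linear_form c = (\<Sum>j\<in>UNIV. smult (c j) (var j))"

text \<open>
  \<open>P\<close> holds for \<open>s\<close> general linear forms \<open>L 0, \<dots>, L (s - 1)\<close> if it holds on a nonempty
  Zariski-open subset of the affine space of their coefficients; it suffices to consider
  principal open sets \<open>F \<noteq> 0\<close>. \<open>P\<close> is expected to depend on \<open>L\<close> only below \<open>s\<close>.
\<close>

definition for_general_linear_forms ::
    "nat \<Rightarrow> ((nat \<Rightarrow> ('n::finite, 'k::field) mpoly) \<Rightarrow> bool) \<Rightarrow> bool" where
  "for_general_linear_forms s P \<longleftrightarrow>
     (\<exists>F :: (nat \<times> 'n, 'k) mpoly. F \<noteq> 0 \<and>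
        (\<forall>m\<in>Poly_Mapping.keys F. Poly_Mapping.keys m \<subseteq> {..<s} \<times> UNIV) \<and>
        (\<forall>a. poly_eval a F \<noteq> 0 \<longrightarrow> P (\<lambda>i. linear_form (\<lambda>j. a (i, j)))))"

text \<open>
  \<open>is_r s I k\<close> says \<open>r_s(R/I) = k\<close>. Over an infinite field two nonempty open sets of
  coefficients meet, so \<open>k\<close> is unique. Note that \<open>I + J\<close> is generated by \<open>I \<union> {L i | i < s}\<close>.
\<close>

definition is_r :: "nat \<Rightarrow> ('n::finite, 'k::field) mpoly set \<Rightarrow> nat \<Rightarrow> bool" where
  "is_r s I k \<longleftrightarrow> for_general_linear_forms s
     (\<lambda>L. hilbert (ideal_gen (I \<union> L ` {..<s})) k \<noteq> 0 \<and>
           (\<forall>j>k. hilbert (ideal_gen (I \<union> L ` {..<s})) j = 0))"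

section \<open>Closed subschemes of projective space\<close>

text \<open>
  A closed subscheme of \<open>Proj R\<close> is represented by its saturated homogeneous ideal; inclusion
  of subschemes is reverse inclusion of ideals. The points of \<open>Proj (R/I)\<close> are the
  homogeneous primes above \<open>I\<close> not containing the irrelevant ideal.
\<close>

definition subscheme_ideal :: "('n::finite, 'k::field) mpoly set \<Rightarrow> bool" where
  "subscheme_ideal I \<longleftrightarrow> homogeneous_ideal I \<and> saturation I = I"

definition proj_points :: "('n::finite, 'k::field) mpoly set \<Rightarrow> ('n, 'k) mpoly set set" where
  "proj_points I = {P. prime_ideal P \<and> homogeneous_ideal P \<and> I \<subseteq> P \<and> \<not> irrelevant \<subseteq> P}"

text \<open>
  The dimension of \<open>Proj (R/I)\<close> is the maximal length of a chain of its points under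
  specialization, one less than the Krull dimension of \<open>R/I\<close>.
\<close>

definition has_point_chain :: "('n::finite, 'k::field) mpoly set \<Rightarrow> nat \<Rightarrow> bool" where
  "has_point_chain I k \<longleftrightarrow>
     (\<exists>P. (\<forall>i\<le>k. P i \<in> proj_points I) \<and> (\<forall>i<k. P i \<subset> P (Suc i)))"

definition has_proj_dim :: "('n::finite, 'k::field) mpoly set \<Rightarrow> nat \<Rightarrow> bool" where
  "has_proj_dim I k \<longleftrightarrow> has_point_chain I k \<and> \<not> has_point_chain I (Suc k)"

definition reduced_subscheme :: "('n::finite, 'k::field) mpoly set \<Rightarrow> bool" where
  "reduced_subscheme I \<longleftrightarrow> radical I = I"

text \<open>
  Irreducibility of the underlying topological space, whose closed subsets are the
  intersections with \<open>proj_points A\<close> for homogeneous ideals \<open>A\<close>.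
\<close>

definition irreducible_subscheme :: "('n::finite, 'k::field) mpoly set \<Rightarrow> bool" where
  "irreducible_subscheme I \<longleftrightarrow> proj_points I \<noteq> {} \<and>
     (\<forall>A B. homogeneous_ideal A \<longrightarrow> homogeneous_ideal B \<longrightarrow>
        proj_points I \<subseteq> proj_points A \<union> proj_points B \<longrightarrow>
        proj_points I \<subseteq> proj_points A \<or> proj_points I \<subseteq> proj_points B)"

definition primary_decomposition ::
    "('n::finite, 'k::field) mpoly set set \<Rightarrow> ('n, 'k) mpoly set \<Rightarrow> bool" where
  "primary_decomposition \<Q> J \<longleftrightarrow>
     finite \<Q> \<and> (\<forall>Q\<in>\<Q>. primary_ideal Q \<and> homogeneous_ideal Q) \<and>
     \<Inter>\<Q> = J \<and> (\<forall>Q\<in>\<Q>. \<Inter>(\<Q> - {Q}) \<noteq> J) \<and> inj_on radical \<Q>"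

text \<open>
  \<open>C\<close> is the unmixed one-dimensional part of the one-dimensional scheme defined by \<open>J\<close>. Its
  one-dimensional primary components are isolated, so \<open>C\<close> does not depend on the
  decomposition.
\<close>

definition unmixed_curve_part ::
    "('n::finite, 'k::field) mpoly set \<Rightarrow> ('n, 'k) mpoly set \<Rightarrow> bool" where
  "unmixed_curve_part J C \<longleftrightarrow>
     (\<exists>\<Q>. primary_decomposition \<Q> J \<and> C = \<Inter>{Q \<in> \<Q>. has_proj_dim Q 1})"

text \<open>
  A reduced zero-dimensional scheme is the finite set \<open>proj_points I\<close> of its (closed) points,
  and the ideal of a subset of it is the intersection of the corresponding primes.
\<close>

definition uniform_position :: "('n::finite, 'k::field) mpoly set \<Rightarrow> bool" where
  "uniform_position I \<longleftrightarrow>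
     (\<forall>V W. V \<subseteq> proj_points I \<longrightarrow> W \<subseteq> proj_points I \<longrightarrow> finite V \<longrightarrow> finite W \<longrightarrow>
        card V = card W \<longrightarrow> hilbert (\<Inter>V) = hilbert (\<Inter>W))"

end

(* Write h(t) for the first difference of the Hilbert function of R/I, where I is the ideal of Z.
   Past r_2 the function h does not increase, so if strict decrease fails at t then
   h(t) = h(t+1) = m with 0 < m < s. For a general pencil (L1, L2), with L1 a nonzerodivisor on R/I
   in the relevant degrees, the flat spots at d and at t make the Bayer-Stillman criterion applicable
   to the ideals J = <I_{<=d}> and J' = <I_{<=t}>, where J lies in J'; hence the Hilbert functions of
   their quotients grow linearly, with slopes s and m. Now J is the intersection of the prime
   ideal of C with components whose Hilbert functions are bounded. If J' is contained in the ideal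
   of C, then R/J' grows at least with slope s > m. Otherwise a form f in J' outside the ideal of C
   is a nonzerodivisor modulo that ideal, so R/(J + f), and with it R/J', has bounded Hilbert
   function, contradicting m > 0. *)

theory Submission
  imports Defs "HOL-Computational_Algebra.Polynomial"
begin

text \<open>The Bayer-Stillman step is a vanishing of first Koszul homology carried down the chain
  of ideals (L1, L2), (L1), 0. Modulo both forms the truncated ideal fills all degrees from t on,
  since t lies past r_2, so there the Koszul complex is that of a polynomial ring; each descent uses
  one colon condition in degree t and yields it in all later degrees. The first condition is
  injectivity of L1 on R/I, the second comes from the flat step: L2 is then a surjection between
  spaces of equal dimension. Only the ideal (L1, L2) enters r_2, so L1 may be moved inside the
  pencil; saturation and finite dimension of a graded piece provide an injective choice. Dimension
  is defined by chains of homogeneous primes, whereas the argument needs sizes of Hilbert functions.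
  The bridge: a chain of three points forces more than linear growth, and the components of J
  inherit the linear bound of R/J; so a component that is not a curve has no chain of two points,
  which bounds its Hilbert function. Quotients appear only as images of linear maps and as
  congruences.\<close>

hide_const (open) Polynomial.smult

(* As a simp rule a * (b * x) = (a * b) * x it loops with the AC laws of multiplication. *)
declare ring_module.scale_scale [simp del]

section \<open>Rank-nullity\<close>

context vector_space
begin

text \<open>Send a basis of \<open>U\<close> to 0 and fix the rest of an extended basis. The
  quotient by \<open>U\<close> can then be replaced by the image of \<open>p\<close>, which is how
  graded pieces of R/I are measured.\<close>

lemma ex_linear_kernel:
  assumes "subspace U"
  shows "\<exists>p. Vector_Spaces.linear scale scale p \<and> (\<forall>x. p x = 0 \<longleftrightarrow> x \<in> U)"
proof -
  interpret vp: vector_space_pair scale scale ..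
  obtain A where A: "A \<subseteq> U" "independent A" "U \<subseteq> span A"
    using maximal_independent_subset[of U] by blast
  have spanA: "span A = U"
    using A assms by (simp add: span_subspace)
  let ?B = "extend_basis A"
  have B: "A \<subseteq> ?B" "independent ?B" "span ?B = UNIV"
    using A(2) extend_basis_superset independent_extend_basis span_extend_basis by auto
  define p where "p = vp.construct ?B (\<lambda>b. if b \<in> A then 0 else b)"
  have lin: "Vector_Spaces.linear scale scale p"
    unfolding p_def using B(2) by (rule vp.linear_construct)
  have pb: "p b = (if b \<in> A then 0 else b)" if "b \<in> ?B" for b
    unfolding p_def using vp.construct_basis[OF B(2) that] .
  interpret p: Vector_Spaces.linear scale scale p by (rule lin)
  have pA: "p x = 0" if "x \<in> span A" for x
  proof (rule p.eq_0_on_span[OF _ that])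
    show "p b = 0" if "b \<in> A" for b using pb that B(1) by auto
  qed
  \<comment> \<open>\<open>p\<close> moves each vector only within \<open>U\<close>, so its kernel
    is no larger than \<open>U\<close>.\<close>
  have p2: "x - p x \<in> span A" for x
  proof -
    have "x \<in> span ?B" using B(3) by simp
    then show ?thesis
    proof (induction rule: span_induct_alt)
      case base
      then show ?case by (simp add: span_zero)
    next
      case (step c x y)
      have "x - p x \<in> span A"
        using pb[OF step(1)] by (auto simp: span_zero span_base)
      then have "scale c (x - p x) + (y - p y) \<in> span A"
        using step(2) by (intro span_add span_scale)
      then show ?case
        by (simp add: p.add p.scale algebra_simps scale_right_diff_distrib)
    qed
  qed
  have "p x = 0 \<longleftrightarrow> x \<in> U" for x
    using pA[of x] p2[of x] spanA by auto
  then show ?thesis using lin by blast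
qed

text \<open>The whole polynomial ring is infinite-dimensional; a finite set \<open>S\<close> whose
  span contains the spaces in question supplies the finiteness that cardinalities need.\<close>

lemma independent_card_le_dim_finite:
  assumes "finite S" "W \<subseteq> span S" "A \<subseteq> W" "independent A"
  shows "finite A" "card A \<le> dim W"
proof -
  obtain B where B: "B \<subseteq> W" "independent B" "W \<subseteq> span B" "card B = dim W"
    using basis_exists by blast
  have "finite B"
    using independent_span_bound[OF assms(1) B(2)] B(1) assms(2) by auto
  then show "finite A" "card A \<le> dim W"
    using independent_span_bound[OF _ assms(4), of B] assms(3) B(3,4) by auto
qed

lemma dim_mono_finite:
  assumes "finite S" "W \<subseteq> span S" "V \<subseteq> W"
  shows "dim V \<le> dim W"
proof -
  obtain A where A: "A \<subseteq> V" "independent A" "V \<subseteq> span A" "card A = dim V"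
    using basis_exists by blast
  then show ?thesis
    using independent_card_le_dim_finite[OF assms(1,2) _ A(2)] assms(3) by auto
qed

text \<open>A basis of the kernel is extended to one of \<open>V\<close>; the added vectors
  \<open>C\<close> map injectively onto a basis of the image.\<close>

lemma dim_kernel_image:
  assumes lin: "Vector_Spaces.linear scale scale p" and V: "subspace V"
    and S: "V \<subseteq> span S" "finite S"
  shows "dim V = dim {x \<in> V. p x = 0} + dim (p ` V)"
proof -
  interpret vp: vector_space_pair scale scale ..
  interpret p: Vector_Spaces.linear scale scale p by (rule lin)
  let ?N = "{x \<in> V. p x = 0}"
  obtain A where A: "A \<subseteq> ?N" "independent A" "?N \<subseteq> span A" "card A = dim ?N"
    using basis_exists by blast
  obtain B where B: "A \<subseteq> B" "B \<subseteq> V" "independent B" "V \<subseteq> span B"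
    using maximal_independent_subset_extend[OF _ A(2), of V] A(1) by auto
  have fB: "finite B" using independent_span_bound[OF S(2) B(3)] B(2) S(1) by auto
  define C where "C = B - A"
  have C: "C \<subseteq> B" "independent C" "A \<inter> C = {}" "B = A \<union> C"
    using B(1) independent_mono[OF B(3)] by (auto simp: C_def)
  have spC: "span C \<subseteq> V" using B(2) C(1) V by (intro span_minimal) auto
  have inj: "inj_on p (span C)"
  proof (subst p.inj_on_iff_eq_0)
    show "subspace (span C)" by simp
    show "\<forall>x\<in>span C. p x = 0 \<longrightarrow> x = 0"
    proof (intro ballI impI)
      fix x assume x: "x \<in> span C" "p x = 0"
      then have xA: "x \<in> span A" using spC A(3) by auto
      \<comment> \<open>A vector in both spans has the same coordinates with respect to
        \<open>A\<close>, \<open>B\<close> and \<open>C\<close>; as \<open>A\<close> and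
        \<open>C\<close> are disjoint, all of them vanish.\<close>
      have r: "representation B x = representation A x" "representation B x = representation C x"
        using representation_extend[OF B(3) xA B(1)] representation_extend[OF B(3) x(1) C(1)] by auto
      have "representation A x b = 0" for b
        using r C(3) representation_ne_zero by (metis disjoint_iff)
      then show "x = 0"
        using sum_nonzero_representation_eq[OF A(2) xA] by simp
    qed
  qed
  have ind: "independent (p ` C)"
    using p.independent_injective_image[OF C(2) inj] .
  have "p ` V \<subseteq> span (p ` C)"
  proof
    fix y assume "y \<in> p ` V"
    then obtain x where x: "x \<in> span (A \<union> C)" "y = p x" using B(4) C(4) by auto
    then obtain a c where "a \<in> span A" "c \<in> span C" "x = a + c"
      unfolding span_Un by blast
    moreover have "p a = 0" if "a \<in> span A" for a
      using p.eq_0_on_span[OF _ that] A(1) by auto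
    ultimately have "y = p c" using x by (simp add: p.add)
    then show "y \<in> span (p ` C)" using \<open>c \<in> span C\<close> p.span_image by auto
  qed
  moreover have "p ` C \<subseteq> p ` V" using C(1) B(2) by auto
  ultimately have "dim (p ` V) = card (p ` C)"
    using basis_card_eq_dim ind by metis
  also have "\<dots> = card C"
    using inj span_superset by (intro card_image) (auto intro: inj_on_subset)
  finally have "dim (p ` V) = card C" .
  moreover have "dim V = card B"
    using basis_card_eq_dim[OF B(2) B(4) B(3)] by simp
  moreover have "card B = card A + card C"
    using C fB by (metis card_Un_disjoint finite_Un)
  ultimately show ?thesis using A(4) by simp
qed

end

section \<open>Homogeneous components\<close>

lemma smult_mult_left: "smult c f * g = smult c (f * g)"
  by (simp only: Defs.smult_def mult.assoc)

lemma smult_mult_right: "f * smult c g = smult c (f * g)"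
  by (simp only: Defs.smult_def mult.left_commute)

abbreviation ideal_add :: "'a::comm_ring_1 set \<Rightarrow> 'a \<Rightarrow> 'a set" where
  "ideal_add I f \<equiv> ideal_gen (insert f I)"

lemma mem_ideal_add:
  "is_ideal I \<Longrightarrow> g \<in> ideal_add I f \<longleftrightarrow> (\<exists>r. g - r * f \<in> I)"
  by (simp add: ring_module.span_insert ring_module.span_eq_iff[THEN iffD2])

lemma is_ideal_imp_subspace: "is_ideal I \<Longrightarrow> mpoly.subspace I"
  unfolding mpoly.subspace_def ring_module.subspace_def Defs.smult_def by auto

lemma is_ideal_smult: "is_ideal I \<Longrightarrow> f \<in> I \<Longrightarrow> smult c f \<in> I"
  by (simp only: Defs.smult_def ring_module.subspace_scale)

lemma is_ideal_mult_left: "is_ideal I \<Longrightarrow> f \<in> I \<Longrightarrow> g * f \<in> I"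
  using ring_module.subspace_scale .

lemma is_ideal_colon:
  assumes I: "is_ideal I" shows "is_ideal {g. f * g \<in> I}"
proof (rule ring_module.subspaceI)
  fix c g assume "g \<in> {g. f * g \<in> I}"
  then have "f * g \<in> I" by simp
  then have "c * (f * g) \<in> I" by (rule is_ideal_mult_left[OF I])
  then show "c * g \<in> {g. f * g \<in> I}" by (metis mem_Collect_eq mult.left_commute)
qed (use I in \<open>auto simp: distrib_left ring_module.subspace_0 ring_module.subspace_add\<close>)

lemma is_ideal_mult_right: "is_ideal I \<Longrightarrow> f \<in> I \<Longrightarrow> f * g \<in> I"
  using ring_module.subspace_scale[of I f g] by (simp add: mult.commute)

definition hcomp :: "nat \<Rightarrow> ('n::finite, 'k::field) mpoly \<Rightarrow> ('n, 'k) mpoly" where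
  "hcomp k f = (\<Sum>m\<in>{m \<in> Poly_Mapping.keys f. mdeg m = k}.
     Poly_Mapping.single m (Poly_Mapping.lookup f m))"

lemma lookup_hcomp:
  "Poly_Mapping.lookup (hcomp k f) m = (if mdeg m = k then Poly_Mapping.lookup f m else 0)"
  unfolding hcomp_def lookup_sum
  by (auto simp: lookup_single when_def sum.delta' in_keys_iff cong: conj_cong)

lemma hcomp_in_forms: "hcomp k f \<in> forms k"
  by (auto simp: forms_def in_keys_iff lookup_hcomp split: if_splits)

lemma hcomp_form: "f \<in> forms e \<Longrightarrow> hcomp k f = (if k = e then f else 0)"
  by (rule poly_mapping_eqI) (auto simp: forms_def lookup_hcomp in_keys_iff)

lemma forms_iff_hcomp: "f \<in> forms e \<longleftrightarrow> hcomp e f = f"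
  by (metis hcomp_form hcomp_in_forms)

lemma hcomp_add: "hcomp k (f + g) = hcomp k f + hcomp k g"
  by (rule poly_mapping_eqI) (simp add: lookup_hcomp lookup_add)

lemma hcomp_diff: "hcomp k (f - g) = hcomp k f - hcomp k g"
  by (rule poly_mapping_eqI) (simp add: lookup_hcomp lookup_minus)

lemma hcomp_zero [simp]: "hcomp k 0 = 0"
  by (rule poly_mapping_eqI) (simp add: lookup_hcomp)

lemma hcomp_sum: "hcomp k (sum f A) = (\<Sum>a\<in>A. hcomp k (f a))"
  by (induction A rule: infinite_finite_induct) (auto simp: hcomp_add)

lemma sum_hcomp: "\<exists>D. f = (\<Sum>k<D. hcomp k f)"
proof
  let ?D = "Suc (Max (mdeg ` Poly_Mapping.keys f))"
  show "f = (\<Sum>k<?D. hcomp k f)"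
  proof (rule poly_mapping_eqI)
    fix m
    have "mdeg m < ?D" if "Poly_Mapping.lookup f m \<noteq> 0"
      using that by (simp add: less_Suc_eq_le in_keys_iff)
    then show "Poly_Mapping.lookup f m = Poly_Mapping.lookup (\<Sum>k<?D. hcomp k f) m"
      by (auto simp: lookup_sum lookup_hcomp simp del: sum.lessThan_Suc)
  qed
qed

lemma mdeg_add: "mdeg (m + m') = mdeg m + mdeg m'"
  by (simp add: mdeg_def lookup_add sum.distrib)

lemma forms_mult: "f \<in> forms a \<Longrightarrow> g \<in> forms b \<Longrightarrow> f * g \<in> forms (a + b)"
  using keys_mult[of f g] by (fastforce simp: forms_def mdeg_add)

lemmas forms_add = mpoly.subspace_add[OF subspace_forms]
lemmas forms_diff = mpoly.subspace_diff[OF subspace_forms]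
lemmas forms_0 = mpoly.subspace_0[OF subspace_forms]
lemmas forms_smult = mpoly.subspace_scale[OF subspace_forms]
lemmas forms_neg = mpoly.subspace_neg[OF subspace_forms]
lemmas forms_sum = mpoly.subspace_sum[OF subspace_forms]

lemma one_in_forms: "1 \<in> forms 0"
  by (auto simp: forms_def mdeg_def)

lemma forms_power: "f \<in> forms a \<Longrightarrow> f ^ n \<in> forms (n * a)"
  by (induction n) (auto intro: forms_mult one_in_forms)

lemma var_in_forms: "var i \<in> forms 1"
proof -
  have "mdeg (Poly_Mapping.single i 1) = 1"
    unfolding mdeg_def by (simp add: lookup_single when_def)
  then show ?thesis by (auto simp: forms_def var_def split: if_splits)
qed

lemma linear_form_in_forms: "linear_form c \<in> forms 1"
  unfolding linear_form_def by (intro forms_sum forms_smult var_in_forms)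

text \<open>Without the case distinction, the truncated difference \<open>k - e\<close> would pick
  the constant term of \<open>g\<close> when \<open>k < e\<close>.\<close>

lemma hcomp_mult_form:
  assumes "f \<in> forms e"
  shows "hcomp k (f * g) = (if e \<le> k then f * hcomp (k - e) g else 0)"
proof -
  obtain D where D: "g = (\<Sum>j<D. hcomp j g)" using sum_hcomp by blast
  have "hcomp k (f * g) = (\<Sum>j<D. hcomp k (f * hcomp j g))"
    by (subst D) (simp add: sum_distrib_left hcomp_sum)
  also have "\<dots> = (\<Sum>j<D. if k = e + j then f * hcomp j g else 0)"
    by (intro sum.cong refl) (simp add: hcomp_form[OF forms_mult[OF assms hcomp_in_forms]])
  also have "\<dots> = (if e \<le> k then f * (\<Sum>j<D. if k - e = j then hcomp j g else 0) else 0)"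
  proof (cases "e \<le> k")
    case True
    then have "k = e + j \<longleftrightarrow> k - e = j" for j by auto
    then show ?thesis using True by simp
  qed auto
  also have "(\<Sum>j<D. if k - e = j then hcomp j g else 0) = hcomp (k - e) (\<Sum>j<D. hcomp j g)"
    unfolding hcomp_sum by (intro sum.cong refl) (simp add: hcomp_form[OF hcomp_in_forms])
  finally show ?thesis using D by simp
qed

lemma homogeneous_is_ideal: "homogeneous_ideal I \<Longrightarrow> is_ideal I"
  by (simp add: homogeneous_ideal_def)

lemma homogeneous_ideal_gen:
  assumes "S \<subseteq> (\<Union>t. forms t)"
  shows "homogeneous_ideal (ideal_gen S)"
proof -
  have "S \<subseteq> (\<Union>t. ideal_gen S \<inter> forms t)"
    using assms ring_module.span_superset[of S] by blast
  then have "ideal_gen S \<subseteq> ideal_gen (\<Union>t. ideal_gen S \<inter> forms t)"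
    by (rule ring_module.span_mono)
  moreover have "ideal_gen (\<Union>t. ideal_gen S \<inter> forms t) \<subseteq> ideal_gen S"
    by (intro ring_module.span_minimal) auto
  ultimately show ?thesis by (auto simp: homogeneous_ideal_def)
qed

lemma homogeneous_hcomp:
  assumes "homogeneous_ideal I" "f \<in> I"
  shows "hcomp k f \<in> I"
proof -
  have I: "is_ideal I" using assms(1) by (rule homogeneous_is_ideal)
  have "f \<in> ideal_gen (\<Union>t. I \<inter> forms t)"
    using assms by (simp add: homogeneous_ideal_def)
  then show ?thesis
  proof (induction rule: ring_module.span_induct_alt)
    case base
    then show ?case using I by (simp add: ring_module.subspace_0)
  next
    case (step c x y)
    then obtain t where "x \<in> I" "x \<in> forms t" by auto
    then have "hcomp k (x * c) \<in> I"
      using I by (simp add: hcomp_mult_form is_ideal_mult_right ring_module.subspace_0)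
    then show ?case
      using step I by (simp add: hcomp_add ring_module.subspace_add mult.commute)
  qed
qed

lemma homogeneous_idealI:
  assumes I: "is_ideal I" and h: "\<And>f k. f \<in> I \<Longrightarrow> hcomp k f \<in> I"
  shows "homogeneous_ideal I"
proof -
  have "I \<subseteq> ideal_gen (\<Union>t. I \<inter> forms t)"
  proof
    fix f assume f: "f \<in> I"
    obtain D where D: "f = (\<Sum>j<D. hcomp j f)" using sum_hcomp by blast
    have "(\<Sum>j<D. hcomp j f) \<in> ideal_gen (\<Union>t. I \<inter> forms t)"
      using h[OF f] hcomp_in_forms by (intro ring_module.span_sum ring_module.span_base) auto
    then show "f \<in> ideal_gen (\<Union>t. I \<inter> forms t)" using D by simp
  qed
  moreover have "ideal_gen (\<Union>t. I \<inter> forms t) \<subseteq> I"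
    using I by (intro ring_module.span_minimal) auto
  ultimately show ?thesis using I by (auto simp: homogeneous_ideal_def)
qed

lemma in_ideal_if_hcomp:
  assumes "is_ideal I" "\<And>k. hcomp k f \<in> I" shows "f \<in> I"
  using sum_hcomp[of f] assms ring_module.subspace_sum by metis

lemma homogeneous_Inter:
  assumes "\<And>I. I \<in> A \<Longrightarrow> homogeneous_ideal I"
  shows "homogeneous_ideal (\<Inter>A)"
  using assms by (intro homogeneous_idealI ring_module.subspace_Inter)
    (auto intro: homogeneous_is_ideal homogeneous_hcomp)

lemma homogeneous_ideal_add:
  assumes I: "homogeneous_ideal I" and f: "f \<in> forms e"
  shows "homogeneous_ideal (ideal_add I f)"
proof (rule homogeneous_idealI)
  fix g k assume "g \<in> ideal_add I f"
  then obtain r where "g - f * r \<in> I"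
    using mem_ideal_add[OF homogeneous_is_ideal[OF I]] by (metis mult.commute)
  then have "hcomp k g - hcomp k (f * r) \<in> I"
    using homogeneous_hcomp[OF I] by (metis hcomp_diff)
  then show "hcomp k g \<in> ideal_add I f"
    unfolding hcomp_mult_form[OF f] mem_ideal_add[OF homogeneous_is_ideal[OF I]]
    by (cases "e \<le> k") (auto simp: mult.commute intro: exI[of _ 0])
qed simp

text \<open>In a representation of \<open>g\<close> as a multiple of \<open>f\<close> modulo
  \<open>I\<close>, only the component of the multiplier in the complementary degree contributes, so
  the multiplier may be taken homogeneous.\<close>

lemma ideal_add_form_decomp:
  assumes I: "homogeneous_ideal I" and f: "f \<in> forms e" and g: "g \<in> ideal_add I f"
    and gk: "g \<in> forms (k + e)"
  obtains r where "r \<in> forms k" "g - f * r \<in> I"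
proof -
  obtain r where "g - f * r \<in> I"
    using g mem_ideal_add[OF homogeneous_is_ideal[OF I]] by (metis mult.commute)
  then have "hcomp (k + e) (g - f * r) \<in> I" by (rule homogeneous_hcomp[OF I])
  then have "g - f * hcomp k r \<in> I"
    using gk by (simp add: hcomp_diff hcomp_mult_form[OF f] hcomp_form)
  then show ?thesis using that hcomp_in_forms by blast
qed

section \<open>Hilbert functions\<close>

lemma finite_monomials: "finite ((\<lambda>m :: 'n::finite \<Rightarrow>\<^sub>0 nat. Poly_Mapping.single m (1 :: 'k::field)) ` {m. mdeg m = t})"
  using finite_mdeg by blast

lemma dim_forms_split:
  fixes V :: "('n::finite, 'k::field) mpoly set" and p :: "('n, 'k) mpoly \<Rightarrow> ('n, 'k) mpoly"
  assumes "Vector_Spaces.linear smult smult p" "mpoly.subspace V" "V \<subseteq> forms t"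
  shows "mpoly.dim V = mpoly.dim {x \<in> V. p x = 0} + mpoly.dim (p ` V)"
  by (rule mpoly.dim_kernel_image[OF assms(1,2) order_trans[OF assms(3) forms_subset_span]
      finite_monomials])

lemma hilbert_eq_dim_image:
  fixes I :: "('n::finite, 'k::field) mpoly set" and p :: "('n, 'k) mpoly \<Rightarrow> ('n, 'k) mpoly"
  assumes "is_ideal I" "Vector_Spaces.linear smult smult p" "\<And>x. p x = 0 \<longleftrightarrow> x \<in> I"
  shows "hilbert I t = mpoly.dim (p ` forms t)"
  unfolding hilbert_def using dim_forms_split[OF assms(2) subspace_forms order_refl, of t] assms(3)
  by (simp add: Int_def conj_commute)

lemma dim_forms_mono:
  fixes V W :: "('n::finite, 'k::field) mpoly set"
  assumes "V \<subseteq> W" "W \<subseteq> forms t"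
  shows "mpoly.dim V \<le> mpoly.dim W"
  by (rule mpoly.dim_mono_finite[OF finite_monomials order_trans[OF assms(2) forms_subset_span]
      assms(1)])

lemma hilbert_antimono: "I \<inter> forms t \<subseteq> J \<inter> forms t \<Longrightarrow> hilbert J t \<le> hilbert I t"
  unfolding hilbert_def by (intro diff_le_mono2 dim_forms_mono) auto

lemma hilbert_cong: "I \<inter> forms t = J \<inter> forms t \<Longrightarrow> hilbert J t = hilbert I t"
  unfolding hilbert_def by simp

text \<open>A form of \<open>B\<close> outside \<open>A\<close> would enlarge a basis of the degree
  \<open>t\<close> part of \<open>A\<close>. This turns a coincidence of Hilbert functions back into
  an equality of ideals in one degree.\<close>

lemma hilbert_le_imp_subset:
  fixes A B :: "('n::finite, 'k::field) mpoly set"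
  assumes "is_ideal A" "A \<subseteq> B" and h: "hilbert A t \<le> hilbert B t"
  shows "B \<inter> forms t \<subseteq> A"
proof (rule ccontr)
  obtain S where S: "S \<subseteq> A \<inter> forms t" "mpoly.independent S"
    "A \<inter> forms t \<subseteq> mpoly.span S" "card S = mpoly.dim (A \<inter> forms t)"
    using mpoly.basis_exists by blast
  have BF: "B \<inter> forms t \<subseteq> mpoly.span ((\<lambda>m. Poly_Mapping.single m 1) ` {m. mdeg m = t})"
    using forms_subset_span by blast
  note le = mpoly.independent_card_le_dim_finite[OF finite_monomials BF]
  have spS: "mpoly.span S \<subseteq> A"
    using S(1) is_ideal_imp_subspace[OF assms(1)] by (intro mpoly.span_minimal) auto
  assume "\<not> B \<inter> forms t \<subseteq> A"
  then obtain f where f: "f \<in> B \<inter> forms t" "f \<notin> A" by blast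
  then have "f \<notin> mpoly.span S" using spS by auto
  then have ind: "mpoly.independent (insert f S)" using S(2) by (rule mpoly.independent_insertI)
  have "insert f S \<subseteq> B \<inter> forms t" using f S(1) assms(2) by auto
  then have "finite (insert f S)" "card (insert f S) \<le> mpoly.dim (B \<inter> forms t)"
    using le[OF _ ind] by auto
  moreover have "mpoly.dim (B \<inter> forms t) \<le> mpoly.dim (forms t :: ('n, 'k) mpoly set)"
    by (rule dim_forms_mono[OF Int_lower2 order_refl])
  moreover have "f \<notin> S" using f S(1) by auto
  ultimately show False using h S(4) by (simp add: hilbert_def)
qed

lemma forms_subset_iff_hilbert:
  fixes I :: "('n::finite, 'k::field) mpoly set"
  assumes "is_ideal I"
  shows "forms t \<subseteq> I \<longleftrightarrow> hilbert I t = 0"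
proof
  assume "forms t \<subseteq> I"
  then have "I \<inter> forms t = forms t" by auto
  then show "hilbert I t = 0" by (simp add: hilbert_def)
next
  assume "hilbert I t = 0"
  then show "forms t \<subseteq> I" using hilbert_le_imp_subset[OF assms, of UNIV] by auto
qed

text \<open>Additivity along the exact sequence 0 -> R/(I : f)(-e) -> R/I -> R/(I + (f)) -> 0, where
  \<open>{g. f * g \<in> I}\<close> is the colon ideal. This is the basic counting tool.\<close>

lemma hilbert_add_form:
  fixes I :: "('n::finite, 'k::field) mpoly set"
  assumes I: "homogeneous_ideal I" and f: "f \<in> forms e"
  shows "hilbert (ideal_add I f) (k + e) + hilbert {g. f * g \<in> I} k = hilbert I (k + e)"
proof -
  let ?F = "forms k :: ('n, 'k) mpoly set" and ?G = "forms (k + e) :: ('n, 'k) mpoly set"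
  have iI: "is_ideal I" using I by (rule homogeneous_is_ideal)
  obtain p :: "('n, 'k) mpoly \<Rightarrow> ('n, 'k) mpoly" where p: "Vector_Spaces.linear smult smult p" "\<And>x. p x = 0 \<longleftrightarrow> x \<in> I"
    using mpoly.ex_linear_kernel[OF is_ideal_imp_subspace[OF iI]] by blast
  interpret p: Vector_Spaces.linear smult smult p by (rule p(1))
  have q: "Vector_Spaces.linear smult smult (\<lambda>g. p (f * g))"
  proof -
    show ?thesis
      by unfold_locales (simp_all only: distrib_left smult_mult_right p.add p.scale)
  qed
  have "is_ideal {g. f * g \<in> I}"
    using iI by (rule is_ideal_colon)
  then have 1: "hilbert {g. f * g \<in> I} k = mpoly.dim ((\<lambda>g. p (f * g)) ` ?F)"
    using hilbert_eq_dim_image[OF _ q] p(2) by simp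
  have 2: "hilbert I (k + e) = mpoly.dim (p ` ?G)"
    by (rule hilbert_eq_dim_image[OF iI p])
  \<comment> \<open>Split the degree \<open>k + e\<close> part of I + (f) by \<open>p\<close>: the
    kernel is the part in \<open>I\<close>, the image is a copy of the degree \<open>k\<close> part
    of R/(I : f).\<close>
  let ?V = "ideal_add I f \<inter> ?G"
  have sV: "mpoly.subspace ?V"
    by (intro mpoly.subspace_inter subspace_forms is_ideal_imp_subspace) simp
  have 3: "mpoly.dim ?V = mpoly.dim {x \<in> ?V. p x = 0} + mpoly.dim (p ` ?V)"
    by (rule dim_forms_split[OF p(1) sV Int_lower2])
  have "p ` ?V = (\<lambda>g. p (f * g)) ` ?F"
  proof (intro subset_antisym subsetI)
    fix y assume "y \<in> p ` ?V"
    then obtain x where x: "x \<in> ?V" "y = p x" by blast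
    then obtain r where r: "r \<in> ?F" "x - f * r \<in> I" using ideal_add_form_decomp[OF I f] by blast
    then have "p x = p (f * r)" using p(2)[of "x - f * r"] by (simp add: p.diff)
    then show "y \<in> (\<lambda>g. p (f * g)) ` ?F" using x r by blast
  next
    fix y assume "y \<in> (\<lambda>g. p (f * g)) ` ?F"
    then obtain g where g: "g \<in> ?F" "y = p (f * g)" by blast
    have "f * g \<in> ideal_add I f"
      unfolding mem_ideal_add[OF iI] using iI
      by (intro exI[of _ g]) (simp add: mult.commute ring_module.subspace_0)
    moreover have "f * g \<in> ?G" using forms_mult[OF f g(1)] by (simp add: add.commute)
    ultimately show "y \<in> p ` ?V" using g by blast
  qed
  moreover have "{x \<in> ?V. p x = 0} = I \<inter> ?G"
    using p(2) ring_module.span_superset[of "insert f I"] by auto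
  ultimately have 4: "mpoly.dim ?V = mpoly.dim (I \<inter> ?G) + hilbert {g. f * g \<in> I} k"
    using 1 3 by simp
  moreover have "mpoly.dim ?V \<le> mpoly.dim ?G" by (rule dim_forms_mono[OF Int_lower2 order_refl])
  ultimately show ?thesis unfolding hilbert_def by linarith
qed

text \<open>In degree \<open>t\<close> the quotient of \<open>A\<close> by
  \<open>A \<inter> B\<close> embeds into that of R by \<open>B\<close>.\<close>

lemma hilbert_Int_le:
  fixes A :: "('n::finite, 'k::field) mpoly set"
  assumes A: "is_ideal A" and B: "is_ideal B"
  shows "hilbert (A \<inter> B) t \<le> hilbert A t + hilbert B t"
proof -
  obtain p :: "('n, 'k) mpoly \<Rightarrow> ('n, 'k) mpoly" where p: "Vector_Spaces.linear smult smult p" "\<And>x. p x = 0 \<longleftrightarrow> x \<in> B"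
    using mpoly.ex_linear_kernel[OF is_ideal_imp_subspace[OF B]] by blast
  interpret p: Vector_Spaces.linear smult smult p by (rule p(1))
  have "hilbert B t = mpoly.dim (p ` forms t)" by (rule hilbert_eq_dim_image[OF B p])
  moreover have "mpoly.dim (A \<inter> forms t) = mpoly.dim {x \<in> A \<inter> forms t. p x = 0} + mpoly.dim (p ` (A \<inter> forms t))"
    by (rule dim_forms_split[OF p(1) mpoly.subspace_inter[OF is_ideal_imp_subspace[OF A] subspace_forms]
        Int_lower2])
  moreover have "{x \<in> A \<inter> forms t. p x = 0} = (A \<inter> B) \<inter> forms t" using p(2) by auto
  moreover have "mpoly.dim (p ` (A \<inter> forms t)) \<le> mpoly.dim (p ` forms t)"
  proof -
    have "p ` forms t \<subseteq> mpoly.span (p ` (\<lambda>m. Poly_Mapping.single m 1) ` {m. mdeg m = t})"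
      using p.spans_image[OF forms_subset_span] by simp
    then show ?thesis
      by (rule mpoly.dim_mono_finite[OF finite_imageI[OF finite_monomials]]) auto
  qed
  ultimately show ?thesis by (simp add: hilbert_def)
qed

section \<open>General linear forms\<close>

text \<open>Induction on the variables, each step leaving a nonzero univariate polynomial over an
  infinite field. Exponents are plain functions and only their values on \<open>V\<close> count; the
  injectivity hypothesis says that distinct members of \<open>S\<close> give distinct monomials in
  \<open>V\<close>.\<close>

lemma ex_nonzero_value_sum:
  fixes c :: "('v \<Rightarrow> nat) \<Rightarrow> 'k::field_char_0"
  assumes "finite V" "finite S" "S \<noteq> {}" "\<And>m. m \<in> S \<Longrightarrow> c m \<noteq> 0"
    and "inj_on (\<lambda>m. (\<lambda>v. if v \<in> V then m v else 0)) S"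
  shows "\<exists>a. (\<Sum>m\<in>S. c m * (\<Prod>v\<in>V. a v ^ m v)) \<noteq> 0"
  using assms
proof (induction V arbitrary: S rule: finite_induct)
  case empty
  then obtain m where "S = {m}"
    by (auto simp: inj_on_def)
  then show ?case using empty by simp
next
  case (insert u V)
  obtain m0 where m0: "m0 \<in> S" using insert.prems by blast
  define T where "T j = {m \<in> S. m u = j}" for j
  have inj: "inj_on (\<lambda>m. (\<lambda>v. if v \<in> V then m v else 0)) (T j)" for j
  proof (rule inj_onI)
    fix m m' assume m: "m \<in> T j" "m' \<in> T j" "(\<lambda>v. if v \<in> V then m v else 0) = (\<lambda>v. if v \<in> V then m' v else 0)"
    then have "m x = m' x" if "x \<in> insert u V" for x
      using that m fun_cong[OF m(3), of x] by (auto simp: T_def split: if_splits)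
    then have "(\<lambda>v. if v \<in> (insert u V) then m v else 0) = (\<lambda>v. if v \<in> (insert u V) then m' v else 0)"
      by auto
    then show "m = m'"
      using insert.prems(4) m by (auto simp: T_def inj_on_def)
  qed
  have "finite (T (m0 u))" "T (m0 u) \<noteq> {}" "\<And>m. m \<in> T (m0 u) \<Longrightarrow> c m \<noteq> 0"
    using insert.prems m0 by (auto simp: T_def)
  from insert.IH[OF this inj] obtain a where
    a: "(\<Sum>m\<in>T (m0 u). c m * (\<Prod>v\<in>V. a v ^ m v)) \<noteq> 0" by blast
  \<comment> \<open>\<open>p\<close> collects the sum by powers of \<open>u\<close> after the other
    variables have been specialized; \<open>a\<close> was chosen to keep the coefficient at exponent
    \<open>m0 u\<close> nonzero.\<close>
  define p where "p = (\<Sum>m\<in>S. monom (c m * (\<Prod>v\<in>V. a v ^ m v)) (m u))"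
  have "coeff p (m0 u) = (\<Sum>m\<in>T (m0 u). c m * (\<Prod>v\<in>V. a v ^ m v))"
    unfolding p_def T_def using insert.prems(1)
    by (simp add: coeff_sum sum.inter_filter)
  then have "p \<noteq> 0" using a by auto
  then have "finite {x. poly p x = 0}" by (rule poly_roots_finite)
  then obtain x where x: "poly p x \<noteq> 0"
    using ex_new_if_finite[OF infinite_UNIV_char_0] by blast
  have "(\<Sum>m\<in>S. c m * (\<Prod>v\<in>insert u V. (a(u := x)) v ^ m v)) = poly p x"
    unfolding p_def poly_sum
  proof (intro sum.cong refl)
    fix m
    have "(\<Prod>v\<in>V. (a(u := x)) v ^ m v) = (\<Prod>v\<in>V. a v ^ m v)"
      using insert.hyps by (intro prod.cong) auto
    then show "c m * (\<Prod>v\<in>insert u V. (a(u := x)) v ^ m v) =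
        poly (monom (c m * (\<Prod>v\<in>V. a v ^ m v)) (m u)) x"
      using insert.hyps by (simp add: poly_monom)
  qed
  then show ?case using x by metis
qed

text \<open>Makes the open set hidden in \<open>is_r\<close> yield an actual choice of linear
  forms.\<close>

lemma ex_poly_eval_nonzero:
  fixes F :: "('v, 'k::field_char_0) mpoly"
  assumes "F \<noteq> 0"
  shows "\<exists>a. poly_eval a F \<noteq> 0"
proof -
  let ?S = "Poly_Mapping.lookup ` Poly_Mapping.keys F"
  let ?V = "\<Union>m\<in>Poly_Mapping.keys F. Poly_Mapping.keys m"
  let ?c = "\<lambda>f. Poly_Mapping.lookup F (Abs_poly_mapping f)"
  have inj: "inj_on (\<lambda>f. (\<lambda>v. if v \<in> ?V then f v else 0)) ?S"
  proof (rule inj_onI)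
    fix f g assume f: "f \<in> ?S" "g \<in> ?S" "(\<lambda>v. if v \<in> ?V then f v else 0) = (\<lambda>v. if v \<in> ?V then g v else 0)"
    then obtain m n where mn: "m \<in> Poly_Mapping.keys F" "f = Poly_Mapping.lookup m"
      "n \<in> Poly_Mapping.keys F" "g = Poly_Mapping.lookup n" by auto
    have "Poly_Mapping.lookup m v = Poly_Mapping.lookup n v" for v
    proof (cases "v \<in> ?V")
      case True
      then have "(\<lambda>v. if v \<in> ?V then f v else 0) v = f v" "(\<lambda>v. if v \<in> ?V then g v else 0) v = g v" by (simp_all only: if_True)
      then show ?thesis using fun_cong[OF f(3), of v] mn by simp
    next
      case False
      then show ?thesis using mn by (metis UN_I in_keys_iff)
    qed
    then show "f = g" using mn by (simp add: fun_eq_iff)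
  qed
  have "\<exists>a. (\<Sum>f\<in>?S. ?c f * (\<Prod>v\<in>?V. a v ^ f v)) \<noteq> 0"
  proof (rule ex_nonzero_value_sum[OF _ _ _ _ inj])
    show "?S \<noteq> {}" using assms by simp
  qed (auto simp: in_keys_iff)
  then obtain a where a: "(\<Sum>f\<in>?S. ?c f * (\<Prod>v\<in>?V. a v ^ f v)) \<noteq> 0" by blast
  have "(\<Sum>f\<in>?S. ?c f * (\<Prod>v\<in>?V. a v ^ f v))
      = (\<Sum>m\<in>Poly_Mapping.keys F. Poly_Mapping.lookup F m * (\<Prod>v\<in>?V. a v ^ Poly_Mapping.lookup m v))"
    by (subst sum.reindex) (auto simp: inj_on_def poly_mapping_eqI)
  also have "\<dots> = poly_eval a F"
    unfolding poly_eval_def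
  proof (intro sum.cong refl arg_cong2[where f = "(*)"])
    fix m assume "m \<in> Poly_Mapping.keys F"
    then show "(\<Prod>v\<in>?V. a v ^ Poly_Mapping.lookup m v)
        = (\<Prod>v\<in>Poly_Mapping.keys m. a v ^ Poly_Mapping.lookup m v)"
      by (intro prod.mono_neutral_right) (auto simp: in_keys_iff)
  qed
  finally show ?thesis using a by metis
qed

section \<open>Injectivity of a member of a pencil\<close>

lemma saturatedD:
  assumes "saturation I = I" "\<And>g. g \<in> forms k \<Longrightarrow> g * f \<in> I"
  shows "f \<in> I"
  using assms unfolding saturation_def by blast

text \<open>Eigenvectors for distinct eigenvalues: modulo \<open>I\<close>, multiplying
  \<open>g c\<close> by \<open>L1\<close> is \<open>- c\<close> times multiplying it by
  \<open>L2\<close>. Applying \<open>L1 + smult c0 L2\<close> to the sum removes the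
  \<open>c0\<close> term and multiplies the others by \<open>smult (c0 - c) L2\<close>. What both
  \<open>L1\<close> and \<open>L2\<close> annihilate modulo \<open>I\<close> is annihilated by all
  forms of degree \<open>k\<close>, hence lies in \<open>I\<close> by saturation.\<close>

lemma colon_pencil_indep:
  assumes I: "is_ideal I" and sat: "saturation I = I"
    and full: "\<And>g. g \<in> forms k \<Longrightarrow> \<exists>a b. g - (L1 * a + L2 * b) \<in> I"
    and S: "finite S"
    and g: "\<And>c. c \<in> S \<Longrightarrow> (L1 + smult c L2) * g c \<in> I"
    and sum: "(\<Sum>c\<in>S. g c) \<in> I"
  shows "\<forall>c\<in>S. g c \<in> I"
  using S g sum
proof (induction S arbitrary: g rule: finite_induct)
  case (insert c0 S)
  have base: "f \<in> I" if "L1 * f \<in> I" "L2 * f \<in> I" for f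
  proof (rule saturatedD[OF sat])
    fix g :: "('a, 'b) mpoly" assume "g \<in> forms k"
    then obtain a b where "g - (L1 * a + L2 * b) \<in> I" using full by blast
    then have "(g - (L1 * a + L2 * b)) * f \<in> I" by (rule is_ideal_mult_right[OF I])
    then have "(g - (L1 * a + L2 * b)) * f + (a * (L1 * f) + b * (L2 * f)) \<in> I"
      using is_ideal_mult_left[OF I that(1)] is_ideal_mult_left[OF I that(2)]
      by (simp only: ring_module.subspace_add[OF I])
    moreover have "(g - (L1 * a + L2 * b)) * f + (a * (L1 * f) + b * (L2 * f)) = g * f"
      by (simp add: algebra_simps)
    ultimately show "g * f \<in> I" by (simp only:)
  qed
  have "\<forall>c\<in>S. smult (c0 - c) (L2 * g c) \<in> I"
  proof (rule insert.IH)
    fix c assume "c \<in> S"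
    then have "smult (c0 - c) (L2 * ((L1 + smult c L2) * g c)) \<in> I"
      using insert.prems(1)[of c] by (intro is_ideal_smult[OF I] is_ideal_mult_left[OF I, of _ L2]) auto
    then show "(L1 + smult c L2) * smult (c0 - c) (L2 * g c) \<in> I"
      by (metis smult_mult_right mult.left_commute)
  next
    let ?A = "L1 + smult c0 L2"
    have "?A * (\<Sum>c\<in>insert c0 S. g c) - ?A * g c0 - (\<Sum>c\<in>S. (L1 + smult c L2) * g c) \<in> I"
      using insert.prems(1) is_ideal_mult_left[OF I insert.prems(2)]
      by (intro ring_module.subspace_diff[OF I] ring_module.subspace_sum[OF I]) auto
    moreover have "?A * (\<Sum>c\<in>insert c0 S. g c) - ?A * g c0 = (\<Sum>c\<in>S. ?A * g c)"
      using insert.hyps by (simp add: ring_distribs(1) sum_distrib_left)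
    then have "?A * (\<Sum>c\<in>insert c0 S. g c) - ?A * g c0 - (\<Sum>c\<in>S. (L1 + smult c L2) * g c)
        = (\<Sum>c\<in>S. ?A * g c - (L1 + smult c L2) * g c)"
      by (simp only: sum_subtractf)
    moreover have "?A * g c - (L1 + smult c L2) * g c = smult (c0 - c) (L2 * g c)" for c
      by (simp add: distrib_right smult_mult_left mpoly.scale_left_diff_distrib)
    ultimately show "(\<Sum>c\<in>S. smult (c0 - c) (L2 * g c)) \<in> I" by simp
  qed
  then have *: "L2 * g c \<in> I" if "c \<in> S" for c
  proof -
    have "c0 \<noteq> c" using that insert.hyps by auto
    then have "smult (inverse (c0 - c)) (smult (c0 - c) (L2 * g c)) = L2 * g c" by simp
    then show ?thesis
      using \<open>\<forall>c\<in>S. smult (c0 - c) (L2 * g c) \<in> I\<close> that is_ideal_smult[OF I] by metis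
  qed
  have S: "g c \<in> I" if "c \<in> S" for c
  proof (rule base)
    show L2: "L2 * g c \<in> I" using * that .
    have "(L1 + smult c L2) * g c - smult c (L2 * g c) \<in> I"
      using that insert.prems(1) by (intro ring_module.subspace_diff[OF I] is_ideal_smult[OF I] L2) auto
    then show "L1 * g c \<in> I" by (simp add: distrib_right smult_mult_left)
  qed
  have "(\<Sum>c\<in>insert c0 S. g c) - (\<Sum>c\<in>S. g c) \<in> I"
    by (rule ring_module.subspace_diff[OF I insert.prems(2) ring_module.subspace_sum[OF I S]])
  then have "g c0 \<in> I" using insert.hyps by simp
  then show ?case using S by simp
qed simp

text \<open>One bad form for each of infinitely many \<open>c\<close> would give arbitrarily many
  independent elements in the finite-dimensional space of forms of degree \<open>t\<close>.\<close>

lemma ex_pencil_colon: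
  fixes I :: "('n::finite, 'k::field_char_0) mpoly set"
  assumes I: "is_ideal I" and sat: "saturation I = I"
    and full: "\<And>g. g \<in> forms k \<Longrightarrow> \<exists>a b. g - (L1 * a + L2 * b) \<in> I"
  shows "\<exists>c. \<forall>f\<in>forms t. (L1 + smult c L2) * f \<in> I \<longrightarrow> f \<in> I"
proof (rule ccontr)
  assume "\<not> ?thesis"
  then have "\<forall>c. \<exists>f. f \<in> forms t \<and> (L1 + smult c L2) * f \<in> I \<and> f \<notin> I" by blast
  then obtain F where F: "\<And>c. F c \<in> forms t" "\<And>c. (L1 + smult c L2) * F c \<in> I" "\<And>c. F c \<notin> I"
    by metis
  have indep: "\<forall>c\<in>S. u c = 0" if S: "finite S" and sum: "(\<Sum>c\<in>S. smult (u c) (F c)) = 0" for S u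
  proof
    fix c assume c: "c \<in> S"
    have "\<forall>c\<in>S. smult (u c) (F c) \<in> I"
    proof (rule colon_pencil_indep[OF I sat full S])
      fix c
      show "(L1 + smult c L2) * smult (u c) (F c) \<in> I"
        using is_ideal_smult[OF I F(2)] by (simp only: smult_mult_right)
    qed (use sum I in \<open>auto simp: ring_module.subspace_0\<close>)
    then have "smult (u c) (F c) \<in> I" using c by blast
    then have "smult (inverse (u c)) (smult (u c) (F c)) \<in> I"
      by (rule is_ideal_smult[OF I])
    then show "u c = 0" using F(3)[of c] by (cases "u c = 0") auto
  qed
  have inj: "inj F"
  proof (rule injI, rule ccontr)
    fix c c' assume "F c = F c'" "c \<noteq> c'"
    then have "(\<Sum>x\<in>{c, c'}. smult (if x = c then 1 else - 1) (F x)) = 0" by simp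
    then show False using indep[of "{c, c'}" "\<lambda>x. if x = c then 1 else - 1"] by simp
  qed
  obtain S :: "'k set" where S: "finite S" "card S = Suc (mpoly.dim (forms t :: ('n, 'k) mpoly set))"
    using infinite_arbitrarily_large[OF infinite_UNIV_char_0] by blast
  have "mpoly.independent (F ` S)"
  proof (rule mpoly.independent_if_scalars_zero)
    fix u x assume "(\<Sum>x\<in>F ` S. smult (u x) x) = 0" "x \<in> F ` S"
    then show "u x = 0"
      using indep[OF S(1), of "\<lambda>c. u (F c)"] inj
      by (auto simp: sum.reindex inj_on_subset[OF inj])
  qed (use S in simp)
  then have "card (F ` S) \<le> mpoly.dim (forms t :: ('n, 'k) mpoly set)"
    using mpoly.independent_card_le_dim_finite[OF finite_monomials forms_subset_span, of "F ` S" t] F(1)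
    by blast
  moreover have "card (F ` S) = card S" using inj by (simp add: card_image inj_on_subset)
  ultimately show False using S by simp
qed

section \<open>Linear substitutions\<close>

lemma sum_monomials: "f = (\<Sum>m\<in>Poly_Mapping.keys f. Poly_Mapping.single m (Poly_Mapping.lookup f m))"
  by (rule poly_mapping_eqI) (auto simp: lookup_sum lookup_single when_def in_keys_iff)

lemma lookup_var_mult:
  "Poly_Mapping.lookup (var j * f) k =
     (\<Sum>m\<in>Poly_Mapping.keys f. if Poly_Mapping.single j 1 + m = k then Poly_Mapping.lookup f m else 0)"
proof -
  have "var j * f = (\<Sum>m\<in>Poly_Mapping.keys f.
      Poly_Mapping.single (Poly_Mapping.single j 1 + m) (Poly_Mapping.lookup f m))"
    by (subst sum_monomials[of f]) (simp add: var_def sum_distrib_left mult_single)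
  then show ?thesis by (simp add: lookup_sum lookup_single when_def)
qed

text \<open>Among the monomials of \<open>f\<close> take \<open>m\<close> with the largest exponent
  in variable \<open>a\<close>. In the product, \<open>m\<close> times that variable can only come
  from the term of the linear form at \<open>a\<close>, so its coefficient is \<open>c a\<close>
  times that of \<open>m\<close>.\<close>

lemma linear_form_mult_eq_0:
  fixes f :: "('n::finite, 'k::field) mpoly"
  assumes a: "c a \<noteq> 0" and 0: "linear_form c * f = 0"
  shows "f = 0"
proof (rule ccontr)
  assume "f \<noteq> 0"
  let ?E = "(\<lambda>m. Poly_Mapping.lookup m a) ` Poly_Mapping.keys f"
  have E: "finite ?E" "?E \<noteq> {}" using \<open>f \<noteq> 0\<close> by auto
  then have "Max ?E \<in> ?E" by (rule Max_in)
  then obtain m where m: "m \<in> Poly_Mapping.keys f" "Poly_Mapping.lookup m a = Max ?E" by auto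
  have max: "Poly_Mapping.lookup m' a \<le> Poly_Mapping.lookup m a" if "m' \<in> Poly_Mapping.keys f" for m'
    using that E m by (auto intro: Max_ge)
  let ?k = "Poly_Mapping.single a 1 + m"
  have other: "Poly_Mapping.lookup (var j * f) ?k = 0" if "j \<noteq> a" for j
    unfolding lookup_var_mult
  proof (intro sum.neutral ballI)
    fix m' assume m': "m' \<in> Poly_Mapping.keys f"
    have "Poly_Mapping.single j 1 + m' \<noteq> ?k"
    proof
      assume "Poly_Mapping.single j 1 + m' = ?k"
      then have "Poly_Mapping.lookup (Poly_Mapping.single j 1 + m') a = Poly_Mapping.lookup ?k a" by simp
      then show False using max[OF m'] that by (simp add: lookup_add lookup_single when_def)
    qed
    then show "(if Poly_Mapping.single j 1 + m' = ?k then Poly_Mapping.lookup f m' else 0) = 0" by simp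
  qed
  have top: "Poly_Mapping.lookup (var a * f) ?k = Poly_Mapping.lookup f m"
    unfolding lookup_var_mult using m(1) by simp
  have "Poly_Mapping.lookup (linear_form c * f) ?k
      = (\<Sum>j\<in>UNIV. c j * Poly_Mapping.lookup (var j * f) ?k)"
  proof -
    have sm: "Poly_Mapping.lookup (smult r g) k = r * Poly_Mapping.lookup g k"
      for r and g :: "('n, 'k) mpoly" and k
      unfolding Defs.smult_def mult_map_scale_conv_mult[symmetric]
      by (simp add: Poly_Mapping.map.rep_eq when_def)
    show ?thesis
      by (simp only: linear_form_def sum_distrib_right lookup_sum smult_mult_left sm)
  qed
  also have "\<dots> = c a * Poly_Mapping.lookup (var a * f) ?k"
    using other by (subst sum.remove[of _ a]) (auto intro!: sum.neutral)
  finally have "c a * Poly_Mapping.lookup f m = 0" using 0 top by simp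
  then show False using a m(1) by (simp add: in_keys_iff)
qed

definition monom_subst :: "('n::finite \<Rightarrow> ('n, 'k::field) mpoly) \<Rightarrow> ('n \<Rightarrow>\<^sub>0 nat) \<Rightarrow> ('n, 'k) mpoly" where
  "monom_subst \<tau> m = (\<Prod>v\<in>UNIV. \<tau> v ^ Poly_Mapping.lookup m v)"

definition subst :: "('n::finite \<Rightarrow> ('n, 'k::field) mpoly) \<Rightarrow> ('n, 'k) mpoly \<Rightarrow> ('n, 'k) mpoly" where
  "subst \<tau> f = (\<Sum>m\<in>Poly_Mapping.keys f. smult (Poly_Mapping.lookup f m) (monom_subst \<tau> m))"

lemma monom_subst_add: "monom_subst \<tau> (m + m') = monom_subst \<tau> m * monom_subst \<tau> m'"
  by (simp add: monom_subst_def lookup_add power_add prod.distrib)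

lemma subst_superset:
  assumes "finite A" "Poly_Mapping.keys f \<subseteq> A"
  shows "subst \<tau> f = (\<Sum>m\<in>A. smult (Poly_Mapping.lookup f m) (monom_subst \<tau> m))"
  unfolding subst_def using assms by (intro sum.mono_neutral_left) (auto simp: in_keys_iff)

lemma subst_add: "subst \<tau> (f + g) = subst \<tau> f + subst \<tau> g"
proof -
  let ?A = "Poly_Mapping.keys f \<union> Poly_Mapping.keys g"
  have "subst \<tau> h = (\<Sum>m\<in>?A. smult (Poly_Mapping.lookup h m) (monom_subst \<tau> m))"
    if "Poly_Mapping.keys h \<subseteq> ?A" for h
    using that by (intro subst_superset) auto
  then show ?thesis
    using Poly_Mapping.keys_add[of f g]
    by (simp add: lookup_add mpoly.scale_left_distrib sum.distrib)
qed

lemma subst_single: "subst \<tau> (Poly_Mapping.single m c) = smult c (monom_subst \<tau> m)"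
  by (subst subst_superset[of "{m}"]) auto

lemma subst_0 [simp]: "subst \<tau> 0 = 0"
  by (simp add: subst_def)

lemma subst_sum: "subst \<tau> (sum f A) = (\<Sum>a\<in>A. subst \<tau> (f a))"
  by (induction A rule: infinite_finite_induct) (auto simp: subst_add)

lemma subst_mult: "subst \<tau> (f * g) = subst \<tau> f * subst \<tau> g"
proof -
  have single: "subst \<tau> (Poly_Mapping.single m c * Poly_Mapping.single m' c') =
      subst \<tau> (Poly_Mapping.single m c) * subst \<tau> (Poly_Mapping.single m' c')" for m m' c c'
    by (simp add: mult_single subst_single monom_subst_add smult_mult_left smult_mult_right mult.commute)
  let ?s = "\<lambda>f m. Poly_Mapping.single m (Poly_Mapping.lookup f m)"
  have "f * g = (\<Sum>m\<in>Poly_Mapping.keys f. \<Sum>m'\<in>Poly_Mapping.keys g. ?s f m * ?s g m')"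
    by (subst (1) sum_monomials[of f], subst (1) sum_monomials[of g]) (simp only: sum_product)
  then have "subst \<tau> (f * g) = (\<Sum>m\<in>Poly_Mapping.keys f. \<Sum>m'\<in>Poly_Mapping.keys g. subst \<tau> (?s f m) * subst \<tau> (?s g m'))"
    by (simp only: subst_sum single)
  also have "\<dots> = subst \<tau> (\<Sum>m\<in>Poly_Mapping.keys f. ?s f m) * subst \<tau> (\<Sum>m\<in>Poly_Mapping.keys g. ?s g m)"
    by (simp only: subst_sum sum_product)
  finally show ?thesis by (simp only: sum_monomials[symmetric])
qed

lemma subst_smult: "subst \<tau> (smult c f) = smult c (subst \<tau> f)"
proof -
  have "monom_subst \<tau> 0 = 1" by (simp add: monom_subst_def)
  then show ?thesis unfolding Defs.smult_def subst_mult by (simp add: subst_single Defs.smult_def)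
qed

lemma subst_var: "subst \<tau> (var v) = \<tau> v"
proof -
  have "monom_subst \<tau> (Poly_Mapping.single v 1) = (\<Prod>u\<in>UNIV. if u = v then \<tau> u else 1)"
    unfolding monom_subst_def by (intro prod.cong) (auto simp: lookup_single when_def)
  then show ?thesis by (simp add: var_def subst_single)
qed

lemma subst_linear_form: "subst \<tau> (linear_form c) = (\<Sum>j\<in>UNIV. smult (c j) (\<tau> j))"
  by (simp add: linear_form_def subst_sum subst_smult subst_var)

lemma forms_prod:
  "(\<And>v. v \<in> A \<Longrightarrow> f v \<in> forms (e v)) \<Longrightarrow> (\<Prod>v\<in>A. f v) \<in> forms (\<Sum>v\<in>A. e v)"
  by (induction A rule: infinite_finite_induct) (auto intro: forms_mult one_in_forms)

lemma subst_forms: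
  assumes "\<And>v. \<tau> v \<in> forms 1" "f \<in> forms k"
  shows "subst \<tau> f \<in> forms k"
  unfolding subst_def
proof (intro forms_sum forms_smult)
  fix m assume "m \<in> Poly_Mapping.keys f"
  then have "mdeg m = k" using assms(2) by (auto simp: forms_def)
  then show "monom_subst \<tau> m \<in> forms k"
    unfolding monom_subst_def using forms_prod[of UNIV "\<lambda>v. \<tau> v ^ Poly_Mapping.lookup m v" "Poly_Mapping.lookup m"]
      forms_power[OF assms(1)] by (auto simp: mdeg_def)
qed

lemma var_power: "var v ^ n = Poly_Mapping.single (Poly_Mapping.single v n) 1"
  by (induction n) (simp_all add: var_def mult_single flip: single_add)

lemma subst_diff_mem:
  assumes I: "is_ideal I" and \<tau>: "\<And>v. var v - \<tau> v \<in> I"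
  shows "f - subst \<tau> f \<in> I"
proof -
  have mult: "f * g - f' * g' \<in> I" if "f - f' \<in> I" "g - g' \<in> I" for f f' g g'
  proof -
    have "f * (g - g') + (f - f') * g' \<in> I"
      by (intro ring_module.subspace_add[OF I] is_ideal_mult_left[OF I] is_ideal_mult_right[OF I] that)
    then show ?thesis by (simp add: algebra_simps)
  qed
  have pow: "var v ^ n - \<tau> v ^ n \<in> I" for v n
  proof (induction n)
    case (Suc n)
    then show ?case using mult[OF \<tau> Suc] by simp
  qed (simp add: ring_module.subspace_0[OF I])
  have prod: "(\<Prod>v\<in>A. var v ^ e v) - (\<Prod>v\<in>A. \<tau> v ^ e v) \<in> I" if "finite A" for A e
    using that
  proof (induction A)
    case (insert v A)
    then show ?case using mult[OF pow[of v "e v"] insert.IH] by simp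
  qed (simp add: ring_module.subspace_0[OF I])
  have "(\<Prod>v\<in>A. Poly_Mapping.single (Poly_Mapping.single v (e v)) 1)
      = Poly_Mapping.single (\<Sum>v\<in>A. Poly_Mapping.single v (e v)) (1 :: 'b)" if "finite A" for A :: "'a set" and e :: "'a \<Rightarrow> nat"
    using that by (induction A) (simp_all add: mult_single)
  moreover have "(\<Sum>v\<in>UNIV. Poly_Mapping.single v (Poly_Mapping.lookup m v)) = m" for m :: "'a \<Rightarrow>\<^sub>0 nat"
    by (rule poly_mapping_eqI) (simp add: lookup_sum lookup_single when_def)
  ultimately have mono: "(\<Prod>v\<in>UNIV. var v ^ Poly_Mapping.lookup m v) = Poly_Mapping.single m (1 :: 'b)" for m :: "'a \<Rightarrow>\<^sub>0 nat"
    by (simp add: var_power)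
  have single: "Poly_Mapping.single m c - subst \<tau> (Poly_Mapping.single m c) \<in> I" for m c
  proof -
    have "smult c (Poly_Mapping.single m 1 - monom_subst \<tau> m) \<in> I"
      using prod[of UNIV "Poly_Mapping.lookup m"] mono
      by (intro is_ideal_smult[OF I]) (simp add: monom_subst_def)
    moreover have "smult c (Poly_Mapping.single m 1) = Poly_Mapping.single m c"
      by (simp add: Defs.smult_def mult_single)
    ultimately show ?thesis by (simp add: subst_single mpoly.scale_right_diff_distrib)
  qed
  let ?s = "\<lambda>m. Poly_Mapping.single m (Poly_Mapping.lookup f m)"
  have "(\<Sum>m\<in>Poly_Mapping.keys f. ?s m - subst \<tau> (?s m)) \<in> I"
    by (intro ring_module.subspace_sum[OF I] single)
  moreover have "(\<Sum>m\<in>Poly_Mapping.keys f. ?s m - subst \<tau> (?s m)) = f - subst \<tau> f"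
    by (simp only: sum_subtractf sum_monomials[symmetric] flip: subst_sum)
  ultimately show ?thesis by (simp only:)
qed

text \<open>Solving \<open>linear_form \<alpha> = 0\<close> for the variable \<open>a\<close>
  identifies the quotient by this form with the polynomial ring in the other variables;
  \<open>\<tau>\<close> is that elimination, read as an endomorphism of the whole ring.\<close>

lemma ex_retraction:
  fixes \<alpha> :: "'n::finite \<Rightarrow> 'k::field"
  assumes "\<alpha> a \<noteq> 0"
  defines "\<tau> \<equiv> \<lambda>v. if v = a then var a - smult (1 / \<alpha> a) (linear_form \<alpha>) else var v"
  shows "subst \<tau> (linear_form \<alpha>) = 0" "\<And>v. \<tau> v \<in> forms 1"
    "\<And>f. f - subst \<tau> f \<in> ideal_gen {linear_form \<alpha>}"
    "\<And>\<beta>. \<beta> a = 0 \<Longrightarrow> subst \<tau> (linear_form \<beta>) = linear_form \<beta>"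
proof -
  have sum: "subst \<tau> (linear_form \<beta>) = linear_form \<beta> - smult (\<beta> a / \<alpha> a) (linear_form \<alpha>)" for \<beta>
  proof -
    have "smult (\<beta> j) (\<tau> j) = smult (\<beta> j) (var j) - (if j = a then smult (\<beta> a / \<alpha> a) (linear_form \<alpha>) else 0)" for j
      by (simp add: \<tau>_def mpoly.scale_right_diff_distrib)
    then have "subst \<tau> (linear_form \<beta>) = (\<Sum>j\<in>UNIV. smult (\<beta> j) (var j)) - smult (\<beta> a / \<alpha> a) (linear_form \<alpha>)"
      by (simp add: subst_linear_form sum_subtractf)
    then show ?thesis by (simp only: linear_form_def)
  qed
  show "subst \<tau> (linear_form \<alpha>) = 0" using sum[of \<alpha>] assms(1) by simp
  show "subst \<tau> (linear_form \<beta>) = linear_form \<beta>" if "\<beta> a = 0" for \<beta> using sum[of \<beta>] that by simp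
  show "\<tau> v \<in> forms 1" for v
    unfolding \<tau>_def by (simp only: forms_diff forms_smult linear_form_in_forms var_in_forms split: if_split) blast
  show "f - subst \<tau> f \<in> ideal_gen {linear_form \<alpha>}" for f
  proof (rule subst_diff_mem)
    have "smult c (linear_form \<alpha>) \<in> ideal_gen {linear_form \<alpha>}" for c
      by (intro is_ideal_smult ring_module.span_base) auto
    then show "var v - \<tau> v \<in> ideal_gen {linear_form \<alpha>}" for v
      by (auto simp: \<tau>_def ring_module.span_zero)
  qed simp
qed

section \<open>The Bayer--Stillman criterion\<close>

text \<open>Vanishing of the Koszul homology H_1 of the family \<open>x\<close> on the image of
  \<open>J\<close> in R/Y, for cycles with entries of degree \<open>k + 1\<close>. Antisymmetric
  matrices stand for the second exterior power, so \<open>\<Lambda>\<close> needs no order; entries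
  are kept in \<open>J\<close> itself and only the equations are read modulo
  \<open>Y\<close>.\<close>

definition koszul_exact ::
    "'i set \<Rightarrow> ('i \<Rightarrow> ('n::finite, 'k::field) mpoly) \<Rightarrow> ('n, 'k) mpoly set \<Rightarrow> ('n, 'k) mpoly set \<Rightarrow> nat \<Rightarrow> bool" where
  "koszul_exact \<Lambda> x Y J k \<longleftrightarrow>
     (\<forall>g. (\<forall>l\<in>\<Lambda>. g l \<in> J \<inter> forms (Suc k)) \<longrightarrow> (\<Sum>l\<in>\<Lambda>. x l * g l) \<in> Y \<longrightarrow>
       (\<exists>h. (\<forall>l\<in>\<Lambda>. \<forall>m\<in>\<Lambda>. h l m \<in> J \<inter> forms k \<and> h m l = - h l m) \<and>
            (\<forall>l\<in>\<Lambda>. g l - (\<Sum>m\<in>\<Lambda>. x m * h l m) \<in> Y)))"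

text \<open>Injectivity of multiplication by \<open>y\<close> on R/(J + Y) in degree
  \<open>k\<close>. The representative \<open>q\<close> is a form of \<open>J\<close>, so that it
  can serve as an entry of Koszul data.\<close>

definition colon_stable ::
    "('n::finite, 'k::field) mpoly set \<Rightarrow> ('n, 'k) mpoly \<Rightarrow> ('n, 'k) mpoly set \<Rightarrow> nat \<Rightarrow> bool" where
  "colon_stable Y y J k \<longleftrightarrow>
     (\<forall>f\<in>forms k. \<forall>p\<in>J. y * f - p \<in> Y \<longrightarrow> (\<exists>q\<in>J \<inter> forms k. f - q \<in> Y))"

definition nonzerodivisor_mod ::
    "('n::finite, 'k::field) mpoly set \<Rightarrow> ('n, 'k) mpoly \<Rightarrow> bool" where
  "nonzerodivisor_mod Y y \<longleftrightarrow> (\<forall>f. y * f \<in> Y \<longrightarrow> f \<in> Y)"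

lemma smult_half_double:
  fixes f :: "('n, 'k::field_char_0) mpoly"
  shows "smult (1 / 2) (f + f) = f"
proof -
  have "smult (1 / 2) (f + f) = smult (1 / 2 + 1 / 2) f"
    by (simp only: mpoly.scale_right_distrib mpoly.scale_left_distrib)
  then show ?thesis by simp
qed

text \<open>Two consecutive Koszul differentials compose to 0: swapping the indices shows that the
  double sum is its own negative, and 2 is invertible.\<close>

lemma antisym_sum_eq_0:
  fixes h :: "'i \<Rightarrow> 'i \<Rightarrow> ('n::finite, 'k::field_char_0) mpoly"
  assumes "\<And>l m. l \<in> \<Lambda> \<Longrightarrow> m \<in> \<Lambda> \<Longrightarrow> h m l = - h l m"
  shows "(\<Sum>l\<in>\<Lambda>. x l * (\<Sum>m\<in>\<Lambda>. x m * h l m)) = 0"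
proof -
  let ?S = "\<Sum>l\<in>\<Lambda>. \<Sum>m\<in>\<Lambda>. x l * (x m * h l m)"
  have "?S = (\<Sum>m\<in>\<Lambda>. \<Sum>l\<in>\<Lambda>. x l * (x m * h l m))" by (rule sum.swap)
  also have "\<dots> = (\<Sum>m\<in>\<Lambda>. \<Sum>l\<in>\<Lambda>. - (x m * (x l * h m l)))"
  proof (intro sum.cong refl)
    fix l m assume "l \<in> \<Lambda>" "m \<in> \<Lambda>"
    then have "h l m = - h m l" by (intro assms)
    then show "x l * (x m * h l m) = - (x m * (x l * h m l))"
      by (simp only: mult_minus_right mult.left_commute)
  qed
  also have "\<dots> = - ?S" by (simp add: sum_negf)
  finally have "?S + ?S = 0" by (simp only: eq_neg_iff_add_eq_0)
  then have "smult (1 / 2) (?S + ?S) = 0" by (simp only: mpoly.scale_zero_right)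
  then have "?S = 0" by (simp only: smult_half_double)
  then show ?thesis by (simp only: sum_distrib_left)
qed

text \<open>Lifts a syzygy modulo \<open>Y + (y)\<close> to one modulo \<open>Y\<close>: the defect of the lift is divisible
  by \<open>y\<close>, and the quotient lies in \<open>J\<close> by the colon condition.\<close>

lemma koszul_lift:
  fixes J Y :: "('n::finite, 'k::field_char_0) mpoly set"
  assumes J: "homogeneous_ideal J" and Y: "homogeneous_ideal Y" and \<Lambda>: "finite \<Lambda>"
    and y: "y \<in> forms 1" and x: "\<And>l. l \<in> \<Lambda> \<Longrightarrow> x l \<in> forms 1"
    and K: "koszul_exact \<Lambda> x (ideal_add Y y) J k"
    and colon: "colon_stable Y y J k" and nzd: "nonzerodivisor_mod Y y"
    and g: "\<And>l. l \<in> \<Lambda> \<Longrightarrow> g l \<in> J \<inter> forms (Suc k)"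
    and u: "(\<Sum>l\<in>\<Lambda>. x l * g l) + y * u \<in> Y"
  shows "\<exists>h f. (\<forall>l\<in>\<Lambda>. \<forall>m\<in>\<Lambda>. h l m \<in> J \<inter> forms k \<and> h m l = - h l m) \<and>
      (\<forall>l\<in>\<Lambda>. f l \<in> J \<inter> forms k) \<and>
      (\<forall>l\<in>\<Lambda>. g l - (\<Sum>m\<in>\<Lambda>. x m * h l m) - y * f l \<in> Y) \<and>
      u + (\<Sum>l\<in>\<Lambda>. x l * f l) \<in> Y"
proof -
  have iJ: "is_ideal J" and iY: "is_ideal Y" using J Y by (auto intro: homogeneous_is_ideal)
  have "(\<Sum>l\<in>\<Lambda>. x l * g l) - (- u) * y \<in> Y" using u by (simp add: mult.commute)
  then have "(\<Sum>l\<in>\<Lambda>. x l * g l) \<in> ideal_add Y y"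
    unfolding mem_ideal_add[OF iY] by blast
  moreover have "\<forall>l\<in>\<Lambda>. g l \<in> J \<inter> forms (Suc k)" using g by blast
  ultimately have "\<exists>h. (\<forall>l\<in>\<Lambda>. \<forall>m\<in>\<Lambda>. h l m \<in> J \<inter> forms k \<and> h m l = - h l m) \<and>
      (\<forall>l\<in>\<Lambda>. g l - (\<Sum>m\<in>\<Lambda>. x m * h l m) \<in> ideal_add Y y)"
    using K[unfolded koszul_exact_def, THEN spec, of g] by (simp only: simp_thms)
  then obtain h where hB: "\<forall>l\<in>\<Lambda>. \<forall>m\<in>\<Lambda>. h l m \<in> J \<inter> forms k \<and> h m l = - h l m"
    and ghB: "\<forall>l\<in>\<Lambda>. g l - (\<Sum>m\<in>\<Lambda>. x m * h l m) \<in> ideal_add Y y"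
    by (elim exE conjE)
  note gh = ghB[rule_format]
  have hJ: "h l m \<in> J" "h l m \<in> forms k" and anti: "h m l = - h l m"
    if "l \<in> \<Lambda>" "m \<in> \<Lambda>" for l m
    using hB[rule_format, OF that] by blast+
  have "\<exists>f\<in>J \<inter> forms k. g l - (\<Sum>m\<in>\<Lambda>. x m * h l m) - y * f \<in> Y" if l: "l \<in> \<Lambda>" for l
  proof -
    let ?d = "g l - (\<Sum>m\<in>\<Lambda>. x m * h l m)"
    obtain r where "?d - r * y \<in> Y"
      using gh[OF l] unfolding mem_ideal_add[OF iY] by blast
    then have "?d - y * r \<in> Y" by (simp only: mult.commute)
    then have "hcomp (Suc k) (?d - y * r) \<in> Y" by (rule homogeneous_hcomp[OF Y])
    moreover have "x m * h l m \<in> forms (Suc k)" if "m \<in> \<Lambda>" for m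
      using forms_mult[OF x[OF that] hJ(2)[OF l that]] by simp
    then have "?d \<in> forms (Suc k)"
      using g l by (intro forms_diff forms_sum) auto
    ultimately have d: "?d - y * hcomp k r \<in> Y"
      by (simp add: hcomp_diff[of _ ?d] hcomp_mult_form[OF y] hcomp_form[of ?d])
    then have "- (?d - y * hcomp k r) \<in> Y"
      by (rule ring_module.subspace_neg[OF iY])
    then have "y * hcomp k r - ?d \<in> Y" by simp
    moreover have "?d \<in> J"
      using g[OF l] hJ(1)[OF l] by (intro ring_module.subspace_diff[OF iJ] ring_module.subspace_sum[OF iJ]
          is_ideal_mult_left[OF iJ]) auto
    ultimately obtain q where q: "q \<in> J \<inter> forms k" "hcomp k r - q \<in> Y"
      using colon hcomp_in_forms unfolding colon_stable_def by blast
    have "(?d - y * hcomp k r) + y * (hcomp k r - q) \<in> Y"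
      by (intro ring_module.subspace_add[OF iY] d is_ideal_mult_left[OF iY] q(2))
    moreover have "(?d - y * hcomp k r) + y * (hcomp k r - q) = ?d - y * q"
      by (simp add: right_diff_distrib)
    ultimately show ?thesis using q(1) by auto
  qed
  then have "\<forall>l\<in>\<Lambda>. \<exists>f. f \<in> J \<inter> forms k \<and> g l - (\<Sum>m\<in>\<Lambda>. x m * h l m) - y * f \<in> Y" by blast
  from bchoice[OF this] obtain f
    where fB: "\<forall>l\<in>\<Lambda>. f l \<in> J \<inter> forms k \<and> g l - (\<Sum>m\<in>\<Lambda>. x m * h l m) - y * f l \<in> Y" ..
  then have f: "f l \<in> J \<inter> forms k" "g l - (\<Sum>m\<in>\<Lambda>. x m * h l m) - y * f l \<in> Y" if "l \<in> \<Lambda>" for l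
    using that by blast+
  \<comment> \<open>Apply the Koszul differential to the relations just found: antisymmetry removes
    \<open>h\<close>, and comparison with \<open>u\<close> leaves a multiple of \<open>y\<close>,
    which can be cancelled modulo \<open>Y\<close>.\<close>
  have "(\<Sum>l\<in>\<Lambda>. x l * (g l - (\<Sum>m\<in>\<Lambda>. x m * h l m) - y * f l)) \<in> Y"
    using f by (intro ring_module.subspace_sum[OF iY] is_ideal_mult_left[OF iY])
  moreover have "(\<Sum>l\<in>\<Lambda>. x l * (g l - (\<Sum>m\<in>\<Lambda>. x m * h l m) - y * f l))
      = (\<Sum>l\<in>\<Lambda>. x l * g l) - (\<Sum>l\<in>\<Lambda>. x l * (\<Sum>m\<in>\<Lambda>. x m * h l m)) - y * (\<Sum>l\<in>\<Lambda>. x l * f l)"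
    by (simp add: right_diff_distrib sum_subtractf sum_distrib_left mult.left_commute)
  moreover have "(\<Sum>l\<in>\<Lambda>. x l * (\<Sum>m\<in>\<Lambda>. x m * h l m)) = 0"
    by (intro antisym_sum_eq_0) (rule anti)
  ultimately have "(\<Sum>l\<in>\<Lambda>. x l * g l) - y * (\<Sum>l\<in>\<Lambda>. x l * f l) \<in> Y" by simp
  then have "((\<Sum>l\<in>\<Lambda>. x l * g l) + y * u) - ((\<Sum>l\<in>\<Lambda>. x l * g l) - y * (\<Sum>l\<in>\<Lambda>. x l * f l)) \<in> Y"
    using u by (rule ring_module.subspace_diff[OF iY, rotated])
  moreover have "((\<Sum>l\<in>\<Lambda>. x l * g l) + y * u) - ((\<Sum>l\<in>\<Lambda>. x l * g l) - y * (\<Sum>l\<in>\<Lambda>. x l * f l))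
      = y * (u + (\<Sum>l\<in>\<Lambda>. x l * f l))"
    by (simp add: distrib_left)
  ultimately have "u + (\<Sum>l\<in>\<Lambda>. x l * f l) \<in> Y"
    using nzd unfolding nonzerodivisor_mod_def by simp
  then show ?thesis using hB f by (intro exI[of _ h] exI[of _ f] conjI ballI) blast+
qed

text \<open>In a cycle over \<open>insert j \<Lambda>\<close> the entry \<open>g j\<close> takes the
  place of \<open>u\<close> in \<open>koszul_lift\<close>. The multipliers found there become the
  row and, with the opposite sign, the column of \<open>j\<close> in the enlarged antisymmetric
  matrix.\<close>

lemma koszul_step:
  fixes J Y :: "('n::finite, 'k::field_char_0) mpoly set"
  assumes J: "homogeneous_ideal J" and Y: "homogeneous_ideal Y" and \<Lambda>: "finite \<Lambda>" "j \<notin> \<Lambda>"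
    and x: "\<And>l. l \<in> insert j \<Lambda> \<Longrightarrow> x l \<in> forms 1"
    and K: "koszul_exact \<Lambda> x (ideal_add Y (x j)) J k"
    and colon: "colon_stable Y (x j) J k" and nzd: "nonzerodivisor_mod Y (x j)"
  shows "koszul_exact (insert j \<Lambda>) x Y J k"
  unfolding koszul_exact_def
proof (intro allI impI)
  fix g assume g: "\<forall>l\<in>insert j \<Lambda>. g l \<in> J \<inter> forms (Suc k)"
    and s: "(\<Sum>l\<in>insert j \<Lambda>. x l * g l) \<in> Y"
  have iJ: "is_ideal J" using J by (rule homogeneous_is_ideal)
  have "(\<Sum>l\<in>\<Lambda>. x l * g l) + x j * g j \<in> Y" using s \<Lambda> by (simp add: add.commute)
  then have "\<exists>h f. (\<forall>l\<in>\<Lambda>. \<forall>m\<in>\<Lambda>. h l m \<in> J \<inter> forms k \<and> h m l = - h l m) \<and>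
      (\<forall>l\<in>\<Lambda>. f l \<in> J \<inter> forms k) \<and>
      (\<forall>l\<in>\<Lambda>. g l - (\<Sum>m\<in>\<Lambda>. x m * h l m) - x j * f l \<in> Y) \<and>
      g j + (\<Sum>l\<in>\<Lambda>. x l * f l) \<in> Y"
    by (rule koszul_lift[OF J Y \<Lambda>(1) _ _ K colon nzd, rotated 3]) (use x g in auto)
  then obtain h f where hB: "\<forall>l\<in>\<Lambda>. \<forall>m\<in>\<Lambda>. h l m \<in> J \<inter> forms k \<and> h m l = - h l m"
    and fB: "\<forall>l\<in>\<Lambda>. f l \<in> J \<inter> forms k"
    and glB: "\<forall>l\<in>\<Lambda>. g l - (\<Sum>m\<in>\<Lambda>. x m * h l m) - x j * f l \<in> Y"
    and gj: "g j + (\<Sum>l\<in>\<Lambda>. x l * f l) \<in> Y"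
    by (elim exE conjE)
  note h = hB[rule_format] and f = fB[rule_format] and gl = glB[rule_format]
  define h' where "h' l m = (if l = j then if m = j then 0 else - f m else if m = j then f l else h l m)" for l m
  have "h' l m \<in> J \<inter> forms k \<and> h' m l = - h' l m" if "l \<in> insert j \<Lambda>" "m \<in> insert j \<Lambda>" for l m
    using that h f
    by (auto simp: h'_def intro: ring_module.subspace_neg[OF iJ] ring_module.subspace_0[OF iJ] forms_neg forms_0)
  moreover have "g l - (\<Sum>m\<in>insert j \<Lambda>. x m * h' l m) \<in> Y" if l: "l \<in> insert j \<Lambda>" for l
  proof (cases "l = j")
    case True
    have "(\<Sum>m\<in>\<Lambda>. x m * h' j m) = - (\<Sum>m\<in>\<Lambda>. x m * f m)"
      unfolding sum_negf[symmetric] using \<Lambda>(2) by (intro sum.cong) (auto simp: h'_def)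
    then show ?thesis using True gj \<Lambda> by (simp add: h'_def)
  next
    case False
    have "(\<Sum>m\<in>\<Lambda>. x m * h' l m) = (\<Sum>m\<in>\<Lambda>. x m * h l m)"
      using \<Lambda>(2) False by (intro sum.cong) (auto simp: h'_def)
    moreover have "h' l j = f l" using False by (simp add: h'_def)
    ultimately show ?thesis using False l gl[of l] \<Lambda> by (simp add: diff_diff_eq add.commute)
  qed
  ultimately show "\<exists>h. (\<forall>l\<in>insert j \<Lambda>. \<forall>m\<in>insert j \<Lambda>. h l m \<in> J \<inter> forms k \<and> h m l = - h l m) \<and>
      (\<forall>l\<in>insert j \<Lambda>. g l - (\<Sum>m\<in>insert j \<Lambda>. x m * h l m) \<in> Y)"
    by blast
qed

text \<open>If \<open>y * f\<close> is congruent to a form of \<open>J\<close>, expand that form by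
  \<open>gen\<close> with coefficients in \<open>J\<close>. The terms make up a cycle with entry
  \<open>u - f\<close> at \<open>y\<close>, and lifting this cycle exhibits \<open>f\<close> modulo
  \<open>Y\<close> as an element of \<open>J\<close>.\<close>

lemma colon_step:
  fixes J Y :: "('n::finite, 'k::field_char_0) mpoly set"
  assumes J: "homogeneous_ideal J" and Y: "homogeneous_ideal Y" and \<Lambda>: "finite \<Lambda>"
    and y: "y \<in> forms 1" and x: "\<And>l. l \<in> \<Lambda> \<Longrightarrow> x l \<in> forms 1"
    and K: "koszul_exact \<Lambda> x (ideal_add Y y) J k"
    and colon: "colon_stable Y y J k" and nzd: "nonzerodivisor_mod Y y"
    and gen: "\<And>p. p \<in> J \<inter> forms (Suc (Suc k)) \<Longrightarrow>
      \<exists>g u. (\<forall>l\<in>\<Lambda>. g l \<in> J \<inter> forms (Suc k)) \<and> u \<in> J \<inter> forms (Suc k) \<and>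
        p - ((\<Sum>l\<in>\<Lambda>. x l * g l) + y * u) \<in> Y"
  shows "colon_stable Y y J (Suc k)"
  unfolding colon_stable_def
proof (intro ballI impI)
  fix f p assume f: "f \<in> forms (Suc k)" and p: "p \<in> J" "y * f - p \<in> Y"
  have iJ: "is_ideal J" and iY: "is_ideal Y" using J Y by (auto intro: homogeneous_is_ideal)
  let ?p = "hcomp (Suc (Suc k)) p"
  have yf: "y * f \<in> forms (Suc (Suc k))" using forms_mult[OF y f] by simp
  have "hcomp (Suc (Suc k)) (y * f - p) \<in> Y" using p(2) by (rule homogeneous_hcomp[OF Y])
  then have p1: "y * f - ?p \<in> Y" using yf by (simp add: hcomp_diff hcomp_form)
  have "?p \<in> J \<inter> forms (Suc (Suc k))"
    using homogeneous_hcomp[OF J p(1)] hcomp_in_forms by auto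
  then obtain g u where g: "\<And>l. l \<in> \<Lambda> \<Longrightarrow> g l \<in> J \<inter> forms (Suc k)" and u: "u \<in> J \<inter> forms (Suc k)"
    and pg: "?p - ((\<Sum>l\<in>\<Lambda>. x l * g l) + y * u) \<in> Y"
    using gen by blast
  have "- (y * f - ?p) - (?p - ((\<Sum>l\<in>\<Lambda>. x l * g l) + y * u)) \<in> Y"
    by (intro ring_module.subspace_diff[OF iY] ring_module.subspace_neg[OF iY] p1 pg)
  then have "(\<Sum>l\<in>\<Lambda>. x l * g l) + y * (u - f) \<in> Y"
    by (simp add: right_diff_distrib add_diff_eq)
  then have "\<exists>h q. (\<forall>l\<in>\<Lambda>. \<forall>m\<in>\<Lambda>. h l m \<in> J \<inter> forms k \<and> h m l = - h l m) \<and>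
      (\<forall>l\<in>\<Lambda>. q l \<in> J \<inter> forms k) \<and>
      (\<forall>l\<in>\<Lambda>. g l - (\<Sum>m\<in>\<Lambda>. x m * h l m) - y * q l \<in> Y) \<and>
      u - f + (\<Sum>l\<in>\<Lambda>. x l * q l) \<in> Y"
    by (rule koszul_lift[OF J Y \<Lambda> y x K colon nzd g, rotated 2])
  then obtain q where qB: "\<forall>l\<in>\<Lambda>. q l \<in> J \<inter> forms k"
    and uf: "u - f + (\<Sum>l\<in>\<Lambda>. x l * q l) \<in> Y"
    by (elim exE conjE)
  note q = qB[rule_format]
  let ?q = "u + (\<Sum>l\<in>\<Lambda>. x l * q l)"
  have "x l * q l \<in> J \<inter> forms (Suc k)" if "l \<in> \<Lambda>" for l
    using q[OF that] forms_mult[OF x[OF that], of "q l" k] is_ideal_mult_left[OF iJ] by auto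
  then have "?q \<in> J \<inter> forms (Suc k)"
    using u by (auto intro!: forms_add forms_sum ring_module.subspace_add[OF iJ] ring_module.subspace_sum[OF iJ])
  moreover have "- (u - f + (\<Sum>l\<in>\<Lambda>. x l * q l)) \<in> Y"
    using uf by (rule ring_module.subspace_neg[OF iY])
  then have "f - ?q \<in> Y" by (simp add: algebra_simps)
  ultimately show "\<exists>q\<in>J \<inter> forms (Suc k). f - q \<in> Y" by blast
qed

section \<open>The Koszul complex of the variables\<close>

lemma var_eq_linear_form:
  "(var j :: ('n::finite, 'k::field) mpoly) = linear_form (\<lambda>i. if i = j then 1 else 0)"
proof -
  have "smult (if i = j then 1 else 0) (var i) = (if i = j then var i else 0 :: ('n, 'k) mpoly)" for i
    by simp
  then show ?thesis by (simp add: linear_form_def)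
qed

text \<open>Setting the variables in \<open>V\<close> to 0 kills the ideal and changes each
  polynomial only by an element of it, which reduces the claim to cancelling \<open>var j\<close> in
  the ring itself.\<close>

lemma nonzerodivisor_mod_var:
  assumes "j \<notin> V"
  shows "nonzerodivisor_mod (ideal_gen (var ` V)) (var j :: ('n::finite, 'k::field) mpoly)"
  unfolding nonzerodivisor_mod_def
proof (intro allI impI)
  fix f :: "('n, 'k) mpoly"
  let ?I = "ideal_gen (var ` V) :: ('n, 'k) mpoly set"
  let ?e = "subst (\<lambda>v. if v \<in> V then 0 else var v :: ('n, 'k) mpoly)"
  have zero: "?e g = 0" if "g \<in> ?I" for g
    using that by (induction rule: ring_module.span_induct_alt) (auto simp: subst_add subst_mult subst_var)
  have diff: "g - ?e g \<in> ?I" for g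
    by (rule subst_diff_mem) (auto simp: ring_module.span_zero intro: ring_module.span_base)
  assume "var j * f \<in> ?I"
  then have "?e (var j * f) = 0" by (rule zero)
  then have "var j * ?e f = 0" by (simp only: subst_mult subst_var assms if_False)
  then have "linear_form (\<lambda>i. if i = j then 1 else 0) * ?e f = 0" by (simp only: var_eq_linear_form)
  then have "?e f = 0" by (rule linear_form_mult_eq_0[rotated, where a = j]) simp
  then show "f \<in> ?I" using diff[of f] by simp
qed

lemma ideal_add_gen: "ideal_add (ideal_gen S) f = ideal_gen (insert f S)"
  by (simp add: ring_module.span_insert ring_module.span_span)

lemma colon_stable_UNIV: "is_ideal Y \<Longrightarrow> colon_stable Y y UNIV k"
  unfolding colon_stable_def by (auto intro!: bexI simp: ring_module.subspace_0)

lemma homogeneous_UNIV: "homogeneous_ideal UNIV"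
  by (rule homogeneous_idealI) auto

lemma homogeneous_zero: "homogeneous_ideal {0}"
  by (rule homogeneous_idealI) auto

text \<open>The variables form a regular sequence. \<open>V\<close> has to vary because the
  induction step moves \<open>var j\<close> from the family into the ideal; with \<open>UNIV\<close>
  for \<open>J\<close> the colon condition is trivial.\<close>

lemma koszul_exact_vars:
  fixes \<Lambda> V :: "'n::finite set"
  assumes "finite \<Lambda>" "\<Lambda> \<inter> V = {}"
  shows "koszul_exact \<Lambda> var (ideal_gen (var ` V) :: ('n, 'k::field_char_0) mpoly set) UNIV k"
  using assms
proof (induction \<Lambda> arbitrary: V rule: finite_induct)
  case empty
  then show ?case by (simp add: koszul_exact_def)
next
  case (insert j \<Lambda>)
  have "var ` V \<subseteq> (\<Union>t. forms t)" using var_in_forms by blast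
  then have hom: "homogeneous_ideal (ideal_gen (var ` V) :: ('n, 'k) mpoly set)"
    by (rule homogeneous_ideal_gen)
  have "koszul_exact \<Lambda> var (ideal_gen (var ` (insert j V)) :: ('n, 'k) mpoly set) UNIV k"
    using insert by (intro insert.IH) auto
  then have "koszul_exact \<Lambda> var (ideal_add (ideal_gen (var ` V)) (var j) :: ('n, 'k) mpoly set) UNIV k"
    by (simp add: ideal_add_gen)
  moreover have "j \<notin> V" using insert by auto
  ultimately show ?case
    by (intro koszul_step homogeneous_UNIV hom insert.hyps var_in_forms nonzerodivisor_mod_var
        colon_stable_UNIV homogeneous_is_ideal[OF hom])
qed

text \<open>Start of the descent: where \<open>J\<close> fills R/Y in degree \<open>k\<close>, the
  entries of \<open>h\<close> can be sought in the whole ring. The retraction \<open>\<pi>\<close>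
  with kernel \<open>Y\<close> turns a congruence into an equation in the polynomial ring, to which
  \<open>koszul_exact_vars\<close> applies.\<close>

lemma koszul_exact_full:
  fixes J Y :: "('n::finite, 'k::field_char_0) mpoly set"
  assumes J: "homogeneous_ideal J" and Y: "homogeneous_ideal Y" and \<Lambda>: "finite \<Lambda>"
    and \<pi>_add: "\<And>f g. \<pi> (f + g) = \<pi> f + \<pi> g" and \<pi>_mult: "\<And>f g. \<pi> (f * g) = \<pi> f * \<pi> g"
    and \<pi>_var: "\<And>l. l \<in> \<Lambda> \<Longrightarrow> \<pi> (var l) = var l"
    and \<pi>_forms: "\<And>f k. f \<in> forms k \<Longrightarrow> \<pi> f \<in> forms k"
    and \<pi>_0: "\<And>f. f \<in> Y \<Longrightarrow> \<pi> f = 0" and \<pi>_diff: "\<And>f. f - \<pi> f \<in> Y"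
    and full: "\<And>f. f \<in> forms k \<Longrightarrow> \<exists>q\<in>J \<inter> forms k. f - q \<in> Y"
  shows "koszul_exact \<Lambda> var Y J k"
  unfolding koszul_exact_def
proof (intro allI impI)
  fix g assume g: "\<forall>l\<in>\<Lambda>. g l \<in> J \<inter> forms (Suc k)" and s: "(\<Sum>l\<in>\<Lambda>. var l * g l) \<in> Y"
  have iJ: "is_ideal J" and iY: "is_ideal Y" using J Y by (auto intro: homogeneous_is_ideal)
  have \<pi>_sum: "\<pi> (sum f A) = (\<Sum>a\<in>A. \<pi> (f a))" for f and A :: "'n set"
    using \<pi>_0[OF ring_module.subspace_0[OF iY]]
    by (induction A rule: infinite_finite_induct) (auto simp: \<pi>_add)
  have "(\<Sum>l\<in>\<Lambda>. var l * \<pi> (g l)) = \<pi> (\<Sum>l\<in>\<Lambda>. var l * g l)"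
    unfolding \<pi>_sum by (intro sum.cong refl) (simp add: \<pi>_mult \<pi>_var)
  also have "\<dots> = 0" using s by (rule \<pi>_0)
  finally have 0: "(\<Sum>l\<in>\<Lambda>. var l * \<pi> (g l)) \<in> ideal_gen (var ` {})" by simp
  have "koszul_exact \<Lambda> var (ideal_gen (var ` {}) :: ('n, 'k) mpoly set) UNIV k"
    by (rule koszul_exact_vars[OF \<Lambda>]) simp
  note K = this[unfolded koszul_exact_def, THEN spec, of "\<lambda>l. \<pi> (g l)", THEN mp, THEN mp, OF _ 0]
  have "\<forall>l\<in>\<Lambda>. \<pi> (g l) \<in> UNIV \<inter> forms (Suc k)" using g \<pi>_forms by auto
  from K[OF this] obtain h where hB: "\<forall>l\<in>\<Lambda>. \<forall>m\<in>\<Lambda>. h l m \<in> UNIV \<inter> forms k \<and> h m l = - h l m"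
    and h0B: "\<forall>l\<in>\<Lambda>. \<pi> (g l) - (\<Sum>m\<in>\<Lambda>. var m * h l m) \<in> ideal_gen (var ` {})"
    by (elim exE conjE)
  have hF: "h l m \<in> forms k" and anti: "h m l = - h l m" if "l \<in> \<Lambda>" "m \<in> \<Lambda>" for l m
    using hB[rule_format, OF that] by blast+
  have "\<forall>f. \<exists>q. f \<in> forms k \<longrightarrow> q \<in> J \<inter> forms k \<and> f - q \<in> Y" using full by blast
  from choice[OF this] obtain c where c: "c f \<in> J \<inter> forms k" "f - c f \<in> Y" if "f \<in> forms k" for f
    by blast
  \<comment> \<open>The chosen representatives \<open>c\<close> need not respect signs; averaging
    restores antisymmetry without leaving the class modulo \<open>Y\<close>.\<close>
  define h' where "h' l m = smult (1 / 2) (c (h l m) - c (h m l))" for l m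
  have "h' l m \<in> J \<inter> forms k" if "l \<in> \<Lambda>" "m \<in> \<Lambda>" for l m
    unfolding h'_def using c(1)[OF hF[OF that]] c(1)[OF hF[OF that(2) that(1)]]
    by (intro IntI is_ideal_smult[OF iJ] ring_module.subspace_diff[OF iJ] forms_smult forms_diff) auto
  moreover have "h' m l = - h' l m" for l m
    unfolding h'_def by (simp flip: mpoly.scale_minus_right)
  moreover have "g l - (\<Sum>m\<in>\<Lambda>. var m * h' l m) \<in> Y" if l: "l \<in> \<Lambda>" for l
  proof -
    have diff: "h l m - h' l m \<in> Y" if m: "m \<in> \<Lambda>" for m
    proof -
      have "smult (1 / 2) ((h l m - c (h l m)) - (h m l - c (h m l))) \<in> Y"
        by (intro is_ideal_smult[OF iY] ring_module.subspace_diff[OF iY] c(2) hF l m)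
      moreover have "(p - u) - (q - v) = (p + p) - (u - v)" if "q = - p" for p q u v :: "('n, 'k) mpoly"
        using that by simp
      ultimately have "smult (1 / 2) ((h l m + h l m) - (c (h l m) - c (h m l))) \<in> Y"
        by (metis anti l m)
      then have "smult (1 / 2) (h l m + h l m) - h' l m \<in> Y"
        by (simp only: h'_def mpoly.scale_right_diff_distrib)
      then show ?thesis by (simp only: smult_half_double)
    qed
    have "(g l - \<pi> (g l)) + (\<Sum>m\<in>\<Lambda>. var m * (h l m - h' l m)) \<in> Y"
      by (intro ring_module.subspace_add[OF iY] ring_module.subspace_sum[OF iY] is_ideal_mult_left[OF iY]
          diff \<pi>_diff)
    moreover have "\<pi> (g l) = (\<Sum>m\<in>\<Lambda>. var m * h l m)" using h0B l by simp
    ultimately show ?thesis by (simp add: right_diff_distrib sum_subtractf)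
  qed
  ultimately show "\<exists>h. (\<forall>l\<in>\<Lambda>. \<forall>m\<in>\<Lambda>. h l m \<in> J \<inter> forms k \<and> h m l = - h l m) \<and>
      (\<forall>l\<in>\<Lambda>. g l - (\<Sum>m\<in>\<Lambda>. var m * h l m) \<in> Y)"
    by blast
qed

lemma koszul_exact_cong:
  assumes "\<And>l. l \<in> \<Lambda> \<Longrightarrow> x l = x' l"
  shows "koszul_exact \<Lambda> x Y J k \<longleftrightarrow> koszul_exact \<Lambda> x' Y J k"
  unfolding koszul_exact_def using assms by (simp cong: sum.cong)

text \<open>Exchange of one coordinate for a linear form. The coefficients change only by multiples
  of \<open>g a\<close>, so they stay in the same ideal and the same degree.\<close>

lemma eliminate_var:
  fixes S :: "'n::finite set" and c :: "'n \<Rightarrow> 'k::field"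
  assumes a: "a \<in> S" "c a \<noteq> 0" and c: "\<And>j. j \<notin> S \<Longrightarrow> c j = 0"
  shows "(\<Sum>j\<in>S. var j * g j) = linear_form c * smult (1 / c a) (g a) +
    (\<Sum>j\<in>S - {a}. var j * (g j - smult (c j / c a) (g a)))"
proof -
  have "linear_form c = (\<Sum>j\<in>S. smult (c j) (var j))"
    unfolding linear_form_def using c by (intro sum.mono_neutral_right) auto
  then have "linear_form c * smult (1 / c a) (g a) = (\<Sum>j\<in>S. var j * smult (c j / c a) (g a))"
    by (simp add: sum_distrib_right smult_mult_left smult_mult_right mpoly.scale_sum_right)
  also have "\<dots> = var a * g a + (\<Sum>j\<in>S - {a}. var j * smult (c j / c a) (g a))"
    using a by (subst sum.remove[of S a]) auto
  finally show ?thesis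
    using a by (subst sum.remove[of S a]) (auto simp: right_diff_distrib sum_subtractf)
qed


text \<open>\<open>gen\<close> says that \<open>J\<close> is generated in degrees at most
  \<open>t\<close>, \<open>full\<close> that R/(J + (L1, L2)) vanishes from degree \<open>t\<close>
  on, where L1 and L2 are the forms of \<open>\<alpha>\<close> and \<open>\<beta>\<close>. The
  normalization \<open>\<beta> a = 0\<close> makes the elimination of variable \<open>a\<close>
  through L1 fix L2, so the two eliminations can be composed.\<close>

theorem bayer_stillman:
  fixes J :: "('n::finite, 'k::field_char_0) mpoly set"
  defines "Y1 \<equiv> \<lambda>\<alpha>. ideal_add {0} (linear_form \<alpha> :: ('n, 'k) mpoly)"
  assumes J: "homogeneous_ideal J"
    and \<alpha>: "\<alpha> a \<noteq> 0" and \<beta>: "\<beta> a = 0" "\<beta> b \<noteq> 0"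
    and gen: "\<And>k p. t \<le> k \<Longrightarrow> p \<in> J \<inter> forms (Suc k) \<Longrightarrow>
      \<exists>g. (\<forall>v. g v \<in> J \<inter> forms k) \<and> p = (\<Sum>v\<in>UNIV. var v * g v)"
    and full: "\<And>k f. t \<le> k \<Longrightarrow> f \<in> forms k \<Longrightarrow>
      \<exists>q\<in>J \<inter> forms k. f - q \<in> ideal_add (Y1 \<alpha>) (linear_form \<beta>)"
    and colon1: "colon_stable {0} (linear_form \<alpha>) J t"
    and colon2: "colon_stable (Y1 \<alpha>) (linear_form \<beta>) J t"
    and k: "t \<le> k"
  shows "colon_stable {0} (linear_form \<alpha>) J k" "colon_stable (Y1 \<alpha>) (linear_form \<beta>) J k"
proof -
  let ?L1 = "linear_form \<alpha> :: ('n, 'k) mpoly" and ?L2 = "linear_form \<beta> :: ('n, 'k) mpoly"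
  let ?Y1 = "Y1 \<alpha>" and ?Y2 = "ideal_add (Y1 \<alpha>) ?L2"
  let ?\<Lambda> = "- {a, b}"
  have ab: "a \<noteq> b" using \<beta> by auto
  have L: "?L1 \<in> forms 1" "?L2 \<in> forms 1" by (rule linear_form_in_forms)+
  have i0: "homogeneous_ideal ({0} :: ('n, 'k) mpoly set)" by (rule homogeneous_zero)
  have i1: "homogeneous_ideal ?Y1" unfolding Y1_def by (rule homogeneous_ideal_add[OF i0 L(1)])
  have i2: "homogeneous_ideal ?Y2" by (rule homogeneous_ideal_add[OF i1 L(2)])
  define \<sigma> where "\<sigma> = subst (\<lambda>v. if v = a then var a - smult (1 / \<alpha> a) ?L1 else var v)"
  define \<tau> where "\<tau> = subst (\<lambda>v. if v = b then var b - smult (1 / \<beta> b) ?L2 else var v)"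
  note \<sigma> = ex_retraction[of \<alpha> a, OF \<alpha>, folded \<sigma>_def] and \<tau> = ex_retraction[of \<beta> b, OF \<beta>(2), folded \<tau>_def]
  have \<sigma>_hom: "\<sigma> (f + g) = \<sigma> f + \<sigma> g" "\<sigma> (f * g) = \<sigma> f * \<sigma> g" "\<sigma> 0 = 0" for f g
    by (simp_all add: \<sigma>_def subst_add subst_mult)
  have \<tau>_hom: "\<tau> (f + g) = \<tau> f + \<tau> g" "\<tau> (f * g) = \<tau> f * \<tau> g" "\<tau> 0 = 0" for f g
    by (simp_all add: \<tau>_def subst_add subst_mult)
  have Y1_gen: "?Y1 = ideal_gen {?L1}"
    unfolding Y1_def by (metis ideal_add_gen ring_module.span_empty)
  have Y1_diff: "f - \<sigma> f \<in> ?Y1" for f unfolding Y1_gen by (rule \<sigma>(3))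
  have Y1_0: "\<sigma> f = 0" if "f \<in> ?Y1" for f
  proof -
    obtain r where "f - r * ?L1 \<in> {0}"
      using \<open>f \<in> ?Y1\<close> mem_ideal_add[OF homogeneous_is_ideal[OF i0]] unfolding Y1_def by blast
    then have "f = r * ?L1" by simp
    then show ?thesis using \<sigma>(1) \<sigma>_hom(2) by simp
  qed
  have nzd1: "nonzerodivisor_mod {0} ?L1"
    unfolding nonzerodivisor_mod_def using linear_form_mult_eq_0[of \<alpha> a, OF \<alpha>] by blast
  have nzd2: "nonzerodivisor_mod ?Y1 ?L2"
    unfolding nonzerodivisor_mod_def
  proof (intro allI impI)
    fix f assume "?L2 * f \<in> ?Y1"
    then have "?L2 * \<sigma> f = 0" using Y1_0 \<sigma>_hom(2) \<sigma>(4)[of \<beta>, OF \<beta>(1)] by metis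
    then have "\<sigma> f = 0" by (rule linear_form_mult_eq_0[of \<beta> b, OF \<beta>(2)])
    then show "f \<in> ?Y1" using Y1_diff[of f] by simp
  qed
  define x where "x v = (if v = b then ?L2 else var v)" for v
  have x: "x v \<in> forms 1" for v using L var_in_forms by (auto simp: x_def)
  have Y2_le: "?Y1 \<subseteq> ?Y2" "?L2 \<in> ?Y2"
    using ring_module.span_superset[of "insert ?L2 ?Y1"] by auto
  have K2: "koszul_exact ?\<Lambda> x ?Y2 J k" if "t \<le> k" for k
  proof -
    have "koszul_exact ?\<Lambda> var ?Y2 J k"
    proof (rule koszul_exact_full[where \<pi> = "\<lambda>f. \<tau> (\<sigma> f)", OF J i2 finite])
      show "\<tau> (\<sigma> (var l)) = var l" if "l \<in> ?\<Lambda>" for l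
        using that by (simp add: \<sigma>_def \<tau>_def subst_var)
      show "\<tau> (\<sigma> f) \<in> forms j" if "f \<in> forms j" for f j
        using that unfolding \<sigma>_def \<tau>_def by (intro subst_forms \<sigma>(2) \<tau>(2))
      show "\<tau> (\<sigma> f) = 0" if "f \<in> ?Y2" for f
      proof -
        from mem_ideal_add[OF homogeneous_is_ideal[OF i1], THEN iffD1, OF that]
        obtain r where r: "f - r * ?L2 \<in> ?Y1" ..
        have "\<sigma> f = \<sigma> (f - r * ?L2) + \<sigma> (r * ?L2)"
          unfolding \<sigma>_hom(1)[symmetric] by simp
        also have "\<dots> = \<sigma> r * ?L2" using Y1_0[OF r] \<sigma>(4)[of \<beta>, OF \<beta>(1)] by (simp add: \<sigma>_hom(2))
        finally show ?thesis using \<tau>(1) by (simp add: \<tau>_hom(2))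
      qed
      show "f - \<tau> (\<sigma> f) \<in> ?Y2" for f
      proof -
        have "ideal_gen {?L2} \<subseteq> ?Y2" using Y2_le(2) by (intro ring_module.span_minimal) auto
        then have "\<sigma> f - \<tau> (\<sigma> f) \<in> ?Y2" using \<tau>(3) by (rule subsetD)
        then have "(f - \<sigma> f) + (\<sigma> f - \<tau> (\<sigma> f)) \<in> ?Y2"
          by (rule ring_module.span_add[OF subsetD[OF Y2_le(1) Y1_diff]])
        then show ?thesis by simp
      qed
    qed (use full that in \<open>auto simp: \<sigma>_hom \<tau>_hom\<close>)
    then show ?thesis by (subst koszul_exact_cong[where x' = var]) (auto simp: x_def)
  qed
  have gen2: "\<exists>u w g. u \<in> J \<inter> forms k \<and> w \<in> J \<inter> forms k \<and> (\<forall>v. g v \<in> J \<inter> forms k) \<and>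
      p = ?L1 * u + (?L2 * w + (\<Sum>v\<in>?\<Lambda>. var v * g v))" if tk: "t \<le> k" and p: "p \<in> J \<inter> forms (Suc k)" for k p
  proof -
    note sub = is_ideal_smult[OF homogeneous_is_ideal[OF J]] forms_smult forms_diff
      ring_module.subspace_diff[OF homogeneous_is_ideal[OF J]]
    from gen[OF tk p] obtain g where "\<forall>v. g v \<in> J \<inter> forms k" and "p = (\<Sum>v\<in>UNIV. var v * g v)"
      by (elim exE conjE)
    then have g: "\<And>v. g v \<in> J \<inter> forms k" "p = (\<Sum>v\<in>UNIV. var v * g v)" by blast+
    define g1 where "g1 v = g v - smult (\<alpha> v / \<alpha> a) (g a)" for v
    have g1: "g1 v \<in> J \<inter> forms k" for v unfolding g1_def using g(1) by (auto intro!: sub)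
    define g2 where "g2 v = g1 v - smult (\<beta> v / \<beta> b) (g1 b)" for v
    have g2: "g2 v \<in> J \<inter> forms k" for v unfolding g2_def using g1 by (auto intro!: sub)
    have "p = ?L1 * smult (1 / \<alpha> a) (g a) + (\<Sum>v\<in>UNIV - {a}. var v * g1 v)"
      unfolding g(2) g1_def by (rule eliminate_var) (use \<alpha> in auto)
    also have "(\<Sum>v\<in>UNIV - {a}. var v * g1 v) = ?L2 * smult (1 / \<beta> b) (g1 b) + (\<Sum>v\<in>UNIV - {a} - {b}. var v * g2 v)"
      unfolding g2_def by (rule eliminate_var) (use \<beta> ab in auto)
    also have "UNIV - {a} - {b} = ?\<Lambda>" by auto
    finally show ?thesis
      using g(1) g1 g2
      by (intro exI[of _ "smult (1 / \<alpha> a) (g a)"] exI[of _ "smult (1 / \<beta> b) (g1 b)"] exI[of _ g2])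
        (auto intro!: sub)
  qed
  \<comment> \<open>\<open>K2\<close> in each degree lifts the colon condition of L2 modulo L1 one
    degree up; in the expansion \<open>gen2\<close> the term with L1 vanishes modulo
    \<open>?Y1\<close>.\<close>
  have C2: "colon_stable ?Y1 ?L2 J k" if "t \<le> k" for k
    using that
  proof (induction k rule: nat_induct_at_least)
    case base
    show ?case by (rule colon2)
  next
    case (Suc k)
    show ?case
    proof (rule colon_step[OF J i1 finite L(2) x K2[OF Suc.hyps] Suc.IH nzd2])
      fix p assume "p \<in> J \<inter> forms (Suc (Suc k))"
      then obtain u w g where g: "u \<in> J \<inter> forms (Suc k)" "w \<in> J \<inter> forms (Suc k)" "\<And>v. g v \<in> J \<inter> forms (Suc k)"
        "p = ?L1 * u + (?L2 * w + (\<Sum>v\<in>?\<Lambda>. var v * g v))"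
        using gen2[of "Suc k" p] Suc.hyps by auto
      have "?L1 \<in> ?Y1" unfolding Y1_gen by (simp add: ring_module.span_base)
      then have "?L1 * u \<in> ?Y1" by (rule is_ideal_mult_right[OF homogeneous_is_ideal[OF i1]])
      moreover have "(\<Sum>v\<in>?\<Lambda>. x v * g v) = (\<Sum>v\<in>?\<Lambda>. var v * g v)"
        by (intro sum.cong) (auto simp: x_def)
      then have "p - ((\<Sum>v\<in>?\<Lambda>. x v * g v) + ?L2 * w) = ?L1 * u" unfolding g(4) by simp
      ultimately show "\<exists>g u. (\<forall>l\<in>?\<Lambda>. g l \<in> J \<inter> forms (Suc k)) \<and> u \<in> J \<inter> forms (Suc k) \<and>
          p - ((\<Sum>l\<in>?\<Lambda>. x l * g l) + ?L2 * u) \<in> ?Y1"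
        using g(2,3) by (intro exI[of _ g] exI[of _ w]) auto
    qed
  qed
  \<comment> \<open>Adjoining L2 to the family brings Koszul exactness down from (L1, L2) to (L1),
    as the colon condition of L1 in the ring requires.\<close>
  have K1: "koszul_exact (insert b ?\<Lambda>) x ?Y1 J k" if "t \<le> k" for k
  proof -
    have "x b = ?L2" by (simp add: x_def)
    then show ?thesis
      using K2[OF that] C2[OF that] nzd2 by (intro koszul_step J i1 x) auto
  qed
  show "colon_stable ?Y1 ?L2 J k" by (rule C2[OF k])
  show "colon_stable {0} ?L1 J k"
    using k
  proof (induction k rule: nat_induct_at_least)
    case base
    show ?case by (rule colon1)
  next
    case (Suc k)
    show ?case
    proof (rule colon_step[OF J i0 finite L(1) x K1[OF Suc.hyps, unfolded Y1_def] Suc.IH nzd1])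
      fix p assume "p \<in> J \<inter> forms (Suc (Suc k))"
      then obtain u w g where g: "u \<in> J \<inter> forms (Suc k)" "w \<in> J \<inter> forms (Suc k)" "\<And>v. g v \<in> J \<inter> forms (Suc k)"
        "p = ?L1 * u + (?L2 * w + (\<Sum>v\<in>?\<Lambda>. var v * g v))"
        using gen2[of "Suc k" p] Suc.hyps by auto
      have "(\<Sum>v\<in>?\<Lambda>. x v * (g(b := w)) v) = (\<Sum>v\<in>?\<Lambda>. var v * g v)"
        by (intro sum.cong) (auto simp: x_def)
      then have "(\<Sum>v\<in>insert b ?\<Lambda>. x v * (g(b := w)) v) = ?L2 * w + (\<Sum>v\<in>?\<Lambda>. var v * g v)"
        by (simp add: x_def)
      then have "p - ((\<Sum>v\<in>insert b ?\<Lambda>. x v * (g(b := w)) v) + ?L1 * u) \<in> {0}" unfolding g(4) by simp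
      then show "\<exists>g u. (\<forall>l\<in>insert b ?\<Lambda>. g l \<in> J \<inter> forms (Suc k)) \<and> u \<in> J \<inter> forms (Suc k) \<and>
          p - ((\<Sum>l\<in>insert b ?\<Lambda>. x l * g l) + ?L1 * u) \<in> {0}"
        using g(1-3) by (intro exI[of _ "g(b := w)"] exI[of _ u]) auto
    qed
  qed
qed

section \<open>Persistence of the Hilbert function\<close>

lemma forms_Suc_decomp:
  fixes f :: "('n::finite, 'k::field) mpoly"
  assumes "f \<in> forms (Suc k)"
  shows "\<exists>g. (\<forall>v. g v \<in> forms k) \<and> f = (\<Sum>v\<in>UNIV. var v * g v)"
proof -
  let ?S = "{f :: ('n, 'k) mpoly. \<exists>g. (\<forall>v. g v \<in> forms k) \<and> f = (\<Sum>v\<in>UNIV. var v * g v)}"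
  have "mpoly.subspace ?S"
  proof (rule mpoly.subspaceI)
    show "0 \<in> ?S" using forms_0 by (auto intro!: exI[of _ "\<lambda>v. 0"])
  next
    fix x y assume "x \<in> ?S" "y \<in> ?S"
    then obtain g g' where "\<forall>v. g v \<in> forms k" "x = (\<Sum>v\<in>UNIV. var v * g v)"
      "\<forall>v. g' v \<in> forms k" "y = (\<Sum>v\<in>UNIV. var v * g' v)" by blast
    then show "x + y \<in> ?S"
      by (auto intro!: exI[of _ "\<lambda>v. g v + g' v"] forms_add simp: distrib_left sum.distrib)
  next
    fix c and x assume "x \<in> ?S"
    then obtain g where "\<forall>v. g v \<in> forms k" "x = (\<Sum>v\<in>UNIV. var v * g v)" by blast
    then show "smult c x \<in> ?S"
      by (auto intro!: exI[of _ "\<lambda>v. smult c (g v)"] forms_smult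
          simp: smult_mult_right mpoly.scale_sum_right)
  qed
  moreover have "Poly_Mapping.single m 1 \<in> ?S" if m: "mdeg m = Suc k" for m :: "'n \<Rightarrow>\<^sub>0 nat"
  proof -
    have "\<exists>v. Poly_Mapping.lookup m v \<noteq> 0"
      using m unfolding mdeg_def by (metis nat.distinct(1) sum.neutral)
    then obtain v where v: "Poly_Mapping.lookup m v \<noteq> 0" ..
    let ?m = "m - Poly_Mapping.single v 1"
    have mm: "Poly_Mapping.single v 1 + ?m = m"
      using v by (intro poly_mapping_eqI) (auto simp: lookup_add lookup_minus lookup_single when_def)
    have "mdeg (Poly_Mapping.single v 1) = 1"
      unfolding mdeg_def by (simp add: lookup_single when_def)
    then have "mdeg ?m = k" using m mdeg_add[of "Poly_Mapping.single v 1" ?m] mm by simp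
    then have "Poly_Mapping.single ?m 1 \<in> (forms k :: ('n, 'k) mpoly set)" by (simp add: forms_def)
    moreover have "Poly_Mapping.single m 1 = var v * (Poly_Mapping.single ?m 1 :: ('n, 'k) mpoly)"
      unfolding var_def mult_single mm by simp
    then have "Poly_Mapping.single m 1 = (\<Sum>u\<in>UNIV. var u * (if u = v then Poly_Mapping.single ?m 1 else 0 :: ('n, 'k) mpoly))"
      by (simp add: if_distrib cong: if_cong)
    ultimately show ?thesis
      using forms_0 by (intro CollectI exI[of _ "\<lambda>u. if u = v then Poly_Mapping.single ?m 1 else 0"]) auto
  qed
  ultimately have "mpoly.span ((\<lambda>m. Poly_Mapping.single m 1) ` {m. mdeg m = Suc k}) \<subseteq> ?S"
    by (intro mpoly.span_minimal) auto
  then show ?thesis using assms forms_subset_span by blast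
qed

section \<open>Truncations of an ideal\<close>

lemma homogeneous_ideal_le: "homogeneous_ideal (ideal_le d I)"
  unfolding ideal_le_def by (rule homogeneous_ideal_gen) auto

lemma ideal_le_subset: "is_ideal I \<Longrightarrow> ideal_le d I \<subseteq> I"
  unfolding ideal_le_def by (rule ring_module.span_minimal) auto

lemma ideal_le_forms: "k \<le> d \<Longrightarrow> I \<inter> forms k \<subseteq> ideal_le d I"
  unfolding ideal_le_def by (auto intro!: ring_module.span_base)

lemma ideal_le_mono: "d \<le> e \<Longrightarrow> ideal_le d I \<subseteq> ideal_le e I"
  unfolding ideal_le_def by (intro ring_module.span_mono UN_mono) auto

lemma ideal_le_decomp:
  fixes I :: "('n::finite, 'k::field) mpoly set"
  assumes k: "d \<le> k" and p: "p \<in> ideal_le d I \<inter> forms (Suc k)"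
  shows "\<exists>g. (\<forall>v. g v \<in> ideal_le d I \<inter> forms k) \<and> p = (\<Sum>v\<in>UNIV. var v * g v)"
proof -
  let ?J = "ideal_le d I"
  have iJ: "is_ideal ?J" using homogeneous_ideal_le by (rule homogeneous_is_ideal)
  \<comment> \<open>The induction concerns the component of degree \<open>k + 1\<close>, since
    partial sums of a representation in the span need not be homogeneous.\<close>
  have "\<exists>g. (\<forall>v. g v \<in> ?J \<inter> forms k) \<and> hcomp (Suc k) f = (\<Sum>v\<in>UNIV. var v * g v)"
    if "f \<in> ?J" for f
    using that unfolding ideal_le_def[of d I]
  proof (induction rule: ring_module.span_induct_alt)
    case base
    show ?case using ring_module.subspace_0[OF iJ] forms_0
      by (intro exI[of _ "\<lambda>v. 0"]) (auto simp: ideal_le_def)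
  next
    case (step c x y)
    obtain g where g: "\<forall>v. g v \<in> ?J \<inter> forms k" "hcomp (Suc k) y = (\<Sum>v\<in>UNIV. var v * g v)"
      using step(2) unfolding ideal_le_def by blast
    obtain e where e: "e \<le> d" "x \<in> I" "x \<in> forms e" using step(1) by auto
    have xJ: "x \<in> ?J" using e ideal_le_forms by blast
    \<comment> \<open>As \<open>e \<le> d\<close> and \<open>d \<le> k\<close>, this coefficient has
      positive degree; a variable can be split off it while the generator \<open>x\<close> stays
      whole.\<close>
    have "hcomp (Suc k - e) c \<in> forms (Suc (k - e))"
      using hcomp_in_forms[of "Suc k - e" c] e k by (simp add: Suc_diff_le)
    from forms_Suc_decomp[OF this] obtain a
      where a: "\<forall>v. a v \<in> forms (k - e)" "hcomp (Suc k - e) c = (\<Sum>v\<in>UNIV. var v * a v)"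
      by (elim exE conjE)
    have "hcomp (Suc k) (x * c) = (\<Sum>v\<in>UNIV. var v * (x * a v))"
      using e k by (simp add: hcomp_mult_form a(2) sum_distrib_left mult.left_commute)
    moreover have "x * a v \<in> ?J \<inter> forms k" for v
      using forms_mult[OF e(3), of "a v" "k - e"] a(1) e(1) k is_ideal_mult_right[OF iJ xJ] by auto
    ultimately show ?case
      using g unfolding ideal_le_def[of d I, symmetric]
      by (intro exI[of _ "\<lambda>v. x * a v + g v"])
        (auto simp: hcomp_add mult.commute[of c x] distrib_left sum.distrib
          intro!: forms_add ring_module.subspace_add[OF iJ])
  qed
  from this[of p] have "\<exists>g. (\<forall>v. g v \<in> ?J \<inter> forms k) \<and> hcomp (Suc k) p = (\<Sum>v\<in>UNIV. var v * g v)"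
    using p by blast
  moreover have "hcomp (Suc k) p = p" using p forms_iff_hcomp by blast
  ultimately show ?thesis by (simp only:)
qed

lemma homogeneous_rep:
  assumes "homogeneous_ideal J" "homogeneous_ideal Y" "f \<in> forms k" "p \<in> J" "f - p \<in> Y"
  shows "\<exists>q\<in>J \<inter> forms k. f - q \<in> Y"
proof
  show "hcomp k p \<in> J \<inter> forms k" using assms homogeneous_hcomp hcomp_in_forms by blast
  have "hcomp k (f - p) \<in> Y" using assms homogeneous_hcomp by blast
  then show "f - hcomp k p \<in> Y" using assms(3) by (simp add: hcomp_diff hcomp_form)
qed

text \<open>Reads membership in J + (y) as congruence modulo (y) to an element of \<open>J\<close>,
  the shape used in \<open>colon_stable\<close>.\<close>

lemma mem_ideal_add_iff_rep:
  assumes "is_ideal J"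
  shows "f \<in> ideal_add J y \<longleftrightarrow> (\<exists>p\<in>J. f - p \<in> ideal_add {0} y)"
proof
  assume "f \<in> ideal_add J y"
  then obtain r where r: "f - r * y \<in> J" using mem_ideal_add[OF assms] by blast
  have "f - (f - r * y) - r * y \<in> {0}" by simp
  then have "f - (f - r * y) \<in> ideal_add {0} y"
    unfolding mem_ideal_add[OF ring_module.subspace_single_0] by blast
  then show "\<exists>p\<in>J. f - p \<in> ideal_add {0} y" using r by blast
next
  assume "\<exists>p\<in>J. f - p \<in> ideal_add {0} y"
  then obtain p r where "p \<in> J" "f - p - r * y \<in> {0}"
    using mem_ideal_add[OF ring_module.subspace_single_0] by blast
  moreover from this(2) have "f - r * y = p" by (simp add: algebra_simps)
  ultimately show "f \<in> ideal_add J y" using mem_ideal_add[OF assms] by blast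
qed

lemma hilbert_add_surjective:
  assumes I: "homogeneous_ideal I" and y: "y \<in> forms 1" and full: "forms (Suc k) \<subseteq> ideal_add I y"
  shows "hilbert {g. y * g \<in> I} k = hilbert I (Suc k)"
  using hilbert_add_form[OF I y, of k] full
  by (simp add: forms_subset_iff_hilbert[OF ring_module.subspace_span])

text \<open>When R/(I + (y)) vanishes in degree \<open>k + 1\<close>, multiplication by
  \<open>y\<close> maps R/I from degree \<open>k\<close> onto that degree.\<close>

lemma hilbert_antimono_surjective:
  assumes I: "homogeneous_ideal I" and y: "y \<in> forms 1" and full: "forms (Suc k) \<subseteq> ideal_add I y"
  shows "hilbert I (Suc k) \<le> hilbert I k"
proof -
  have "I \<subseteq> {g. y * g \<in> I}" using is_ideal_mult_left[OF homogeneous_is_ideal[OF I]] by blast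
  then have "hilbert {g. y * g \<in> I} k \<le> hilbert I k" by (intro hilbert_antimono) auto
  then show ?thesis using hilbert_add_surjective[OF assms] by simp
qed

text \<open>The truncation J agrees with \<open>I\<close> in degree \<open>t\<close> and lies in it,
  so injectivity in degree \<open>t\<close> is inherited: that of \<open>L1\<close> is
  \<open>nz\<close>, that of \<open>L2\<close> on R/(I + (L1)) follows from \<open>flat\<close>.
  Bayer-Stillman propagates both. Then R/(J + (L1)) has a constant Hilbert function from
  \<open>t\<close> on, and this constant is the slope for R/J.\<close>

theorem hilbert_persistence:
  fixes I :: "('n::finite, 'k::field_char_0) mpoly set"
  assumes I: "homogeneous_ideal I"
    and \<alpha>: "\<alpha> a \<noteq> 0" and \<beta>: "\<beta> a = 0" "\<beta> b \<noteq> 0"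
  defines "L1 \<equiv> linear_form \<alpha>" and "L2 \<equiv> linear_form \<beta>"
  assumes nz: "\<And>f. f \<in> forms t \<Longrightarrow> L1 * f \<in> I \<Longrightarrow> f \<in> I"
    and full: "\<And>k. t \<le> k \<Longrightarrow> forms k \<subseteq> ideal_add (ideal_add I L1) L2"
    and flat: "hilbert (ideal_add I L1) (Suc t) = hilbert (ideal_add I L1) t"
    and k: "t \<le> k"
  shows "hilbert (ideal_le t I) (Suc k) = hilbert (ideal_le t I) k + hilbert (ideal_add I L1) t"
proof -
  let ?J = "ideal_le t I" and ?Y1 = "ideal_add {0} L1"
  let ?Y2 = "ideal_add ?Y1 L2"
  have L: "L1 \<in> forms 1" "L2 \<in> forms 1" unfolding L1_def L2_def by (rule linear_form_in_forms)+
  have iI: "is_ideal I" using I by (rule homogeneous_is_ideal)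
  have J: "homogeneous_ideal ?J" by (rule homogeneous_ideal_le)
  then have iJ: "is_ideal ?J" by (rule homogeneous_is_ideal)
  have Y1: "homogeneous_ideal ?Y1" by (rule homogeneous_ideal_add[OF homogeneous_zero L(1)])
  have Y2: "homogeneous_ideal ?Y2" by (rule homogeneous_ideal_add[OF Y1 L(2)])
  have JI: "?J \<subseteq> I" by (rule ideal_le_subset[OF iI])
  have I1: "homogeneous_ideal (ideal_add I L1)" by (rule homogeneous_ideal_add[OF I L(1)])
  have J1: "homogeneous_ideal (ideal_add ?J L1)" by (rule homogeneous_ideal_add[OF J L(1)])
  have IJt: "q \<in> ?J \<inter> forms t" if "q \<in> I \<inter> forms t" for q
    using that ideal_le_forms[of t t I] by blast
  have add_t: "f \<in> ideal_add ?J L1" if "f \<in> ideal_add I L1" "f \<in> forms t" for f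
    using that homogeneous_rep[OF I Y1] IJt
    unfolding mem_ideal_add_iff_rep[OF iI] mem_ideal_add_iff_rep[OF iJ] by blast
  \<comment> \<open>In degree \<open>t\<close> this comes from \<open>full\<close>, since
    \<open>I\<close> and \<open>?J\<close> agree there; above \<open>t\<close> they may differ, and
    the claim is passed on by multiplying with variables.\<close>
  have fullJ: "\<exists>q\<in>?J \<inter> forms j. f - q \<in> ?Y2" if "t \<le> j" "f \<in> forms j" for j f
    using that
  proof (induction j arbitrary: f rule: nat_induct_at_least)
    case base
    have "f \<in> ideal_add (ideal_add I L1) L2" using full base by blast
    then obtain r where "f - r * L2 \<in> ideal_add I L1"
      using mem_ideal_add[OF ring_module.subspace_span] by blast
    then obtain p where p: "p \<in> I" "f - r * L2 - p \<in> ?Y1"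
      using mem_ideal_add_iff_rep[OF iI] by blast
    have "f - p - r * L2 = f - r * L2 - p" by simp
    then have "f - p \<in> ?Y2"
      unfolding mem_ideal_add[OF homogeneous_is_ideal[OF Y1]] using p(2) by (metis)
    then show ?case using homogeneous_rep[OF I Y2 base p(1)] IJt by blast
  next
    case (Suc j)
    from forms_Suc_decomp[OF Suc.prems] obtain g
      where g: "\<forall>v. g v \<in> forms j" "f = (\<Sum>v\<in>UNIV. var v * g v)" by (elim exE conjE)
    have "\<forall>v. \<exists>q. q \<in> ?J \<inter> forms j \<and> g v - q \<in> ?Y2" using Suc.IH g(1) by blast
    from choice[OF this] obtain q where q: "\<forall>v. q v \<in> ?J \<inter> forms j \<and> g v - q v \<in> ?Y2" ..
    have "var v * q v \<in> ?J \<inter> forms (Suc j)" for v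
      using q forms_mult[OF var_in_forms, of "q v" j v] is_ideal_mult_left[OF iJ] by auto
    then have "(\<Sum>v\<in>UNIV. var v * q v) \<in> ?J \<inter> forms (Suc j)"
      by (intro IntI forms_sum ring_module.subspace_sum[OF iJ]) auto
    moreover have "(\<Sum>v\<in>UNIV. var v * (g v - q v)) \<in> ?Y2"
      using q by (intro ring_module.span_sum ring_module.span_scale) blast
    then have "f - (\<Sum>v\<in>UNIV. var v * q v) \<in> ?Y2"
      by (simp add: g(2) right_diff_distrib sum_subtractf)
    ultimately show ?case by blast
  qed
  have colon1: "colon_stable {0} L1 ?J t"
    unfolding colon_stable_def
  proof (intro ballI impI)
    fix f p assume f: "f \<in> forms t" "p \<in> ?J" "L1 * f - p \<in> {0}"
    then have "f \<in> I" using nz[of f] JI by auto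
    then show "\<exists>q\<in>?J \<inter> forms t. f - q \<in> {0}" using f IJt by (intro bexI[of _ f]) auto
  qed
  have colon2: "colon_stable ?Y1 L2 ?J t"
    unfolding colon_stable_def
  proof (intro ballI impI)
    fix f p assume f: "f \<in> forms t" "p \<in> ?J" "L2 * f - p \<in> ?Y1"
    then have "f \<in> {g. L2 * g \<in> ideal_add I L1} \<inter> forms t"
      using JI mem_ideal_add_iff_rep[OF iI] by blast
    \<comment> \<open>Multiplication by \<open>L2\<close> is onto in degree \<open>t + 1\<close>, so
      \<open>flat\<close> leaves no room for a kernel: the colon ideal cannot exceed I + (L1) in
      degree \<open>t\<close>.\<close>
    moreover have "hilbert (ideal_add I L1) t \<le> hilbert {g. L2 * g \<in> ideal_add I L1} t"
      using hilbert_add_surjective[OF I1 L(2) full[of "Suc t"]] flat by simp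
    then have "{g. L2 * g \<in> ideal_add I L1} \<inter> forms t \<subseteq> ideal_add I L1"
      using is_ideal_mult_left[OF homogeneous_is_ideal[OF I1]] homogeneous_is_ideal[OF I1]
      by (intro hilbert_le_imp_subset) auto
    ultimately have "f \<in> ideal_add ?J L1" using add_t f(1) by blast
    then show "\<exists>q\<in>?J \<inter> forms t. f - q \<in> ?Y1"
      using homogeneous_rep[OF J Y1 f(1)] mem_ideal_add_iff_rep[OF iJ] by blast
  qed
  have col: "colon_stable {0} L1 ?J j" "colon_stable ?Y1 L2 ?J j" if "t \<le> j" for j
    using bayer_stillman[OF J \<alpha> \<beta> ideal_le_decomp fullJ[unfolded L1_def L2_def]
        colon1[unfolded L1_def] colon2[unfolded L1_def L2_def] that]
    unfolding L1_def L2_def by auto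
  have eq1: "hilbert {g. L1 * g \<in> ?J} j = hilbert ?J j" if "t \<le> j" for j
  proof (rule hilbert_cong)
    show "?J \<inter> forms j = {g. L1 * g \<in> ?J} \<inter> forms j"
      using col(1)[OF that] is_ideal_mult_left[OF iJ] unfolding colon_stable_def by fastforce
  qed
  have eq2: "hilbert {g. L2 * g \<in> ideal_add ?J L1} j = hilbert (ideal_add ?J L1) j" if "t \<le> j" for j
  proof (rule hilbert_cong)
    have "g \<in> ideal_add ?J L1" if "L2 * g \<in> ideal_add ?J L1" "g \<in> forms j" for g
      using that col(2)[OF \<open>t \<le> j\<close>] unfolding colon_stable_def mem_ideal_add_iff_rep[OF iJ] by blast
    then show "ideal_add ?J L1 \<inter> forms j = {g. L2 * g \<in> ideal_add ?J L1} \<inter> forms j"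
      using is_ideal_mult_left[OF homogeneous_is_ideal[OF J1]] by blast
  qed
  have full': "forms j \<subseteq> ideal_add (ideal_add ?J L1) L2" if j: "t \<le> j" for j
  proof
    fix f :: "('n, 'k) mpoly" assume "f \<in> forms j"
    then obtain q where q: "q \<in> ?J" "f - q \<in> ?Y2" using fullJ[OF j] by blast
    then obtain r where "f - q - r * L2 \<in> ?Y1" using mem_ideal_add[OF homogeneous_is_ideal[OF Y1]] by blast
    then have "f - r * L2 - q \<in> ?Y1" by (simp add: algebra_simps)
    then have "f - r * L2 \<in> ideal_add ?J L1" using q(1) mem_ideal_add_iff_rep[OF iJ] by blast
    then show "f \<in> ideal_add (ideal_add ?J L1) L2"
      using mem_ideal_add[OF ring_module.subspace_span] by blast
  qed
  have const: "hilbert (ideal_add ?J L1) j = hilbert (ideal_add I L1) t" if "t \<le> j" for j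
    using that
  proof (induction j rule: nat_induct_at_least)
    case base
    have "ideal_add ?J L1 \<subseteq> ideal_add I L1" using JI by (intro ring_module.span_mono) auto
    then show ?case using add_t by (intro hilbert_cong) blast
  next
    case (Suc j)
    then show ?case
      using hilbert_add_surjective[OF J1 L(2) full'[of "Suc j"]] eq2[of j] by simp
  qed
  show ?thesis
    using hilbert_add_form[OF J L(1), of k] eq1[OF k] const[of "Suc k"] k by simp
qed


section \<open>Reduction to a general pencil\<close>

lemma linear_form_add_smult:
  "linear_form \<alpha> + smult c (linear_form \<beta>) = linear_form (\<lambda>j. \<alpha> j + c * \<beta> j)"
  by (simp add: linear_form_def mpoly.scale_sum_right mpoly.scale_left_distrib sum.distrib)

lemma ideal_add_subsetI: "is_ideal J \<Longrightarrow> I \<subseteq> J \<Longrightarrow> f \<in> J \<Longrightarrow> ideal_add I f \<subseteq> J"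
  by (intro ring_module.span_minimal) auto

lemma ideal_add_superset: "I \<subseteq> ideal_add I f" "f \<in> ideal_add I f"
  using ring_module.span_superset[of "insert f I"] by auto

text \<open>The multiplier of the first form is adjusted inside the pencil, which does not change the
  ideal generated by both forms; hence injectivity on \<open>R/I\<close> comes for free from saturation.\<close>

lemma ex_general_pencil:
  fixes I :: "('n::finite, 'k::field_char_0) mpoly set"
  assumes I: "homogeneous_ideal I" and sat: "saturation I = I" and r: "is_r 2 I r"
  shows "\<exists>\<alpha> \<beta>. (\<forall>k>r. forms k \<subseteq> ideal_add (ideal_add I (linear_form \<alpha>)) (linear_form \<beta>)) \<and>
    (\<forall>k\<le>t. \<forall>f\<in>forms k. linear_form \<alpha> * f \<in> I \<longrightarrow> f \<in> I)"
proof -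
  have iI: "is_ideal I" using I by (rule homogeneous_is_ideal)
  obtain F :: "(nat \<times> 'n, 'k) mpoly" where F: "F \<noteq> 0" and P: "\<And>a. poly_eval a F \<noteq> 0 \<Longrightarrow>
      \<forall>j>r. hilbert (ideal_gen (I \<union> (\<lambda>i. linear_form (\<lambda>j. a (i, j))) ` {..<2})) j = 0"
    using r unfolding is_r_def for_general_linear_forms_def by blast
  obtain a where "poly_eval a F \<noteq> 0" using ex_poly_eval_nonzero[OF F] by blast
  note hj = P[OF this]
  define \<alpha> where "\<alpha> j = a (0, j)" for j
  define \<beta> where "\<beta> j = a (1, j)" for j
  let ?A = "linear_form \<alpha>" and ?B = "linear_form \<beta>"
  have "(\<lambda>i. linear_form (\<lambda>j. a (i, j))) ` {..<2} = {?B, ?A}"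
    by (auto simp: lessThan_nat_numeral lessThan_Suc \<alpha>_def[abs_def] \<beta>_def[abs_def] numeral_2_eq_2)
  then have "ideal_gen (I \<union> (\<lambda>i. linear_form (\<lambda>j. a (i, j))) ` {..<2}) = ideal_add (ideal_add I ?A) ?B"
    by (simp add: ideal_add_gen insert_commute)
  then have full: "forms k \<subseteq> ideal_add (ideal_add I ?A) ?B" if "r < k" for k
    using hj that forms_subset_iff_hilbert[of "ideal_add (ideal_add I ?A) ?B" k] by simp
  have rep: "\<exists>p q. g - (?A * p + ?B * q) \<in> I" if g: "g \<in> forms (Suc r)" for g
  proof -
    have "g \<in> ideal_add (ideal_add I ?A) ?B" using g full[of "Suc r"] by blast
    then obtain q where "g - q * ?B \<in> ideal_add I ?A"
      using mem_ideal_add[OF ring_module.subspace_span] by blast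
    then obtain p where "g - q * ?B - p * ?A \<in> I" using mem_ideal_add[OF iI] by blast
    moreover have "g - q * ?B - p * ?A = g - (?A * p + ?B * q)" by (simp add: algebra_simps)
    ultimately have "g - (?A * p + ?B * q) \<in> I" by (simp only:)
    then show ?thesis by blast
  qed
  from ex_pencil_colon[where t = t, OF iI sat rep] obtain c
    where c: "\<forall>f\<in>forms t. (?A + smult c ?B) * f \<in> I \<longrightarrow> f \<in> I" by blast
  define \<gamma> where "\<gamma> j = \<alpha> j + c * \<beta> j" for j
  have \<gamma>: "linear_form \<gamma> = ?A + smult c ?B" unfolding \<gamma>_def[abs_def] linear_form_add_smult ..
  have "forms k \<subseteq> ideal_add (ideal_add I (linear_form \<gamma>)) ?B" if "r < k" for k
  proof -
    let ?K = "ideal_add (ideal_add I (linear_form \<gamma>)) ?B"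
    have "linear_form \<gamma> \<in> ?K" "?B \<in> ?K" "I \<subseteq> ?K" using ideal_add_superset by blast+
    then have "linear_form \<gamma> - smult c ?B \<in> ?K"
      by (intro ring_module.span_diff is_ideal_smult) auto
    then have "?A \<in> ?K" by (simp add: \<gamma>)
    then have "ideal_add (ideal_add I ?A) ?B \<subseteq> ?K"
      using \<open>?B \<in> ?K\<close> \<open>I \<subseteq> ?K\<close> by (intro ideal_add_subsetI) auto
    then show ?thesis using full[OF that] by blast
  qed
  \<comment> \<open>Injectivity descends from degree \<open>t\<close>: multiplying \<open>f\<close>
    by any linear form gives a form of the next degree killed in the same way, and saturation then
    returns \<open>f\<close> to \<open>I\<close>.\<close>
  moreover have "\<forall>f\<in>forms k. linear_form \<gamma> * f \<in> I \<longrightarrow> f \<in> I" if "k \<le> t" for k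
    using that
  proof (induction k rule: inc_induct)
    case base
    then show ?case using c by (simp add: \<gamma>)
  next
    case (step k)
    show ?case
    proof (intro ballI impI)
      fix f assume f: "f \<in> forms k" "linear_form \<gamma> * f \<in> I"
      show "f \<in> I"
      proof (rule saturatedD[OF sat])
        fix g :: "('n, 'k) mpoly" assume g: "g \<in> forms 1"
        have "g * f \<in> forms (Suc k)" using forms_mult[OF g f(1)] by simp
        moreover have "g * (linear_form \<gamma> * f) \<in> I" by (rule is_ideal_mult_left[OF iI f(2)])
        then have "linear_form \<gamma> * (g * f) \<in> I" by (simp only: mult.left_commute)
        ultimately show "g * f \<in> I" using step.IH by blast
      qed
    qed
  qed
  ultimately show ?thesis by blast
qed

text \<open>With \<open>L\<close> injective on R/I in degree \<open>k\<close>, the first difference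
  is the Hilbert function of the hyperplane section R/(I + (L)), on which the second form of a
  pencil can act.\<close>

lemma delta_hilbert_eq:
  assumes I: "homogeneous_ideal I" and L: "L \<in> forms 1"
    and nz: "\<And>f. f \<in> forms k \<Longrightarrow> L * f \<in> I \<Longrightarrow> f \<in> I"
  shows "delta_hilbert I (Suc k) = int (hilbert (ideal_add I L) (Suc k))"
proof -
  have "hilbert {g. L * g \<in> I} k = hilbert I k"
    using nz is_ideal_mult_left[OF homogeneous_is_ideal[OF I]] by (intro hilbert_cong) blast
  then show ?thesis
    using hilbert_add_form[OF I L, of k] by (simp add: delta_hilbert_def)
qed

text \<open>Past \<open>r\<close> the second form of the pencil maps the hyperplane section by the
  first one onto its next degree.\<close>

lemma delta_hilbert_decreasing:
  fixes I :: "('n::finite, 'k::field_char_0) mpoly set"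
  assumes I: "homogeneous_ideal I" and sat: "saturation I = I" and r: "is_r 2 I r" and k: "r < k"
  shows "delta_hilbert I (Suc k) \<le> delta_hilbert I k"
proof -
  from ex_general_pencil[OF I sat r, of k] obtain \<alpha> \<beta> where
    full: "\<And>k. r < k \<Longrightarrow> forms k \<subseteq> ideal_add (ideal_add I (linear_form \<alpha>)) (linear_form \<beta>)"
    and nz: "\<And>j f. j \<le> k \<Longrightarrow> f \<in> forms j \<Longrightarrow> linear_form \<alpha> * f \<in> I \<Longrightarrow> f \<in> I" by blast
  \<comment> \<open>The value at \<open>k\<close> uses injectivity one degree lower, at
    \<open>j\<close>; positivity of \<open>k\<close> also avoids the special case of
    \<open>delta_hilbert\<close> at 0.\<close>
  obtain j where j: "k = Suc j" using k by (cases k) auto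
  have "hilbert (ideal_add I (linear_form \<alpha>)) (Suc k) \<le> hilbert (ideal_add I (linear_form \<alpha>)) k"
    using k by (intro hilbert_antimono_surjective[OF homogeneous_ideal_add[OF I linear_form_in_forms]
          linear_form_in_forms full]) auto
  then show ?thesis
    using delta_hilbert_eq[OF I linear_form_in_forms nz[OF order_refl]]
      delta_hilbert_eq[OF I linear_form_in_forms nz[of j]] j by simp
qed

text \<open>Brings the pencil to the normal form of \<open>hilbert_persistence\<close>. Positivity
  guarantees two nonzero forms: if the first vanished, its injectivity would put all forms of degree
  \<open>t\<close> into \<open>I\<close>; if the second did, they would all lie in the sum of
  \<open>I\<close> and the first.\<close>

lemma delta_hilbert_persistence:
  fixes I :: "('n::finite, 'k::field_char_0) mpoly set"
  assumes I: "homogeneous_ideal I" and sat: "saturation I = I" and r: "is_r 2 I r" and t: "r < t"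
    and flat: "delta_hilbert I (Suc t) = delta_hilbert I t" and pos: "delta_hilbert I t > 0"
    and k: "t \<le> k"
  shows "int (hilbert (ideal_le t I) (Suc k)) = int (hilbert (ideal_le t I) k) + delta_hilbert I t"
proof -
  have iI: "is_ideal I" using I by (rule homogeneous_is_ideal)
  from ex_general_pencil[OF I sat r, of t] obtain \<alpha> \<beta> where
    full: "\<And>k. r < k \<Longrightarrow> forms k \<subseteq> ideal_add (ideal_add I (linear_form \<alpha>)) (linear_form \<beta>)"
    and nz: "\<And>j f. j \<le> t \<Longrightarrow> f \<in> forms j \<Longrightarrow> linear_form \<alpha> * f \<in> I \<Longrightarrow> f \<in> I" by blast
  let ?I1 = "ideal_add I (linear_form \<alpha>)"
  obtain j where j: "t = Suc j" using t by (cases t) auto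
  have h: "delta_hilbert I (Suc t) = int (hilbert ?I1 (Suc t))" "delta_hilbert I t = int (hilbert ?I1 t)"
    using delta_hilbert_eq[OF I linear_form_in_forms nz[OF order_refl]]
      delta_hilbert_eq[OF I linear_form_in_forms nz[of j]] j by simp_all
  have ne: "\<not> forms t \<subseteq> ?I1"
    using pos h(2) forms_subset_iff_hilbert[of ?I1 t] by simp
  have "\<exists>a. \<alpha> a \<noteq> 0"
  proof (rule ccontr)
    assume "\<not> ?thesis"
    then have "linear_form \<alpha> = 0" by (simp add: linear_form_def)
    then have "forms t \<subseteq> I" using nz[of t] ring_module.subspace_0[OF iI] by auto
    then show False using ne ideal_add_superset by blast
  qed
  then obtain a where a: "\<alpha> a \<noteq> 0" ..
  \<comment> \<open>Subtracting a multiple of the first form clears the coefficient at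
    \<open>a\<close> and leaves the ideal of the pencil unchanged.\<close>
  define c where "c = - (\<beta> a / \<alpha> a)"
  define \<gamma> where "\<gamma> j = \<beta> j + c * \<alpha> j" for j
  have \<gamma>: "linear_form \<gamma> = linear_form \<beta> + smult c (linear_form \<alpha>)"
    unfolding \<gamma>_def[abs_def] linear_form_add_smult ..
  have "\<gamma> a = 0" using a by (simp add: \<gamma>_def c_def)
  have full': "forms k \<subseteq> ideal_add ?I1 (linear_form \<gamma>)" if "t \<le> k" for k
  proof -
    have m: "linear_form \<alpha> \<in> ideal_add ?I1 (linear_form \<gamma>)" "linear_form \<gamma> \<in> ideal_add ?I1 (linear_form \<gamma>)"
      "?I1 \<subseteq> ideal_add ?I1 (linear_form \<gamma>)" using ideal_add_superset by blast+
    then have "linear_form \<gamma> - smult c (linear_form \<alpha>) \<in> ideal_add ?I1 (linear_form \<gamma>)"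
      by (intro ring_module.span_diff is_ideal_smult) auto
    then have "linear_form \<beta> \<in> ideal_add ?I1 (linear_form \<gamma>)" by (simp add: \<gamma>)
    then have "ideal_add ?I1 (linear_form \<beta>) \<subseteq> ideal_add ?I1 (linear_form \<gamma>)"
      by (rule ideal_add_subsetI[OF ring_module.subspace_span m(3)])
    then show ?thesis using full[of k] that t by auto
  qed
  have "\<exists>b. \<gamma> b \<noteq> 0"
  proof (rule ccontr)
    assume "\<not> ?thesis"
    then have "linear_form \<gamma> = 0" by (simp add: linear_form_def)
    then have "ideal_add ?I1 (linear_form \<gamma>) \<subseteq> ?I1"
      by (intro ideal_add_subsetI[OF ring_module.subspace_span order_refl]) (simp add: ring_module.span_zero)
    then show False using ne full'[of t] by blast
  qed
  then obtain b where b: "\<gamma> b \<noteq> 0" ..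
  have "hilbert (ideal_le t I) (Suc k) = hilbert (ideal_le t I) k + hilbert ?I1 t"
    using flat h by (intro hilbert_persistence[OF I a \<open>\<gamma> a = 0\<close> b nz[OF order_refl] full' _ k]) auto
  then show ?thesis using h(2) by simp
qed

section \<open>Homogeneous primes\<close>

lemma hcomp_mult:
  assumes D: "f = (\<Sum>i<D. hcomp i f)"
  shows "hcomp k (f * g) = (\<Sum>i<D. if i \<le> k then hcomp i f * hcomp (k - i) g else 0)"
proof -
  have "f * g = (\<Sum>i<D. hcomp i f * g)" by (subst D) (simp add: sum_distrib_right)
  then show ?thesis by (simp add: hcomp_sum hcomp_mult_form[OF hcomp_in_forms])
qed

lemma ex_top_component:
  assumes I: "is_ideal I" and f: "f \<notin> I"
  obtains i where "hcomp i f \<notin> I" "\<And>j. i < j \<Longrightarrow> hcomp j f \<in> I"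
proof -
  obtain D where D: "f = (\<Sum>i<D. hcomp i f)" using sum_hcomp by blast
  let ?S = "{i. hcomp i f \<notin> I}"
  have zero: "hcomp i f = 0" if "D \<le> i" for i
    using that by (subst D) (simp add: hcomp_sum hcomp_form[OF hcomp_in_forms])
  have "i < D" if "hcomp i f \<notin> I" for i
    using that zero[of i] ring_module.subspace_0[OF I] by (cases "D \<le> i") auto
  then have "?S \<subseteq> {..<D}" by blast
  then have fin: "finite ?S" by (rule finite_subset) simp
  have "?S \<noteq> {}" using in_ideal_if_hcomp[OF I, of f] f by blast
  then have "Max ?S \<in> ?S" using fin by (intro Max_in)
  moreover have "hcomp j f \<in> I" if "Max ?S < j" for j
    using that Max_ge[OF fin, of j] by force
  ultimately show ?thesis using that by blast
qed

text \<open>Take the top components outside \<open>I\<close>, in degrees \<open>i\<close> and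
  \<open>j\<close>. All other contributions to the component of \<open>a * b\<close> in degree
  \<open>i + j\<close> lie in \<open>I\<close>, so the product of these two does as well.\<close>

lemma prime_ideal_if_forms:
  assumes I: "homogeneous_ideal I" and ne: "I \<noteq> UNIV"
    and forms: "\<And>a b i j. a \<in> forms i \<Longrightarrow> b \<in> forms j \<Longrightarrow> a * b \<in> I \<Longrightarrow> a \<in> I \<or> b \<in> I"
  shows "prime_ideal I"
  unfolding prime_ideal_def
proof (intro conjI allI impI ne)
  show iI: "is_ideal I" using I by (rule homogeneous_is_ideal)
  fix a b assume ab: "a * b \<in> I"
  show "a \<in> I \<or> b \<in> I"
  proof (rule ccontr)
    assume "\<not> ?thesis"
    then have "a \<notin> I" "b \<notin> I" by auto
    obtain i where i: "hcomp i a \<notin> I" "\<And>k. i < k \<Longrightarrow> hcomp k a \<in> I"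
      using ex_top_component[OF iI \<open>a \<notin> I\<close>] by blast
    obtain j where j: "hcomp j b \<notin> I" "\<And>k. j < k \<Longrightarrow> hcomp k b \<in> I"
      using ex_top_component[OF iI \<open>b \<notin> I\<close>] by blast
    obtain D where D: "a = (\<Sum>i<D. hcomp i a)" using sum_hcomp by blast
    have "i < D"
    proof (rule ccontr)
      assume "\<not> i < D"
      then have "hcomp i a = 0" by (subst D) (simp add: hcomp_sum hcomp_form[OF hcomp_in_forms])
      then show False using i(1) ring_module.subspace_0[OF iI] by simp
    qed
    let ?c = "\<lambda>k. if k \<le> i + j then hcomp k a * hcomp (i + j - k) b else 0"
    have "(\<Sum>k<D. ?c k) \<in> I"
      using homogeneous_hcomp[OF I ab, of "i + j"] hcomp_mult[OF D] by simp
    moreover have "(\<Sum>k\<in>{..<D} - {i}. ?c k) \<in> I"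
    proof (rule ring_module.subspace_sum[OF iI])
      fix k assume "k \<in> {..<D} - {i}"
      then consider "k < i" | "i < k" by force
      then show "?c k \<in> I"
      proof cases
        case 1
        then show ?thesis using j(2)[of "i + j - k"] by (auto intro: is_ideal_mult_left[OF iI])
      next
        case 2
        then show ?thesis using i(2)[of k]
          by (auto intro: is_ideal_mult_right[OF iI] simp: ring_module.subspace_0[OF iI])
      qed
    qed
    ultimately have "(\<Sum>k<D. ?c k) - (\<Sum>k\<in>{..<D} - {i}. ?c k) \<in> I"
      by (rule ring_module.subspace_diff[OF iI])
    moreover have "(\<Sum>k<D. ?c k) = ?c i + (\<Sum>k\<in>{..<D} - {i}. ?c k)"
      using \<open>i < D\<close> by (intro sum.remove) auto
    ultimately have "hcomp i a * hcomp j b \<in> I" by simp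
    then show False using forms[OF hcomp_in_forms hcomp_in_forms] i(1) j(1) by blast
  qed
qed

text \<open>Zorn's lemma among homogeneous ideals missing \<open>S\<close>. Maximality is tested by
  adjoining a form, which keeps the ideal homogeneous; primeness on forms then suffices.\<close>

lemma ex_homogeneous_prime:
  fixes A :: "('n::finite, 'k::field) mpoly set"
  assumes A: "homogeneous_ideal A"
    and S: "1 \<in> S" "\<And>x y. x \<in> S \<Longrightarrow> y \<in> S \<Longrightarrow> x * y \<in> S" "S \<inter> A = {}"
  shows "\<exists>P. prime_ideal P \<and> homogeneous_ideal P \<and> A \<subseteq> P \<and> S \<inter> P = {}"
proof -
  let ?A = "{I. homogeneous_ideal I \<and> A \<subseteq> I \<and> S \<inter> I = {}}"
  have "\<exists>M\<in>?A. \<forall>X\<in>?A. M \<subseteq> X \<longrightarrow> X = M"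
  proof (rule subset_Zorn_nonempty)
    show "?A \<noteq> {}" using A S by blast
  next
    fix Ch assume Ch: "Ch \<noteq> {}" "subset.chain ?A Ch"
    have hom: "homogeneous_ideal I" if "I \<in> Ch" for I
      using that Ch(2) unfolding subset_chain_def by blast
    then have id: "is_ideal I" if "I \<in> Ch" for I using that by (intro homogeneous_is_ideal)
    have "is_ideal (\<Union>Ch)"
    proof (rule ring_module.subspaceI)
      show "0 \<in> \<Union>Ch" using Ch(1) id[THEN ring_module.subspace_0] by blast
      show "x + y \<in> \<Union>Ch" if xy: "x \<in> \<Union>Ch" "y \<in> \<Union>Ch" for x y
      proof -
        obtain I I' where I: "x \<in> I" "y \<in> I'" "I \<in> Ch" "I' \<in> Ch" using xy by blast
        then have "I \<subseteq> I' \<or> I' \<subseteq> I" using Ch(2) unfolding subset_chain_def by blast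
        then show ?thesis
        proof
          assume "I \<subseteq> I'"
          then have "x + y \<in> I'" using I by (intro ring_module.subspace_add[OF id]) auto
          then show ?thesis using I(4) by blast
        next
          assume "I' \<subseteq> I"
          then have "x + y \<in> I" using I by (intro ring_module.subspace_add[OF id]) auto
          then show ?thesis using I(3) by blast
        qed
      qed
      show "c * x \<in> \<Union>Ch" if "x \<in> \<Union>Ch" for c x
        using that is_ideal_mult_left[OF id, of _ x c] by blast
    qed
    moreover have "hcomp k f \<in> \<Union>Ch" if "f \<in> \<Union>Ch" for f k
      using that homogeneous_hcomp[OF hom, of _ f k] by blast
    ultimately have "homogeneous_ideal (\<Union>Ch)" by (rule homogeneous_idealI)
    then show "\<Union>Ch \<in> ?A" using Ch unfolding subset_chain_def by blast
  qed
  then obtain M where MA: "M \<in> ?A" and maxA: "\<forall>X\<in>?A. M \<subseteq> X \<longrightarrow> X = M"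
    by (elim bexE)
  from MA have M: "homogeneous_ideal M" "A \<subseteq> M" "S \<inter> M = {}" by simp_all
  have max: "X = M" if "homogeneous_ideal X" "A \<subseteq> X" "S \<inter> X = {}" "M \<subseteq> X" for X
    using maxA that by simp
  have iM: "is_ideal M" using M(1) by (rule homogeneous_is_ideal)
  have "prime_ideal M"
  proof (rule prime_ideal_if_forms[OF M(1)])
    show "M \<noteq> UNIV" using M(3) S(1) by auto
    fix a b i j assume ab: "a \<in> forms i" "b \<in> forms j" "a * b \<in> M"
    have ex: "\<exists>x\<in>S. \<exists>r. x - r * c \<in> M" if c: "c \<in> forms l" "c \<notin> M" for c l
    proof -
      have "ideal_add M c \<noteq> M" using c ideal_add_superset(2)[of c M] by auto
      moreover have "A \<subseteq> ideal_add M c" using M(2) ideal_add_superset(1)[of M c] by (rule order_trans)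
      ultimately have "S \<inter> ideal_add M c \<noteq> {}"
        using max[OF homogeneous_ideal_add[OF M(1) c(1)] _ _ ideal_add_superset(1)] by auto
      then obtain x where x: "x \<in> S" "x \<in> ideal_add M c" by blast
      from x(2)[unfolded mem_ideal_add[OF iM]] show ?thesis using x(1) by blast
    qed
    show "a \<in> M \<or> b \<in> M"
    proof (rule ccontr)
      assume "\<not> ?thesis"
      then obtain x r y u where x: "x \<in> S" "x - r * a \<in> M" and y: "y \<in> S" "y - u * b \<in> M"
        using ex[OF ab(1)] ex[OF ab(2)] by blast
      have "(x - r * a) * y + ((r * a) * (y - u * b) + (r * u) * (a * b)) \<in> M"
        by (rule ring_module.subspace_add[OF iM is_ideal_mult_right[OF iM x(2)]
              ring_module.subspace_add[OF iM is_ideal_mult_left[OF iM y(2)] is_ideal_mult_left[OF iM ab(3)]]])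
      moreover have "(x - r * a) * y + ((r * a) * (y - u * b) + (r * u) * (a * b)) = x * y"
        by (simp add: algebra_simps)
      ultimately have "x * y \<in> M" by (simp only:)
      then show False using S(2)[OF x(1) y(1)] M(3) by blast
    qed
  qed
  then show ?thesis using M by (intro exI[of _ M] conjI)
qed

lemma ex_homogeneous_prime_power:
  fixes A :: "('n::finite, 'k::field) mpoly set"
  assumes "homogeneous_ideal A" "\<And>N. x ^ N \<notin> A"
  shows "\<exists>P. prime_ideal P \<and> homogeneous_ideal P \<and> A \<subseteq> P \<and> x \<notin> P"
proof -
  have "\<exists>P. prime_ideal P \<and> homogeneous_ideal P \<and> A \<subseteq> P \<and> range (\<lambda>N. x ^ N) \<inter> P = {}"
    using assms
    by (intro ex_homogeneous_prime) (auto simp flip: power_add intro: range_eqI[of _ _ 0])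
  moreover have "x \<in> range (\<lambda>N. x ^ N)" by (rule range_eqI[of _ _ 1]) simp
  ultimately show ?thesis by blast
qed

lemma prime_ideal_is_ideal: "prime_ideal P \<Longrightarrow> is_ideal P"
  by (simp add: prime_ideal_def)

lemma prime_idealD: "prime_ideal P \<Longrightarrow> a * b \<in> P \<Longrightarrow> a \<in> P \<or> b \<in> P"
  by (simp add: prime_ideal_def)

lemma prime_ideal_one: "prime_ideal P \<Longrightarrow> 1 \<notin> P"
  using is_ideal_mult_left[of P 1] unfolding prime_ideal_def by auto

lemma prime_ideal_power: "prime_ideal P \<Longrightarrow> a ^ n \<in> P \<Longrightarrow> a \<in> P"
  by (induction n) (auto dest: prime_ideal_one prime_idealD)

lemma proj_points_iff:
  "P \<in> proj_points I \<longleftrightarrow> prime_ideal P \<and> homogeneous_ideal P \<and> I \<subseteq> P \<and> (\<exists>i. var i \<notin> P)"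
proof -
  have "irrelevant \<subseteq> P \<longleftrightarrow> (\<forall>i. var i \<in> P)" if P: "is_ideal P"
  proof
    have "var i \<in> irrelevant" for i :: 'a by (simp add: irrelevant_def ring_module.span_base)
    then show "\<forall>i. var i \<in> P" if "irrelevant \<subseteq> P" using that by auto
    show "irrelevant \<subseteq> P" if "\<forall>i. var i \<in> P"
      unfolding irrelevant_def using that by (intro ring_module.span_minimal P) auto
  qed
  then show ?thesis unfolding proj_points_def using prime_ideal_is_ideal[of P] by auto
qed

section \<open>Dimension and growth of the Hilbert function\<close>

text \<open>Modulo a prime, \<open>f\<close> is a nonzerodivisor, so raising the degree by
  \<open>e\<close> adds the value of R/(P + (f)), at least \<open>m\<close>, each time.\<close>

lemma hilbert_prime_growth:
  fixes P :: "('n::finite, 'k::field) mpoly set"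
  assumes P: "prime_ideal P" "homogeneous_ideal P" and f: "f \<in> forms e" "f \<notin> P"
    and P': "ideal_add P f \<subseteq> P'" and m: "\<And>k. k1 \<le> k \<Longrightarrow> m \<le> hilbert P' k"
    and k: "k1 \<le> k"
  shows "j * m \<le> hilbert P (k + j * e)"
proof (induction j)
  case (Suc j)
  have "{g. f * g \<in> P} = P"
    using prime_idealD[OF P(1), of f] f(2) is_ideal_mult_left[OF prime_ideal_is_ideal[OF P(1)], of _ f] by blast
  then have "hilbert P (k + j * e + e) = hilbert (ideal_add P f) (k + j * e + e) + hilbert P (k + j * e)"
    using hilbert_add_form[OF P(2) f(1), of "k + j * e"] by simp
  moreover have "hilbert P' (k + j * e + e) \<le> hilbert (ideal_add P f) (k + j * e + e)"
    using P' by (intro hilbert_antimono) auto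
  ultimately show ?case using Suc m[of "k + j * e + e"] k by (simp add: algebra_simps)
qed simp

lemma ex_form_in_diff:
  assumes "homogeneous_ideal P" "homogeneous_ideal P'" "\<not> P' \<subseteq> P"
  obtains e f where "f \<in> forms e" "f \<in> P'" "f \<notin> P"
proof -
  obtain g where g: "g \<in> P'" "g \<notin> P" using assms(3) by blast
  then obtain k where k: "hcomp k g \<notin> P"
    using in_ideal_if_hcomp[OF homogeneous_is_ideal[OF assms(1)], of g] by blast
  show ?thesis by (rule that[OF hcomp_in_forms homogeneous_hcomp[OF assms(2) g(1)] k])
qed

text \<open>Each specialization costs one order of growth: the largest prime has values at least 1,
  the middle one exceeds any constant, and the smallest one outgrows every line of slope
  \<open>A\<close>.\<close>

lemma no_point_chain_2:
  fixes Q :: "('n::finite, 'k::field) mpoly set"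
  assumes lin: "\<And>k. hilbert Q k \<le> A * k + B"
  shows "\<not> has_point_chain Q 2"
proof
  assume "has_point_chain Q 2"
  then obtain P where P: "\<And>i. i \<le> 2 \<Longrightarrow> P i \<in> proj_points Q" "\<And>i. i < 2 \<Longrightarrow> P i \<subset> P (Suc i)"
    unfolding has_point_chain_def by blast
  have pr: "prime_ideal (P i)" "homogeneous_ideal (P i)" "Q \<subseteq> P i" if "i \<le> 2" for i
    using P(1)[OF that] unfolding proj_points_iff by auto
  have sub: "\<not> P (Suc 0) \<subseteq> P 0" "\<not> P 2 \<subseteq> P (Suc 0)" "P 0 \<subseteq> P (Suc 0)" "P (Suc 0) \<subseteq> P 2"
    using P(2)[of 0] P(2)[of 1] by (auto simp: numeral_2_eq_2)
  obtain e f where f: "f \<in> forms e" "f \<in> P (Suc 0)" "f \<notin> P 0"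
    by (rule ex_form_in_diff[OF pr(2) pr(2) sub(1)]) auto
  obtain e' f' where f': "f' \<in> forms e'" "f' \<in> P 2" "f' \<notin> P (Suc 0)"
    by (rule ex_form_in_diff[OF pr(2) pr(2) sub(2)]) auto
  obtain v where v: "var v \<notin> P 2" using P(1)[of 2] unfolding proj_points_iff by auto
  have one: "1 \<le> hilbert (P 2) k" for k
  proof -
    have "var v ^ k \<in> forms k" using forms_power[OF var_in_forms, of v k] by simp
    moreover have "var v ^ k \<notin> P 2" using prime_ideal_power[OF pr(1)[of 2], of "var v" k] v by auto
    ultimately have "\<not> forms k \<subseteq> P 2" by blast
    then show ?thesis
      using forms_subset_iff_hilbert[OF prime_ideal_is_ideal[OF pr(1)], of 2 k] by simp
  qed
  have add1: "ideal_add (P (Suc 0)) f' \<subseteq> P 2"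
    using sub f' by (intro ideal_add_subsetI prime_ideal_is_ideal pr) auto
  have add0: "ideal_add (P 0) f \<subseteq> P (Suc 0)"
    using sub f by (intro ideal_add_subsetI prime_ideal_is_ideal pr) auto
  \<comment> \<open>Over \<open>e\<close> degrees a line of slope \<open>A\<close> gains
    \<open>A * e\<close>; \<open>?m\<close> is one more.\<close>
  let ?m = "A * e + 1"
  have 1: "?m \<le> hilbert (P (Suc 0)) k" if "?m * e' \<le> k" for k
    using hilbert_prime_growth[OF pr(1) pr(2) f'(1,3) add1, of 0 1 "k - ?m * e'" ?m] one that by simp
  \<comment> \<open>Enough steps for a surplus of 1 per step to exceed the initial value of the
    affine bound.\<close>
  let ?j = "A * (?m * e') + B + 1"
  have "?j * ?m \<le> hilbert (P 0) (?m * e' + ?j * e)"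
    by (rule hilbert_prime_growth[OF pr(1) pr(2) f(1,3) add0 1]) auto
  also have "\<dots> \<le> hilbert Q (?m * e' + ?j * e)"
    using pr(3)[of 0] by (intro hilbert_antimono) auto
  also have "\<dots> \<le> A * (?m * e' + ?j * e) + B" by (rule lin)
  finally show False by (simp add: algebra_simps)
qed

text \<open>A monomial whose degree reaches the sum of the exponents \<open>N v\<close> contains one
  of the powers \<open>var v ^ N v\<close>.\<close>

lemma forms_subset_if_var_powers:
  fixes A :: "('n::finite, 'k::field) mpoly set"
  assumes A: "is_ideal A" and v: "\<And>v. \<exists>N. var v ^ N \<in> A"
  shows "\<exists>k0. \<forall>k\<ge>k0. forms k \<subseteq> A"
proof -
  obtain N where N: "\<And>v. var v ^ N v \<in> A" using v by metis
  have "forms k \<subseteq> A" if k: "sum N UNIV \<le> k" for k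
  proof
    fix f :: "('n, 'k) mpoly" assume f: "f \<in> forms k"
    have "Poly_Mapping.single m c \<in> A" if m: "mdeg m = k" for m c
    proof -
      have "\<exists>v. N v \<le> Poly_Mapping.lookup m v"
      proof (rule ccontr)
        assume "\<not> ?thesis"
        then have "mdeg m < sum N UNIV"
          unfolding mdeg_def by (intro sum_strict_mono) (auto simp: not_le)
        then show False using m k by simp
      qed
      then obtain v where v: "N v \<le> Poly_Mapping.lookup m v" ..
      have "m = (m - Poly_Mapping.single v (N v)) + Poly_Mapping.single v (N v)"
        using v by (intro poly_mapping_eqI) (auto simp: lookup_add lookup_minus lookup_single when_def)
      then have "Poly_Mapping.single m c = Poly_Mapping.single (m - Poly_Mapping.single v (N v)) c * var v ^ N v"
        by (simp add: var_power mult_single)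
      then show ?thesis using is_ideal_mult_left[OF A N] by simp
    qed
    then have "(\<Sum>m\<in>Poly_Mapping.keys f. Poly_Mapping.single m (Poly_Mapping.lookup f m)) \<in> A"
      using f by (intro ring_module.subspace_sum[OF A]) (auto simp: forms_def)
    then show "f \<in> A" by (simp flip: sum_monomials)
  qed
  then show ?thesis by blast
qed

text \<open>If the Hilbert function were unbounded, cutting with a variable outside the radical would
  leave a projective point, and this point would specialize a larger one.\<close>

lemma hilbert_bounded_if_not_curve:
  fixes Q :: "('n::finite, 'k::field) mpoly set"
  assumes Q: "primary_ideal Q" "homogeneous_ideal Q"
    and lin: "\<And>k. hilbert Q k \<le> A * k + B" and dim: "\<not> has_proj_dim Q 1"
  shows "\<exists>b. \<forall>k. hilbert Q k \<le> b"
proof -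
  have iQ: "is_ideal Q" using Q(2) by (rule homogeneous_is_ideal)
  have "\<not> has_point_chain Q (Suc 1)" using no_point_chain_2[OF lin] by (simp add: numeral_2_eq_2)
  \<comment> \<open>The linear bound excludes chains of three points; as \<open>Q\<close> is not of
    dimension one, chains of two are excluded as well.\<close>
  then have chain: "\<not> has_point_chain Q 1" using dim unfolding has_proj_dim_def by blast
  have "\<exists>k0. \<forall>k\<ge>k0. hilbert Q (Suc k) \<le> hilbert Q k"
  proof (cases "\<forall>v. \<exists>N. var v ^ N \<in> Q")
    case True
    then obtain k0 where "\<forall>k\<ge>k0. forms k \<subseteq> Q" using forms_subset_if_var_powers[OF iQ] by blast
    then have "\<forall>k\<ge>k0. hilbert Q (Suc k) = 0" using forms_subset_iff_hilbert[OF iQ] by simp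
    then show ?thesis by (intro exI[of _ k0]) simp
  next
    case False
    then obtain v where v: "\<And>N. var v ^ N \<notin> Q" by blast
    let ?K = "ideal_add Q (var v)"
    have K: "homogeneous_ideal ?K" by (rule homogeneous_ideal_add[OF Q(2) var_in_forms])
    have nzd: "f \<in> Q" if "f * var v ^ N \<in> Q" for f N
    proof -
      have "\<exists>k. (var v ^ N) ^ k \<in> Q" if "f \<notin> Q"
        using \<open>f * var v ^ N \<in> Q\<close> that Q(1) unfolding primary_ideal_def by blast
      then show ?thesis using v by (metis power_mult)
    qed
    have "\<exists>N. var w ^ N \<in> ?K" for w
    proof (rule ccontr)
      assume "\<nexists>N. var w ^ N \<in> ?K"
      then have "\<exists>P. prime_ideal P \<and> homogeneous_ideal P \<and> ?K \<subseteq> P \<and> var w \<notin> P"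
        by (intro ex_homogeneous_prime_power[OF K]) blast
      then obtain P1 where P1: "prime_ideal P1" "homogeneous_ideal P1" "?K \<subseteq> P1" "var w \<notin> P1" by blast
      have QP1: "Q \<subseteq> P1" "var v \<in> P1" using P1(3) ideal_add_superset(1)[of Q "var v"] ideal_add_superset(2)[of "var v" Q] by blast+
      \<comment> \<open>A prime missing this multiplicative set lies inside \<open>P1\<close> and
        omits \<open>var v\<close>, hence is strictly smaller. The set misses \<open>Q\<close>
        because \<open>Q\<close> is primary and \<open>var v\<close> is outside its radical.\<close>
      define S where "S = {g * var v ^ N | g N. g \<notin> P1}"
      have "\<exists>P. prime_ideal P \<and> homogeneous_ideal P \<and> Q \<subseteq> P \<and> S \<inter> P = {}"
      proof (rule ex_homogeneous_prime[OF Q(2)])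
        show "1 \<in> S" unfolding S_def using prime_ideal_one[OF P1(1)]
          by (intro CollectI exI[of _ 1] exI[of _ 0]) simp
        show "x * y \<in> S" if xy: "x \<in> S" "y \<in> S" for x y
        proof -
          obtain g N g' N' where g: "x = g * var v ^ N" "g \<notin> P1" "y = g' * var v ^ N'" "g' \<notin> P1"
            using xy unfolding S_def by blast
          then have "x * y = (g * g') * var v ^ (N + N')" by (simp add: power_add mult_ac)
          moreover have "g * g' \<notin> P1" using prime_idealD[OF P1(1), of g g'] g by blast
          ultimately show ?thesis unfolding S_def by blast
        qed
        show "S \<inter> Q = {}" using nzd QP1(1) unfolding S_def by blast
      qed
      then obtain P0 where P0: "prime_ideal P0" "homogeneous_ideal P0" "Q \<subseteq> P0" "S \<inter> P0 = {}" by blast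
      have S1: "g \<in> S" if "g \<notin> P1" for g
        unfolding S_def using that by (intro CollectI exI[of _ g] exI[of _ 0]) simp
      have "var v \<in> S"
        unfolding S_def using prime_ideal_one[OF P1(1)] by (intro CollectI exI[of _ 1] exI[of _ 1]) simp
      then have "P0 \<subset> P1" using S1 P0(4) QP1(2) by blast
      moreover have "var w \<notin> P0" using S1[OF P1(4)] P0(4) by blast
      ultimately have "has_point_chain Q 1"
        unfolding has_point_chain_def using P0 P1 QP1
        by (intro exI[of _ "\<lambda>i. if i = 0 then P0 else P1"]) (auto simp: proj_points_iff)
      then show False using chain by blast
    qed
    then obtain k0 where k0: "\<forall>k\<ge>k0. forms k \<subseteq> ?K"
      using forms_subset_if_var_powers[OF homogeneous_is_ideal[OF K]] by blast
    have "hilbert Q (Suc k) \<le> hilbert Q k" if "k0 \<le> k" for k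
      using k0 that by (intro hilbert_antimono_surjective[OF Q(2) var_in_forms[of v]]) auto
    then show ?thesis by blast
  qed
  then obtain k0 where k0: "\<And>k. k0 \<le> k \<Longrightarrow> hilbert Q (Suc k) \<le> hilbert Q k" by blast
  \<comment> \<open>From \<open>k0\<close> on the values do not rise, and before that the affine
    bound is at most its value at \<open>k0\<close>.\<close>
  have "hilbert Q k \<le> A * k0 + B" for k
  proof (cases "k \<le> k0")
    case True
    then show ?thesis using lin[of k] by (meson add_le_mono1 le_trans mult_le_mono2)
  next
    case False
    then have "k0 \<le> k" by simp
    then show ?thesis
    proof (induction k rule: nat_induct_at_least)
      case (Suc k)
      then show ?case using k0[of k] by simp
    qed (rule lin)
  qed
  then show ?thesis by blast
qed

text \<open>Bounds add under intersection; the empty intersection is the whole ring, with Hilbert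
  function 0.\<close>

lemma hilbert_bounded_Inter:
  assumes "finite \<N>" "\<And>Q. Q \<in> \<N> \<Longrightarrow> is_ideal Q" "\<And>Q. Q \<in> \<N> \<Longrightarrow> \<exists>b. \<forall>k. hilbert Q k \<le> b"
  shows "\<exists>b. \<forall>k. hilbert (\<Inter>\<N>) k \<le> b"
  using assms
proof (induction \<N> rule: finite_induct)
  case empty
  show ?case by (simp add: hilbert_def)
next
  case (insert Q \<N>)
  obtain b b' where b: "\<And>k. hilbert Q k \<le> b" "\<And>k. hilbert (\<Inter>\<N>) k \<le> b'"
    using insert by (metis insertCI)
  have "hilbert (Q \<inter> \<Inter>\<N>) k \<le> b + b'" for k
  proof -
    have "hilbert (Q \<inter> \<Inter>\<N>) k \<le> hilbert Q k + hilbert (\<Inter>\<N>) k"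
      using insert.prems(1) by (intro hilbert_Int_le ring_module.subspace_Inter) auto
    then show ?thesis using b[of k] by (meson add_mono order_trans)
  qed
  then show ?case by auto
qed

text \<open>Irreducibility places all points of \<open>C\<close> in the zero set of \<open>f\<close>
  or in that of \<open>g\<close>, and reducedness has to turn this into membership. Points of Proj
  do not see primes containing the irrelevant ideal; the dimension of the components bridges this
  gap by providing a variable outside the radical of the component in question.\<close>

lemma curve_part_form_prime:
  fixes C :: "('n::finite, 'k::field) mpoly set"
  assumes C: "C = \<Inter>\<Q>" and \<Q>: "\<And>Q. Q \<in> \<Q> \<Longrightarrow> primary_ideal Q \<and> homogeneous_ideal Q \<and> has_proj_dim Q 1"
    and red: "reduced_subscheme C" and irr: "irreducible_subscheme C"
    and f: "f \<in> forms i" and g: "g \<in> forms j" and fg: "f * g \<in> C"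
  shows "f \<in> C \<or> g \<in> C"
proof -
  have homC: "homogeneous_ideal C" unfolding C using \<Q> by (intro homogeneous_Inter) blast
  have key: "h \<in> C" if h: "h \<in> forms l" and pts: "proj_points C \<subseteq> proj_points (ideal_gen {h})" for h l
  proof (rule ccontr)
    assume "h \<notin> C"
    then obtain Q where Q: "Q \<in> \<Q>" "h \<notin> Q" unfolding C by blast
    have "has_point_chain Q 1" using \<Q>[OF Q(1)] unfolding has_proj_dim_def by blast
    then obtain P where "P \<in> proj_points Q" unfolding has_point_chain_def by blast
    then obtain v where P: "prime_ideal P" "Q \<subseteq> P" "var v \<notin> P" unfolding proj_points_iff by blast
    have "var v ^ N \<notin> Q" for N using prime_ideal_power[OF P(1), of "var v" N] P by blast
    \<comment> \<open>The factor \<open>var v\<close> makes the prime found below a genuine point: a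
      prime avoiding \<open>h * var v\<close> cannot contain the irrelevant ideal.\<close>
    then have "h * var v \<notin> Q" using \<Q>[OF Q(1)] Q(2) unfolding primary_ideal_def by blast
    then have "h * var v \<notin> C" using Q(1) C by blast
    then have "(h * var v) ^ N \<notin> C" for N
      using red unfolding reduced_subscheme_def radical_def by blast
    then have "\<exists>P. prime_ideal P \<and> homogeneous_ideal P \<and> C \<subseteq> P \<and> h * var v \<notin> P"
      by (intro ex_homogeneous_prime_power[OF homC])
    then obtain P' where P': "prime_ideal P'" "homogeneous_ideal P'" "C \<subseteq> P'" "h * var v \<notin> P'" by blast
    have "var v \<notin> P'" "h \<notin> P'"
      using P'(4) is_ideal_mult_left[OF prime_ideal_is_ideal[OF P'(1)], of "var v" h]
        is_ideal_mult_right[OF prime_ideal_is_ideal[OF P'(1)], of h "var v"] by blast+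
    then have "P' \<in> proj_points C" using P' unfolding proj_points_iff by blast
    then have "P' \<in> proj_points (ideal_gen {h})" using pts by blast
    then have "ideal_gen {h} \<subseteq> P'" unfolding proj_points_iff by blast
    then show False using \<open>h \<notin> P'\<close> ring_module.span_base[of h "{h}"] by auto
  qed
  have hom: "homogeneous_ideal (ideal_gen {f})" "homogeneous_ideal (ideal_gen {g})"
    using f g by (auto intro!: homogeneous_ideal_gen)
  have "proj_points C \<subseteq> proj_points (ideal_gen {f}) \<union> proj_points (ideal_gen {g})"
  proof
    fix P assume P: "P \<in> proj_points C"
    then have "prime_ideal P" "f * g \<in> P" using fg unfolding proj_points_iff by blast+
    then consider "f \<in> P" | "g \<in> P" using prime_idealD[of P f g] by blast
    moreover have "ideal_gen {h} \<subseteq> P" if "h \<in> P" for h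
      using that prime_ideal_is_ideal[OF \<open>prime_ideal P\<close>] by (intro ring_module.span_minimal) auto
    ultimately show "P \<in> proj_points (ideal_gen {f}) \<union> proj_points (ideal_gen {g})"
      using P unfolding proj_points_iff Un_iff by cases blast+
  qed
  then have "proj_points C \<subseteq> proj_points (ideal_gen {f}) \<or> proj_points C \<subseteq> proj_points (ideal_gen {g})"
    using irr hom unfolding irreducible_subscheme_def by blast
  then show ?thesis using key[OF f] key[OF g] by blast
qed

section \<open>Strict decrease\<close>

lemma linear_growth:
  fixes H :: "nat \<Rightarrow> nat" and s :: int
  assumes "\<And>k. k0 \<le> k \<Longrightarrow> int (H (Suc k)) = int (H k) + s"
  shows "int (H (k0 + i)) = int (H k0) + s * int i"
  using assms by (induction i) (auto simp: algebra_simps)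

text \<open>The Hilbert functions of the two truncations are exactly affine from \<open>d\<close>
  and from \<open>t\<close> on, so each contradiction can be read off at an explicit degree where
  the slopes outweigh the constants.\<close>

lemma delta_hilbert_no_later_flat:
  fixes I :: "('n::finite, 'k::field_char_0) mpoly set"
  assumes I: "homogeneous_ideal I" "saturation I = I" and r: "is_r 2 I r" "r < d"
    and flat: "delta_hilbert I (Suc d) = delta_hilbert I d"
    and C: "unmixed_curve_part (ideal_le d I) C" "reduced_subscheme C" "irreducible_subscheme C"
    and t: "d \<le> t" and flat': "delta_hilbert I (Suc t) = delta_hilbert I t"
    and pos: "0 < delta_hilbert I t" and less: "delta_hilbert I t < delta_hilbert I d"
  shows False
proof -
  define s where "s = delta_hilbert I d"
  define m where "m = delta_hilbert I t"
  have sm: "0 < m" "m < s" using pos less by (simp_all add: s_def m_def)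
  let ?J = "ideal_le d I" and ?J' = "ideal_le t I"
  have J: "homogeneous_ideal ?J" and J': "homogeneous_ideal ?J'" by (rule homogeneous_ideal_le)+
  have JJ': "?J \<subseteq> ?J'" using t by (rule ideal_le_mono)
  have HJ: "int (hilbert ?J (d + i)) = int (hilbert ?J d) + s * int i" for i
    unfolding s_def
    by (rule linear_growth, rule delta_hilbert_persistence[OF I r flat]) (use pos less in auto)
  have HJ': "int (hilbert ?J' (t + i)) = int (hilbert ?J' t) + m * int i" for i
    unfolding m_def
    by (rule linear_growth, rule delta_hilbert_persistence[OF I r(1) _ flat' pos]) (use r t in auto)
  obtain \<Q> where PD: "primary_decomposition \<Q> ?J" and C_eq: "C = \<Inter>{Q \<in> \<Q>. has_proj_dim Q 1}"
    using C(1) unfolding unmixed_curve_part_def by (elim exE conjE)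
  have \<Q>: "finite \<Q>" "\<And>Q. Q \<in> \<Q> \<Longrightarrow> primary_ideal Q \<and> homogeneous_ideal Q" "\<Inter>\<Q> = ?J"
    using PD unfolding primary_decomposition_def by simp_all
  let ?\<N> = "{Q \<in> \<Q>. \<not> has_proj_dim Q 1}"
  have JC: "?J = C \<inter> \<Inter>?\<N>" unfolding \<Q>(3)[symmetric] C_eq by blast
  have homC: "homogeneous_ideal C" unfolding C_eq using \<Q>(2) by (intro homogeneous_Inter) blast
  \<comment> \<open>An affine bound valid in all degrees; the sum absorbs the finitely many values
    up to \<open>d\<close>. The components of \<open>?J\<close> inherit it, as the dimension
    argument requires.\<close>
  have lin: "hilbert ?J k \<le> nat s * k + sum (hilbert ?J) {..d}" for k
  proof (cases "k \<le> d")
    case True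
    then have "hilbert ?J k \<le> sum (hilbert ?J) {..d}" by (intro member_le_sum) auto
    then show ?thesis by simp
  next
    case False
    then have "int (hilbert ?J k) = int (hilbert ?J d) + s * int (k - d)" using HJ[of "k - d"] by simp
    also have "\<dots> = int (hilbert ?J d + nat s * (k - d))" using sm by simp
    finally have "hilbert ?J k = hilbert ?J d + nat s * (k - d)" by (simp only: of_nat_eq_iff)
    moreover have "hilbert ?J d \<le> sum (hilbert ?J) {..d}" by (intro member_le_sum) auto
    moreover have "nat s * (k - d) \<le> nat s * k" by simp
    ultimately show ?thesis by linarith
  qed
  have "\<exists>b. \<forall>k. hilbert (\<Inter>?\<N>) k \<le> b"
  proof (rule hilbert_bounded_Inter)
    fix Q assume Q: "Q \<in> ?\<N>"
    then show "is_ideal Q" using \<Q>(2) homogeneous_is_ideal by blast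
    have "hilbert Q k \<le> nat s * k + sum (hilbert ?J) {..d}" for k
    proof -
      have "?J \<subseteq> Q" using Q \<Q>(3) by blast
      then have "hilbert Q k \<le> hilbert ?J k" by (intro hilbert_antimono) auto
      then show ?thesis using lin[of k] by linarith
    qed
    then show "\<exists>b. \<forall>k. hilbert Q k \<le> b"
      using Q \<Q>(2) by (intro hilbert_bounded_if_not_curve) auto
  qed (use \<Q>(1) in simp)
  then obtain b where b: "\<And>k. hilbert (\<Inter>?\<N>) k \<le> b" by blast
  \<comment> \<open>Discarding the components that are not curves costs at most the constant
    \<open>b\<close>, so the slope \<open>s\<close> survives in R/C.\<close>
  have HC: "hilbert ?J k \<le> hilbert C k + b" for k
  proof -
    have "is_ideal (\<Inter>?\<N>)" using \<Q>(2) by (intro homogeneous_is_ideal homogeneous_Inter) blast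
    then have "hilbert ?J k \<le> hilbert C k + hilbert (\<Inter>?\<N>) k"
      unfolding JC using homogeneous_is_ideal[OF homC] by (intro hilbert_Int_le)
    then show ?thesis using b[of k] by linarith
  qed
  show False
  proof (cases "?J' \<subseteq> C")
    case True
    \<comment> \<open>As \<open>s\<close> is at least \<open>m + 1\<close>, the gap between the two
      lines grows by at least 1 per degree; \<open>?i\<close> exceeds the offset
      \<open>hilbert ?J' t + b\<close>.\<close>
    let ?i = "hilbert ?J' t + b + 1"
    have "hilbert ?J (t + ?i) \<le> hilbert ?J' (t + ?i) + b"
    proof -
      have "hilbert C (t + ?i) \<le> hilbert ?J' (t + ?i)" using True by (intro hilbert_antimono) auto
      then show ?thesis using HC[of "t + ?i"] by linarith
    qed
    moreover have "int (hilbert ?J (t + ?i)) = int (hilbert ?J d) + s * int (t - d + ?i)"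
      using HJ[of "t - d + ?i"] t by simp
    moreover have "s * int ?i \<le> s * int (t - d + ?i)" using sm by (intro mult_left_mono) auto
    moreover have "(m + 1) * int ?i \<le> s * int ?i" using sm by (intro mult_right_mono) auto
    ultimately show False using HJ'[of ?i] by (simp add: distrib_right)
  next
    case False
    obtain e f where f: "f \<in> forms e" "f \<in> ?J'" "f \<notin> C"
      using False by (rule ex_form_in_diff[OF homC J'])
    have prime: "g \<in> C" if g: "g \<in> forms k" "f * g \<in> C" for g k
      using curve_part_form_prime[OF C_eq _ C(2,3) f(1) g(1) g(2)] \<Q>(2) f(3) by blast
    \<comment> \<open>On forms, the colon ideal of \<open>f\<close> in \<open>?J\<close> lies in
      \<open>C\<close>. The exact sequence thus bounds R/(J + (f)) by the rise of R/J over
      \<open>e\<close> degrees, which is \<open>s * e\<close>, plus the correction \<open>b\<close>,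
      uniformly in \<open>i\<close>.\<close>
    have bound: "int (hilbert ?J' (t + i + e)) \<le> s * int e + int b" for i
    proof -
      let ?k = "t + i"
      have "{g. f * g \<in> ?J} \<inter> forms ?k \<subseteq> C \<inter> forms ?k" using prime JC by blast
      then have "hilbert C ?k \<le> hilbert {g. f * g \<in> ?J} ?k" by (rule hilbert_antimono)
      moreover have "ideal_add ?J f \<subseteq> ?J'"
        by (rule ideal_add_subsetI[OF homogeneous_is_ideal[OF J'] JJ' f(2)])
      then have "hilbert ?J' (?k + e) \<le> hilbert (ideal_add ?J f) (?k + e)"
        by (intro hilbert_antimono) auto
      moreover note hilbert_add_form[OF J f(1), of ?k] HC[of ?k]
      ultimately have "hilbert ?J' (?k + e) + hilbert ?J ?k \<le> hilbert ?J (?k + e) + b" by linarith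
      moreover have "int (hilbert ?J ?k) = int (hilbert ?J d) + s * int (t - d + i)"
        using HJ[of "t - d + i"] t by simp
      moreover have "int (hilbert ?J (?k + e)) = int (hilbert ?J d) + s * int (t - d + i + e)"
        using HJ[of "t - d + i + e"] t by simp
      moreover have "s * int (t - d + i + e) = s * int (t - d + i) + s * int e"
        by (simp add: distrib_left)
      ultimately show ?thesis by linarith
    qed
    \<comment> \<open>One more than the uniform bound; a slope \<open>m\<close> of at least 1
      reaches it within this many degrees.\<close>
    let ?i = "nat (s * int e + int b) + 1"
    have "int ?i \<le> m * int (?i + e)"
    proof -
      have "1 * int (?i + e) \<le> m * int (?i + e)" using sm by (intro mult_right_mono) auto
      then show ?thesis by simp
    qed
    then show False using bound[of ?i] HJ'[of "?i + e"] sm by (simp add: add.assoc)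
  qed
qed

theorem proposition5p3:
  fixes I_Z I_C :: "('n::finite, 'k::field_char_0) mpoly set"
    and s :: int and d r :: nat
  assumes "CARD('n) \<ge> 3"
    and "subscheme_ideal I_Z" and "has_proj_dim I_Z 0"
    and "is_r 2 I_Z r" and "r < d"
    and "s = delta_hilbert I_Z d"
    and "delta_hilbert I_Z d = delta_hilbert I_Z (d + 1)"
    and "delta_hilbert I_Z (d + 1) > delta_hilbert I_Z (d + 2)"
    and "unmixed_curve_part (ideal_le d I_Z) I_C"
    and "reduced_subscheme I_C" and "irreducible_subscheme I_C"
  shows "(I_C \<subseteq> I_Z \<longrightarrow>
            (\<forall>t\<ge>d + 1. delta_hilbert I_Z t > 0 \<longrightarrow>
               delta_hilbert I_Z t > delta_hilbert I_Z (t + 1))) \<and>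
         (reduced_subscheme I_Z \<and> uniform_position I_Z \<longrightarrow>
            (\<forall>t\<ge>d + 1. delta_hilbert I_Z t > 0 \<longrightarrow>
               delta_hilbert I_Z t > delta_hilbert I_Z (t + 1)))"
proof -
  have I: "homogeneous_ideal I_Z" "saturation I_Z = I_Z"
    using assms(2) by (auto simp: subscheme_ideal_def)
  have "delta_hilbert I_Z (t + 1) < delta_hilbert I_Z t"
    if t: "d + 1 \<le> t" and pos: "0 < delta_hilbert I_Z t" for t
  proof (rule ccontr)
    assume neg: "\<not> ?thesis"
    have dec: "delta_hilbert I_Z (Suc k) \<le> delta_hilbert I_Z k" if "d \<le> k" for k
      using that assms(5) by (intro delta_hilbert_decreasing[OF I assms(4)]) simp
    have flat: "delta_hilbert I_Z (Suc t) = delta_hilbert I_Z t"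
      using dec[of t] neg t by force
    \<comment> \<open>The strict drop after \<open>d + 1\<close> rules out a flat step there, so
      monotonicity puts the value at \<open>t\<close> below \<open>s\<close>: two flat steps at
      different heights.\<close>
    then have "t \<noteq> d + 1" using assms(8) by auto
    then have "d + 2 \<le> t" using t by simp
    then have "delta_hilbert I_Z t \<le> delta_hilbert I_Z (d + 2)"
      by (induction t rule: dec_induct) (auto intro: order_trans[OF dec])
    then have "delta_hilbert I_Z t < delta_hilbert I_Z d" using assms(7,8) by simp
    then show False
      using delta_hilbert_no_later_flat[OF I assms(4,5) _ assms(9-11) _ flat pos] assms(7) t by simp
  qed
  then show ?thesis by blast
qed

end
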